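(* For any increasing real sequence $T=\{t_n\}$ with $|t_n|\to\infty$ as $|n|\to\infty$, there exists a positive measure $\mu=\sum_n\mu_n\delta_{t_n}$ with $\sum_n\mu_n/(t_n^2+1)<\infty$ such that the de Branges space with spectral data $(T,\mu)$ contains an $M$-basis of reproducing kernels $\{k_\lambda\}_{\lambda\in\Lambda}$ with $\operatorname{def}(\Lambda_1,\Lambda_2)=\infty$ for some partition $\Lambda=\Lambda_1\cup\Lambda_2$.
   Context: Given an increasing real sequence $T=\{t_n\}$ with $|t_n|\to\infty$, positive $\mu_n$ with $\sum_n\mu_n/(t_n^2+1)<\infty$, and a real-on-$\mathbb R$ entire function $A$ with simple zeros exactly at $T$, the de Branges space with spectral data $(T,\mu)$ is the space of entire functions $F(z)=A(z)\sum_n a_n\mu_n^{1/2}/(z-t_n)$, $\{a_n\}\in\ell^2$, with $\|F\|=\pi\|\{a_n\}\|_{\ell^2}$; it is a de Branges space $\mathcal H(E)$ (with $E$ Hermite–Biehler, $(E+E^* )/2=A$), i.e. a reproducing kernel Hilbert space of entire functions; $k_w$ denotes its reproducing kernel at $w$. A system in a Hilbert space is exact if complete and minimal; an $M$-basis if also its biorthogonal system is complete. If $\{k_\lambda\}_{\lambda\in\Lambda}$ is exact, its generating function $G$ is entire with simple zeros exactly at $\Lambda$, $G\notin\mathcal H(E)$, and $g_\lambda:=G/(z-\lambda)\in\mathcal H(E)$; $\{g_\lambda\}$ is (up to normalization) the biorthogonal system. For a disjoint partition $\Lambda=\Lambda_1\cup\Lambda_2$, $\operatorname{def}(\Lambda_1,\Lambda_2)=\dim(\{g_\lambda\}_{\lambda\in\Lambda_1}\cup\{k_\lambda\}_{\lambda\in\Lambda_2})^\perp$.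 *)

theory Defs
  imports "HOL-Analysis.Analysis"
begin

text \<open>An increasing real sequence with |t_n| tending to infinity is represented by its
  range T: an infinite subset of the reals with only finitely many points in every
  bounded interval.  Quantities indexed by n are indexed by the points t of T.\<close>

definition spectral_seq :: "real set \<Rightarrow> bool" where
  "spectral_seq T \<longleftrightarrow> infinite T \<and> (\<forall>r. finite {t \<in> T. \<bar>t\<bar> \<le> r})"

definition dB_admissible :: "real set \<Rightarrow> (complex \<Rightarrow> complex) \<Rightarrow> bool" where
  "dB_admissible T A \<longleftrightarrow> A holomorphic_on UNIV \<and> (\<forall>x::real. A (of_real x) \<in> \<real>)
     \<and> (\<forall>z. A z = 0 \<longleftrightarrow> z \<in> of_real ` T) \<and> (\<forall>t\<in>T. deriv A (of_real t) \<noteq> 0)"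

definition l2_on :: "real set \<Rightarrow> (real \<Rightarrow> complex) \<Rightarrow> bool" where
  "l2_on T a \<longleftrightarrow> (\<lambda>t. (norm (a t))\<^sup>2) summable_on T \<and> (\<forall>t. t \<notin> T \<longrightarrow> a t = 0)"

definition dB_rep :: "real set \<Rightarrow> (real \<Rightarrow> real) \<Rightarrow> (complex \<Rightarrow> complex)
    \<Rightarrow> (real \<Rightarrow> complex) \<Rightarrow> (complex \<Rightarrow> complex) \<Rightarrow> bool" where
  "dB_rep T \<mu> A a F \<longleftrightarrow> l2_on T a \<and> F holomorphic_on UNIV \<and>
     (\<forall>z. z \<notin> of_real ` T \<longrightarrow>
        F z = A z * infsum (\<lambda>t. a t * of_real (sqrt (\<mu> t)) / (z - of_real t)) T)"

definition dB_space :: "real set \<Rightarrow> (real \<Rightarrow> real) \<Rightarrow> (complex \<Rightarrow> complex)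
    \<Rightarrow> (complex \<Rightarrow> complex) set" where
  "dB_space T \<mu> A = {F. \<exists>a. dB_rep T \<mu> A a F}"

definition dB_coef :: "real set \<Rightarrow> (real \<Rightarrow> real) \<Rightarrow> (complex \<Rightarrow> complex)
    \<Rightarrow> (complex \<Rightarrow> complex) \<Rightarrow> real \<Rightarrow> complex" where
  "dB_coef T \<mu> A F = (THE a. dB_rep T \<mu> A a F)"

definition dB_inner :: "real set \<Rightarrow> (real \<Rightarrow> real) \<Rightarrow> (complex \<Rightarrow> complex)
    \<Rightarrow> (complex \<Rightarrow> complex) \<Rightarrow> (complex \<Rightarrow> complex) \<Rightarrow> complex" where
  "dB_inner T \<mu> A F G =
     of_real (pi\<^sup>2) * infsum (\<lambda>t. dB_coef T \<mu> A F t * cnj (dB_coef T \<mu> A G t)) T"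

definition dB_kernel :: "real set \<Rightarrow> (real \<Rightarrow> real) \<Rightarrow> (complex \<Rightarrow> complex)
    \<Rightarrow> complex \<Rightarrow> (complex \<Rightarrow> complex)" where
  "dB_kernel T \<mu> A w = (THE k. k \<in> dB_space T \<mu> A \<and>
       (\<forall>F\<in>dB_space T \<mu> A. dB_inner T \<mu> A F k = F w))"

definition fspan :: "(complex \<Rightarrow> complex) set \<Rightarrow> (complex \<Rightarrow> complex) set" where
  "fspan S = {G. \<exists>(n::nat) c f. (\<forall>i<n. f i \<in> S) \<and> G = (\<lambda>z. \<Sum>i<n. c i * f i z)}"

definition clspan :: "(complex \<Rightarrow> complex) set
    \<Rightarrow> ((complex \<Rightarrow> complex) \<Rightarrow> (complex \<Rightarrow> complex) \<Rightarrow> complex)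
    \<Rightarrow> (complex \<Rightarrow> complex) set \<Rightarrow> (complex \<Rightarrow> complex) set" where
  "clspan H inn S = {F \<in> H. \<forall>e>0. \<exists>G\<in>fspan S.
      sqrt (Re (inn (\<lambda>z. F z - G z) (\<lambda>z. F z - G z))) < e}"

definition complete_sys where
  "complete_sys H inn S \<longleftrightarrow> S \<subseteq> H \<and> H \<subseteq> clspan H inn S"

definition minimal_fam where
  "minimal_fam H inn \<Lambda> k \<longleftrightarrow>
     (\<forall>l\<in>\<Lambda>. k l \<in> H \<and> k l \<notin> clspan H inn (k ` (\<Lambda> - {l})))"

definition exact_fam where
  "exact_fam H inn \<Lambda> k \<longleftrightarrow> complete_sys H inn (k ` \<Lambda>) \<and> minimal_fam H inn \<Lambda> k"

definition biorth_fam where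
  "biorth_fam H inn \<Lambda> k g \<longleftrightarrow>
     (\<forall>l\<in>\<Lambda>. g l \<in> H \<and> (\<forall>\<nu>\<in>\<Lambda>. inn (g l) (k \<nu>) = (if l = \<nu> then 1 else 0)))"

definition M_basis_fam where
  "M_basis_fam H inn \<Lambda> k \<longleftrightarrow> exact_fam H inn \<Lambda> k \<and>
     (\<exists>g. biorth_fam H inn \<Lambda> k g \<and> complete_sys H inn (g ` \<Lambda>))"

definition orth_compl where
  "orth_compl H inn S = {F \<in> H. \<forall>G\<in>S. inn F G = 0}"

definition infinite_dim :: "(complex \<Rightarrow> complex) set \<Rightarrow> bool" where
  "infinite_dim V \<longleftrightarrow> (\<forall>n::nat. \<exists>f. (\<forall>i<n. f i \<in> V) \<and>
      (\<forall>c. (\<lambda>z. \<Sum>i<n. c i * f i z) = (\<lambda>z. 0) \<longrightarrow> (\<forall>i<n. c i = 0)))"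

text \<open>def(Lambda1, Lambda2) = infinity, with g the biorthogonal system (the g_lambda = G/(z-lambda)
  up to normalization, which does not change the orthogonal complement).\<close>
definition defect_infinite where
  "defect_infinite H inn \<Lambda>1 \<Lambda>2 k g \<longleftrightarrow> infinite_dim (orth_compl H inn (g ` \<Lambda>1 \<union> k ` \<Lambda>2))"

end

theory Submission
  imports Defs "HOL-Complex_Analysis.Complex_Analysis"
begin

text \<open>In the coordinates of the space, the kernel at a point \<open>\<gamma>\<close> off \<open>T\<close> is proportional to the
  Cauchy vector \<open>(\<surd>\<mu>\<^sub>t / (\<gamma> - t))\<close>, and the kernel at a point of \<open>T\<close> to a unit vector. Putting into \<open>\<Lambda>\<close>
  all points of \<open>T\<close> outside an extremely sparse sequence \<open>t\<^sub>n\<close> of elements of \<open>T\<close>, one is left with a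
  problem on that sequence: find weights \<open>v\<^sub>n = \<surd>\<mu>\<^sub>n\<close> and \<open>u\<^sub>n\<close> such that the vectors \<open>(v\<^sub>n / (t\<^sub>n - \<gamma>))\<close>
  and \<open>(u\<^sub>n / (t\<^sub>n - \<gamma>))\<close> form two complete biorthogonal systems, together with infinitely many vectors
  orthogonal to a mixture of the two.

  The weights come from four products with simple poles at the \<open>t\<^sub>n\<close> satisfying \<open>\<phi>\<^sub>1 \<phi>\<^sub>2 = \<psi> \<beta>\<close>. The
  residues of \<open>\<beta>\<close> are \<open>b\<^sub>n\<^sup>2\<close>, and those of \<open>\<phi>\<^sub>2\<close>, \<open>\<phi>\<^sub>1\<close>, \<open>\<psi>\<close> are \<open>b\<^sub>n v\<^sub>n\<close>, \<open>b\<^sub>n u\<^sub>n\<close>, \<open>u\<^sub>n v\<^sub>n\<close>. The zeros of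
  \<open>\<psi>\<close> are the points \<open>\<gamma>\<close>; each of them is a zero of \<open>\<phi>\<^sub>1\<close> or of \<open>\<phi>\<^sub>2\<close>, which determines its side in the
  partition. Infinitely many poles of \<open>\<phi>\<^sub>1\<close> and of \<open>\<phi>\<^sub>2\<close> are not accompanied by a zero, so these functions
  decay faster than any power between the poles. Hence the residue sums vanish even with an extra factor
  \<open>t\<^sub>n\<^sup>k\<close>, and all the vectors \<open>(b\<^sub>n t\<^sub>n\<^sup>k)\<close> are orthogonal to the mixed system. Accompanied poles are nevertheless
  in the majority, and near them one of \<open>u\<^sub>n\<close>, \<open>v\<^sub>n\<close> is large, which forces both systems to be complete.
  Every identity needed is a limit of finite partial fraction expansions.\<close>

section \<open>Partial fractions and products close to one\<close>

text \<open>Three demands compete. Orthogonality with every \<open>t n ^ k\<close> needs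
  \<open>b n\<close> superpolynomially small; \<open>v n ^ 2\<close> and \<open>u n ^ 2\<close> must
  be summable against \<open>1 / (t n ^ 2 + 1)\<close>; completeness needs \<open>v n\<close> to
  grow on \<open>N1\<close> and \<open>u n\<close> on \<open>N2\<close>. One device tunes all sizes:
  at an accompanied pole the residue is comparable to the distance from its zero divided by
  \<open>q\<close>, so a zero at a prescribed tiny distance prescribes the residue. At an
  unaccompanied pole no distance is free and the residue has order
  \<open>\<bar>t n\<bar> / q\<close>; taking \<open>b n\<close> of order \<open>1 / sqrt q\<close>,
  up to exponential factors, keeps both \<open>b n\<close> and the quotient small. The points of
  \<open>T\<close> off the sparse sequence get geometric weights. Biorthogonal elements belonging to
  them need a correction by a unit vector whose coefficient contains a value of
  \<open>\<psi>\<close>; that this value is nonzero is not computed but deduced from completeness of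
  the kernels. \<open>A\<close> enters the kernels only through nonzero scalar factors, so one
  \<open>\<mu>\<close> serves every admissible \<open>A\<close>.\<close>

lemma partial_fraction_expansion:
  fixes Q :: "real poly" and a :: "'i \<Rightarrow> real"
  assumes fin: "finite I" and inj: "inj_on a I" and deg: "degree Q < card I"
    and z: "\<And>i. i \<in> I \<Longrightarrow> z \<noteq> a i"
  shows "poly Q z / (\<Prod>i\<in>I. z - a i) =
    (\<Sum>i\<in>I. poly Q (a i) / (\<Prod>j\<in>I - {i}. a i - a j) / (z - a i))"
proof -
  define L where "L i = (\<Prod>j\<in>I - {i}. [:- a j, 1:])" for i
  define c where "c i = poly Q (a i) / (\<Prod>j\<in>I - {i}. a i - a j)" for i
  have L: "poly (L i) x = (\<Prod>j\<in>I - {i}. x - a j)" for i x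
    by (simp add: L_def poly_prod)
  have nz: "(\<Prod>j\<in>I - {i}. a i - a j) \<noteq> 0" if "i \<in> I" for i
    using fin inj that by (auto simp: inj_on_def)
  have degL: "degree (L i) < card I" if "i \<in> I" for i
  proof -
    have "degree (L i) \<le> sum (degree \<circ> (\<lambda>j. [:- a j, 1:])) (I - {i})"
      unfolding L_def by (rule degree_prod_sum_le) (use fin in auto)
    also have "\<dots> = card (I - {i})" by simp
    also have "\<dots> < card I" using fin that by (metis card_Diff1_less)
    finally show ?thesis .
  qed
  have "Q = (\<Sum>i\<in>I. smult (c i) (L i))"
  proof (rule poly_eqI_degree)
    fix x assume "x \<in> a ` I"
    then obtain k where k: "k \<in> I" "x = a k" by auto
    have "poly (\<Sum>i\<in>I. smult (c i) (L i)) x = (\<Sum>i\<in>I. c i * (\<Prod>j\<in>I - {i}. a k - a j))"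
      by (simp add: poly_sum L k)
    also have "\<dots> = (\<Sum>i\<in>I. if i = k then poly Q (a k) else 0)"
    proof (rule sum.cong)
      fix i assume i: "i \<in> I"
      show "c i * (\<Prod>j\<in>I - {i}. a k - a j) = (if i = k then poly Q (a k) else 0)"
      proof (cases "i = k")
        case True then show ?thesis using nz[OF i] by (simp add: c_def)
      next
        case False
        then have "(\<Prod>j\<in>I - {i}. a k - a j) = 0" using fin k by auto
        then show ?thesis using False by simp
      qed
    qed simp
    also have "\<dots> = poly Q x" using fin k by simp
    finally show "poly Q x = poly (\<Sum>i\<in>I. smult (c i) (L i)) x" ..
  next
    show "degree Q < card (a ` I)" using deg inj by (simp add: card_image)
    have "degree (\<Sum>i\<in>I. smult (c i) (L i)) < card I"
      by (rule degree_sum_less) (use degL deg in \<open>auto intro: le_less_trans[OF degree_smult_le]\<close>)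
    then show "degree (\<Sum>i\<in>I. smult (c i) (L i)) < card (a ` I)" using inj by (simp add: card_image)
  qed
  then have "poly Q z = (\<Sum>i\<in>I. c i * (\<Prod>j\<in>I - {i}. z - a j))"
    by (metis (no_types, lifting) L poly_smult poly_sum sum.cong)
  moreover have "(\<Prod>j\<in>I - {i}. z - a j) / (\<Prod>i\<in>I. z - a i) = 1 / (z - a i)" if "i \<in> I" for i
  proof -
    have "(\<Prod>i\<in>I. z - a i) = (z - a i) * (\<Prod>j\<in>I - {i}. z - a j)"
      using fin that by (rule prod.remove)
    moreover have "(\<Prod>j\<in>I - {i}. z - a j) \<noteq> 0" using fin z by auto
    ultimately show ?thesis by simp
  qed
  ultimately have "poly Q z / (\<Prod>i\<in>I. z - a i) = (\<Sum>i\<in>I. c i * (1 / (z - a i)))"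
    by (simp add: sum_divide_distrib flip: times_divide_eq_right)
  then show ?thesis by (simp add: c_def)
qed

text \<open>The bounds \<open>(1/2)^(j+3)\<close> sum to 1/4 over all \<open>j\<close>, so the
  constants 1/2 and 2 are the same for every finite index set. This uniformity is what survives the
  limit of infinitely many factors.\<close>

lemma prod_one_plus_small:
  fixes \<theta> :: "nat \<Rightarrow> real"
  assumes fin: "finite S" and \<theta>: "\<And>j. j \<in> S \<Longrightarrow> \<bar>\<theta> j\<bar> \<le> (1/2)^(j+3)"
  shows "1/2 \<le> (\<Prod>j\<in>S. 1 + \<theta> j)" "(\<Prod>j\<in>S. 1 + \<theta> j) \<le> 2"
proof -
  have "summable (\<lambda>j. (1/2)^(j+3) :: real)"
    by (intro summable_ignore_initial_segment summable_geometric) auto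
  then have "(\<Sum>j\<in>S. (1/2)^(j+3)) \<le> (\<Sum>j. (1/2::real)^(j+3))"
    by (rule sum_le_suminf) (use fin in auto)
  also have "\<dots> = 1/4"
    using suminf_split_initial_segment[of "\<lambda>j. (1/2::real)^j" 3]
    by (simp add: summable_geometric suminf_geometric lessThan_nat_numeral eval_nat_numeral)
  finally have S: "(\<Sum>j\<in>S. (1/2::real)^(j+3)) \<le> 1/4" .
  \<comment> \<open>Weierstrass' product inequality; nonnegativity is carried along so that the
    induction step may multiply inequalities.\<close>
  have lo: "1 - (\<Sum>j\<in>A. (1/2::real)^(j+3)) \<le> (\<Prod>j\<in>A. 1 + \<theta> j) \<and> 0 \<le> (\<Prod>j\<in>A. 1 + \<theta> j)"
    if "finite A" "A \<subseteq> S" for A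
    using that
  proof (induction A rule: finite_induct)
    case (insert k A)
    let ?P = "\<Prod>j\<in>A. 1 + \<theta> j" and ?s = "\<Sum>j\<in>A. (1/2::real)^(j+3)" and ?h = "(1/2::real)^(k+3)"
    have IH: "1 - ?s \<le> ?P" "0 \<le> ?P" using insert by auto
    have k: "- ?h \<le> \<theta> k" using \<theta>[of k] insert.prems by auto
    have h: "0 \<le> ?h" "?h \<le> 1" by (auto intro: power_le_one)
    have s: "0 \<le> ?s" by (intro sum_nonneg) auto
    have "1 - (?h + ?s) \<le> (1 - ?h) * (1 - ?s)" using h s by (simp add: algebra_simps)
    also have "\<dots> \<le> (1 - ?h) * ?P" using IH h by (intro mult_left_mono) auto
    also have "\<dots> \<le> (1 + \<theta> k) * ?P" using IH k by (intro mult_right_mono) auto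
    finally have "1 - (?h + ?s) \<le> (1 + \<theta> k) * ?P" .
    moreover have "0 \<le> (1 + \<theta> k) * ?P" using IH k h by (intro mult_nonneg_nonneg) auto
    ultimately show ?case
      unfolding prod.insert[OF insert.hyps(1,2)] sum.insert[OF insert.hyps(1,2)] by blast
  qed auto
  from lo[OF fin order_refl] S show "1/2 \<le> (\<Prod>j\<in>S. 1 + \<theta> j)" by linarith
  have "(\<Prod>j\<in>S. 1 + \<theta> j) \<le> (\<Prod>j\<in>S. exp ((1/2)^(j+3)))"
  proof (rule prod_mono)
    fix j assume j: "j \<in> S"
    have "\<bar>\<theta> j\<bar> \<le> (1/2)^(j+3)" "(1/2::real)^(j+3) \<le> 1" using \<theta>[OF j] by (auto intro: power_le_one)
    then show "0 \<le> 1 + \<theta> j \<and> 1 + \<theta> j \<le> exp ((1/2)^(j+3))"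
      using exp_ge_add_one_self[of "(1/2)^(j+3)"] by linarith
  qed
  also have "\<dots> = exp (\<Sum>j\<in>S. (1/2)^(j+3))" using fin by (simp add: exp_sum)
  also have "\<dots> \<le> exp (1/4)" using S by simp
  also have "\<dots> \<le> 2" using exp_bound[of "1/4"] by (simp add: power2_eq_square)
  finally show "(\<Prod>j\<in>S. 1 + \<theta> j) \<le> 2" .
qed

lemma convergent_prod_one_plus_small:
  fixes \<theta> :: "nat \<Rightarrow> real"
  assumes \<theta>: "\<And>j. \<bar>\<theta> j\<bar> \<le> (1/2)^(j+3)"
  shows "convergent (\<lambda>K. \<Prod>j<K. 1 + \<theta> j)"
proof -
  have "summable (\<lambda>j. (1/2)^(j+3) :: real)"
    by (intro summable_ignore_initial_segment summable_geometric) auto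
  then have "summable (\<lambda>j. norm ((1 + \<theta> j) - 1))"
    by (rule summable_comparison_test'[where N=0]) (use \<theta> in simp)
  then have "convergent_prod (\<lambda>j. 1 + \<theta> j)"
    by (intro abs_convergent_prod_imp_convergent_prod summable_imp_abs_convergent_prod)
  then have "(\<lambda>K. \<Prod>j\<le>K. 1 + \<theta> j) \<longlonglongrightarrow> prodinf (\<lambda>j. 1 + \<theta> j)"
    by (rule convergent_prod_LIMSEQ)
  then have "(\<lambda>K. \<Prod>j<K. 1 + \<theta> j) \<longlonglongrightarrow> prodinf (\<lambda>j. 1 + \<theta> j)"
    by (intro LIMSEQ_imp_Suc[of "\<lambda>K. \<Prod>j<K. 1 + \<theta> j"]) (simp only: lessThan_Suc_atMost)
  then show ?thesis by (rule convergentI)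
qed

section \<open>Residues of products along a sparse sequence\<close>

locale sparse =
  fixes t :: "nat \<Rightarrow> real"
  assumes growth: "4^(n+2) * (\<Prod>i<n. \<bar>t i\<bar>)\<^sup>2 \<le> \<bar>t n\<bar>"
begin

section \<open>Geometry of the sparse nodes\<close>

lemma one_le_prod_abs_t: "1 \<le> (\<Prod>i<n. \<bar>t i\<bar>)"
proof (induction n)
  case (Suc n)
  have "1 * 1 \<le> 4^(n+2) * (\<Prod>i<n. \<bar>t i\<bar>)\<^sup>2"
    by (intro mult_mono) (use Suc in \<open>auto simp: power2_eq_square intro!: one_le_power mult_ge1_I\<close>)
  also note growth
  finally have "1 * 1 \<le> (\<Prod>i<n. \<bar>t i\<bar>) * \<bar>t n\<bar>" using Suc by (intro mult_mono) auto
  then show ?case by simp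
qed simp

lemma abs_t_ge: "4^(n+2) \<le> \<bar>t n\<bar>"
proof -
  have "4^(n+2) * 1 \<le> 4^(n+2) * (\<Prod>i<n. \<bar>t i\<bar>)\<^sup>2"
    using one_le_prod_abs_t by (intro mult_left_mono) (auto intro: one_le_power)
  then show ?thesis using growth[of n] by linarith
qed

lemma one_le_abs_t: "1 \<le> \<bar>t n\<bar>"
  using abs_t_ge[of n] one_le_power[of "4::real" "n+2"] by linarith

lemma t_nonzero [simp]: "t n \<noteq> 0"
  using one_le_abs_t[of n] by auto

text \<open>One node outweighs the product of all preceding ones, so a single power of
  \<open>\<bar>t n\<bar>\<close> pays for every earlier numerator.\<close>

lemma prod_abs_t_le: "4^(n+2) * (\<Prod>i<n. \<bar>t i\<bar>) \<le> \<bar>t n\<bar>"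
proof -
  have "4^(n+2) * (\<Prod>i<n. \<bar>t i\<bar>) \<le> 4^(n+2) * (\<Prod>i<n. \<bar>t i\<bar>)\<^sup>2"
    using one_le_prod_abs_t[of n] by (intro mult_left_mono self_le_power) auto
  then show ?thesis using growth[of n] by linarith
qed

lemma prod_subset_abs_t_le:
  assumes "S \<subseteq> {..<n}"
  shows "1 \<le> (\<Prod>i\<in>S. \<bar>t i\<bar>)" "(\<Prod>i\<in>S. \<bar>t i\<bar>) \<le> (\<Prod>i<n. \<bar>t i\<bar>)"
  using assms by (auto intro!: prod_ge_1 prod_mono2 simp: one_le_abs_t)

lemma t_gap:
  assumes "j < n" shows "4^(n+2) * \<bar>t j\<bar> \<le> \<bar>t n\<bar>"
proof -
  have "\<bar>t j\<bar> \<le> (\<Prod>i<n. \<bar>t i\<bar>)" using prod_subset_abs_t_le(2)[of "{j}" n] assms by simp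
  then have "4^(n+2) * \<bar>t j\<bar> \<le> 4^(n+2) * (\<Prod>i<n. \<bar>t i\<bar>)" by simp
  then show ?thesis using prod_abs_t_le[of n] by linarith
qed

lemma t_gap2: assumes "j < n" shows "2 * \<bar>t j\<bar> \<le> \<bar>t n\<bar>"
proof -
  have "(2::real) \<le> 4 ^ 1" by simp
  also have "\<dots> \<le> 4^(n+2)" by (rule power_increasing) auto
  finally have "2 * \<bar>t j\<bar> \<le> 4^(n+2) * \<bar>t j\<bar>" by (intro mult_right_mono) auto
  then show ?thesis using t_gap[OF assms] by linarith
qed

text \<open>Moduli of distinct nodes differ at least by a factor 2, so the difference is comparable
  to the larger one. The bound 8 exceeds twice the displacement 1 allowed by
  \<open>near_le_1\<close>, so displaced nodes remain distinct.\<close>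

lemma t_dist:
  assumes "j \<noteq> n"
  shows "\<bar>t n\<bar> / 2 \<le> \<bar>t n - t j\<bar>" "\<bar>t j\<bar> / 2 \<le> \<bar>t n - t j\<bar>" "8 \<le> \<bar>t n - t j\<bar>"
proof -
  have "2 * \<bar>t j\<bar> \<le> \<bar>t n\<bar> \<or> 2 * \<bar>t n\<bar> \<le> \<bar>t j\<bar>" using assms t_gap2 by (metis nat_neq_iff)
  then show 1: "\<bar>t n\<bar> / 2 \<le> \<bar>t n - t j\<bar>" and "\<bar>t j\<bar> / 2 \<le> \<bar>t n - t j\<bar>" by linarith+
  have "(16::real) \<le> 4^(n+2)" using one_le_power[of "4::real" n] by (simp add: power_add)
  then show "8 \<le> \<bar>t n - t j\<bar>" using 1 abs_t_ge[of n] by linarith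
qed

lemma t_eq_iff [simp]: "t i = t j \<longleftrightarrow> i = j"
  using t_dist(3)[of i j] by force

lemma inj_t: "inj t"
  by (auto simp: inj_on_def)

text \<open>The factor at \<open>j\<close> has the pole \<open>t j\<close>. For \<open>j \<notin> M\<close> it has the zero \<open>\<zeta> j\<close> and tends to 1 at infinity; for
  \<open>j \<in> M\<close> it equals \<open>1 / (1 - z / t j)\<close>, and \<open>\<zeta> j\<close> is irrelevant. Thus \<open>resK\<close> and \<open>res\<close> are the residues at
  \<open>t n\<close> of the product over \<open>j < K\<close> and over all \<open>j\<close>. At \<open>t n\<close> the factor at \<open>j \<noteq> n\<close> is \<open>wt\<close> up to the
  relative error \<open>dev\<close>.\<close>

definition fac :: "nat set \<Rightarrow> (nat \<Rightarrow> real) \<Rightarrow> nat \<Rightarrow> real \<Rightarrow> real" where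
  "fac M \<zeta> j z = (if j \<in> M then - t j else z - \<zeta> j) / (z - t j)"

text \<open>The residue at \<open>t n\<close> of the factor with index \<open>n\<close>
  itself.\<close>

definition head :: "nat set \<Rightarrow> (nat \<Rightarrow> real) \<Rightarrow> nat \<Rightarrow> real" where
  "head M \<zeta> n = (if n \<in> M then - t n else t n - \<zeta> n)"

definition wt :: "nat set \<Rightarrow> nat \<Rightarrow> nat \<Rightarrow> real" where
  "wt M n j = (if j \<in> M \<and> j < n then - t j / t n else 1)"

definition dev :: "nat set \<Rightarrow> (nat \<Rightarrow> real) \<Rightarrow> nat \<Rightarrow> nat \<Rightarrow> real" where
  "dev M \<zeta> n j = fac M \<zeta> j (t n) / wt M n j - 1"

definition near :: "(nat \<Rightarrow> real) \<Rightarrow> bool" where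
  "near \<zeta> \<longleftrightarrow> (\<forall>j. \<bar>\<zeta> j - t j\<bar> \<le> (1/4)^(j+2))"

text \<open>The reciprocal modulus of the product of all \<open>wt M n j\<close>: the decay at
  \<open>t n\<close> caused by the unaccompanied poles before it.\<close>

definition q :: "nat set \<Rightarrow> nat \<Rightarrow> real" where
  "q M n = (\<Prod>j\<in>M \<inter> {..<n}. \<bar>t n\<bar> / \<bar>t j\<bar>)"

definition resK :: "nat set \<Rightarrow> (nat \<Rightarrow> real) \<Rightarrow> nat \<Rightarrow> nat \<Rightarrow> real" where
  "resK M \<zeta> K n = head M \<zeta> n * (\<Prod>j\<in>{..<K} - {n}. fac M \<zeta> j (t n))"

definition res :: "nat set \<Rightarrow> (nat \<Rightarrow> real) \<Rightarrow> nat \<Rightarrow> real" where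
  "res M \<zeta> n = lim (\<lambda>K. resK M \<zeta> K n)"

lemma q_ge_1: "1 \<le> q M n"
  unfolding q_def
proof (rule prod_ge_1)
  fix j assume "j \<in> M \<inter> {..<n}"
  then have "2 * \<bar>t j\<bar> \<le> \<bar>t n\<bar>" by (intro t_gap2) auto
  then show "1 \<le> \<bar>t n\<bar> / \<bar>t j\<bar>" by (simp add: field_simps)
qed

lemma q_pos [simp]: "0 < q M n"
  using q_ge_1[of M n] by linarith

section \<open>Size and convergence of residues\<close>

lemma quarter_le: "j \<le> n \<Longrightarrow> 2 * (1/4::real)^(n+2) \<le> (1/2)^(j+3)"
proof -
  assume "j \<le> n"
  have "(1/4::real) = (1/2)^2" by (simp add: power2_eq_square)
  moreover have "2 * (n+2) = Suc (2*n+3)" by simp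
  ultimately have "2 * (1/4::real)^(n+2) = 2 * (1/2)^Suc (2*n+3)"
    by (simp only: power_mult[symmetric])
  also have "\<dots> = (1/2)^(2*n+3)" unfolding power_Suc mult.assoc[symmetric] by simp
  also have "\<dots> \<le> (1/2)^(j+3)" using \<open>j \<le> n\<close> by (intro power_decreasing) auto
  finally show ?thesis .
qed

lemma t_ratio_le:
  assumes "j < n" shows "\<bar>t j\<bar> / \<bar>t n\<bar> \<le> (1/4)^(n+2)"
  using t_gap[OF assms] by (simp add: field_simps)

lemma wt_nonzero [simp]: "wt M n j \<noteq> 0"
  by (simp add: wt_def)

text \<open>Three regimes. At an accompanied pole the error is the displacement of the zero over a
  distance of at least 8. An unaccompanied factor is close to 1 if its pole lies far beyond
  \<open>t n\<close>, and close to \<open>- t j / t n\<close> if it lies far inside; both errors are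
  at most twice a ratio of nodes.\<close>

lemma dev_bound:
  assumes near: "near \<zeta>" and nj: "n \<noteq> j"
  shows "\<bar>dev M \<zeta> n j\<bar> \<le> (1/2)^(j+3)"
proof -
  have ne: "t n - t j \<noteq> 0" using nj by simp
  consider "j \<notin> M" | "j \<in> M" "n < j" | "j \<in> M" "j < n" using nj by linarith
  then show ?thesis
  proof cases
    case 1
    then have "dev M \<zeta> n j = (t j - \<zeta> j) / (t n - t j)"
      using ne by (simp add: dev_def wt_def fac_def field_simps)
    moreover have "\<bar>t j - \<zeta> j\<bar> / \<bar>t n - t j\<bar> \<le> (1/4)^(j+2) / 1"
      using near t_dist(3)[of j n] nj
      by (intro frac_le) (auto simp: near_def abs_minus_commute)
    moreover have "0 \<le> (1/4::real)^(j+2)" by simp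
    ultimately show ?thesis using quarter_le[of j j] by (simp only: abs_divide) linarith
  next
    case 2
    then have "dev M \<zeta> n j = - t n / (t n - t j)"
      using ne by (simp add: dev_def wt_def fac_def field_simps)
    moreover have "\<bar>t n\<bar> / \<bar>t n - t j\<bar> \<le> \<bar>t n\<bar> / (\<bar>t j\<bar> / 2)"
      using t_dist(2)[of j n] nj by (intro divide_left_mono) auto
    moreover have "\<bar>t n\<bar> / (\<bar>t j\<bar> / 2) \<le> 2 * (1/4)^(j+2)" using t_ratio_le[OF 2(2)] by (simp add: mult.commute)
    ultimately show ?thesis using quarter_le[of j j]
      by (simp only: abs_divide abs_minus_cancel) linarith
  next
    case 3
    then have "dev M \<zeta> n j = t j / (t n - t j)"
      using ne by (simp add: dev_def wt_def fac_def field_simps)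
    moreover have "\<bar>t j\<bar> / \<bar>t n - t j\<bar> \<le> \<bar>t j\<bar> / (\<bar>t n\<bar> / 2)"
      using t_dist(1)[of j n] nj by (intro divide_left_mono) auto
    moreover have "\<bar>t j\<bar> / (\<bar>t n\<bar> / 2) \<le> 2 * (1/4)^(n+2)" using t_ratio_le[OF 3(2)] by (simp add: mult.commute)
    ultimately show ?thesis using quarter_le[of j n] 3(2)
      by (simp only: abs_divide) linarith
  qed
qed

lemma fac_eq: "fac M \<zeta> j (t n) = wt M n j * (1 + dev M \<zeta> n j)"
  by (simp add: dev_def)

lemma prod_wt:
  assumes "finite S" "M \<inter> {..<n} \<inter> S = R"
  shows "(\<Prod>j\<in>S. wt M n j) = (\<Prod>j\<in>R. - t j / t n)"
proof -
  have "(\<Prod>j\<in>S. wt M n j) = (\<Prod>j\<in>R. wt M n j)"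
    using assms by (intro prod.mono_neutral_right) (auto simp: wt_def)
  also have "\<dots> = (\<Prod>j\<in>R. - t j / t n)"
    using assms(2) by (intro prod.cong) (auto simp: wt_def)
  finally show ?thesis .
qed

text \<open>Splitting off the main terms \<open>wt\<close> leaves a product close to one. The
  general set \<open>S\<close> lets the same estimate serve residues, values at nodes beyond the
  truncation, and products of node differences.\<close>

lemma prod_fac_bounds:
  assumes near: "near \<zeta>" and fin: "finite S" and S: "n \<notin> S" and R: "M \<inter> {..<n} \<inter> S = R"
  shows "(\<Prod>j\<in>R. \<bar>t j\<bar> / \<bar>t n\<bar>) / 2 \<le> \<bar>\<Prod>j\<in>S. fac M \<zeta> j (t n)\<bar>"
    "\<bar>\<Prod>j\<in>S. fac M \<zeta> j (t n)\<bar> \<le> 2 * (\<Prod>j\<in>R. \<bar>t j\<bar> / \<bar>t n\<bar>)"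
proof -
  let ?P = "\<Prod>j\<in>S. 1 + dev M \<zeta> n j" and ?Q = "\<Prod>j\<in>R. \<bar>t j\<bar> / \<bar>t n\<bar>"
  have "(\<Prod>j\<in>S. fac M \<zeta> j (t n)) = (\<Prod>j\<in>R. - t j / t n) * ?P"
    by (simp add: fac_eq prod.distrib prod_wt[OF fin R])
  then have eq: "\<bar>\<Prod>j\<in>S. fac M \<zeta> j (t n)\<bar> = ?Q * \<bar>?P\<bar>"
    by (simp add: abs_mult abs_prod abs_divide)
  have dev: "\<bar>dev M \<zeta> n j\<bar> \<le> (1/2)^(j+3)" if "j \<in> S" for j
    using that S by (intro dev_bound[OF near]) auto
  have "1/2 \<le> ?P" "?P \<le> 2"
    using prod_one_plus_small[OF fin dev] by blast+
  then have P: "1/2 \<le> \<bar>?P\<bar>" "\<bar>?P\<bar> \<le> 2" by auto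
  have "0 \<le> ?Q" by (intro prod_nonneg) auto
  then show "?Q / 2 \<le> \<bar>\<Prod>j\<in>S. fac M \<zeta> j (t n)\<bar>" "\<bar>\<Prod>j\<in>S. fac M \<zeta> j (t n)\<bar> \<le> 2 * ?Q"
    unfolding eq using P mult_left_mono[of "1/2" "\<bar>?P\<bar>" ?Q] mult_left_mono[of "\<bar>?P\<bar>" 2 ?Q] by auto
qed

lemma inverse_q: "(\<Prod>j\<in>M \<inter> {..<n}. \<bar>t j\<bar> / \<bar>t n\<bar>) = 1 / q M n"
  by (simp add: q_def prod_dividef)

lemma resK_bounds:
  assumes "near \<zeta>" "n < K"
  shows "\<bar>head M \<zeta> n\<bar> / (2 * q M n) \<le> \<bar>resK M \<zeta> K n\<bar>"
    "\<bar>resK M \<zeta> K n\<bar> \<le> 2 * \<bar>head M \<zeta> n\<bar> / q M n"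
proof -
  have R: "M \<inter> {..<n} \<inter> ({..<K} - {n}) = M \<inter> {..<n}" using assms(2) by auto
  note b = prod_fac_bounds[OF assms(1) _ _ R, unfolded inverse_q]
  show "\<bar>head M \<zeta> n\<bar> / (2 * q M n) \<le> \<bar>resK M \<zeta> K n\<bar>"
    using mult_left_mono[OF b(1), of "\<bar>head M \<zeta> n\<bar>"] by (simp add: resK_def abs_mult mult.commute)
  show "\<bar>resK M \<zeta> K n\<bar> \<le> 2 * \<bar>head M \<zeta> n\<bar> / q M n"
    using mult_left_mono[OF b(2), of "\<bar>head M \<zeta> n\<bar>"] by (simp add: resK_def abs_mult mult.commute)
qed

lemma resK_tendsto:
  assumes "near \<zeta>"
  shows "(\<lambda>K. resK M \<zeta> K n) \<longlonglongrightarrow> res M \<zeta> n"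
proof -
  \<comment> \<open>Putting 0 at the excluded index turns the product into one over an initial
    segment.\<close>
  define \<theta> where "\<theta> j = (if j = n then 0 else dev M \<zeta> n j)" for j
  have "convergent (\<lambda>K. \<Prod>j<K. 1 + \<theta> j)"
    by (rule convergent_prod_one_plus_small) (use assms in \<open>auto simp: \<theta>_def intro: dev_bound\<close>)
  then have conv: "convergent (\<lambda>K. head M \<zeta> n * ((\<Prod>j\<in>M \<inter> {..<n}. - t j / t n) * (\<Prod>j<K. 1 + \<theta> j)))"
    by (intro convergent_mult convergent_const)
  have "\<forall>\<^sub>F K in sequentially. head M \<zeta> n * ((\<Prod>j\<in>M \<inter> {..<n}. - t j / t n) * (\<Prod>j<K. 1 + \<theta> j)) = resK M \<zeta> K n"
    using eventually_gt_at_top[of n]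
  proof eventually_elim
    case (elim K)
    have R: "M \<inter> {..<n} \<inter> ({..<K} - {n}) = M \<inter> {..<n}" using elim by auto
    have "(\<Prod>j\<in>{..<K} - {n}. fac M \<zeta> j (t n)) =
        (\<Prod>j\<in>M \<inter> {..<n}. - t j / t n) * (\<Prod>j\<in>{..<K} - {n}. 1 + dev M \<zeta> n j)"
      by (simp add: fac_eq prod.distrib prod_wt[OF _ R])
    also have "(\<Prod>j\<in>{..<K} - {n}. 1 + dev M \<zeta> n j) = (\<Prod>j<K. 1 + \<theta> j)"
      by (intro prod.mono_neutral_cong_left) (auto simp: \<theta>_def)
    finally show ?case by (simp add: resK_def)
  qed
  then have "convergent (\<lambda>K. resK M \<zeta> K n)"
    using conv convergent_cong by fastforce
  then show ?thesis by (simp add: res_def convergent_LIMSEQ_iff)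
qed

lemma res_bounds:
  assumes "near \<zeta>"
  shows "\<bar>head M \<zeta> n\<bar> / (2 * q M n) \<le> \<bar>res M \<zeta> n\<bar>" "\<bar>res M \<zeta> n\<bar> \<le> 2 * \<bar>head M \<zeta> n\<bar> / q M n"
proof -
  have l: "(\<lambda>K. \<bar>resK M \<zeta> K n\<bar>) \<longlonglongrightarrow> \<bar>res M \<zeta> n\<bar>" by (intro tendsto_rabs resK_tendsto assms)
  show "\<bar>head M \<zeta> n\<bar> / (2 * q M n) \<le> \<bar>res M \<zeta> n\<bar>"
    by (rule LIMSEQ_le_const[OF l]) (use resK_bounds(1)[OF assms] in \<open>blast intro: exI[of _ "Suc n"] Suc_le_lessD\<close>)
  show "\<bar>res M \<zeta> n\<bar> \<le> 2 * \<bar>head M \<zeta> n\<bar> / q M n"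
    by (rule LIMSEQ_le_const2[OF l]) (use resK_bounds(2)[OF assms] in \<open>blast intro: exI[of _ "Suc n"] Suc_le_lessD\<close>)
qed

text \<open>Once \<open>k + 1\<close> elements of \<open>M\<close> lie below \<open>n\<close>, the
  numerators of \<open>q\<close> contribute at least \<open>k + 1\<close> powers of
  \<open>\<bar>t n\<bar>\<close>, while all denominators together cost at most one power by
  sparseness.\<close>

lemma q_superpolynomial:
  assumes "infinite M"
  shows "\<forall>\<^sub>F n in sequentially. \<bar>t n\<bar> ^ k \<le> q M n"
proof -
  obtain A where A: "A \<subseteq> M" "finite A" "card A = Suc k"
    using infinite_arbitrarily_large[OF assms] by blast
  have "\<forall>\<^sub>F n in sequentially. A \<subseteq> {..<n}"
    using A(2) by (metis eventually_sequentiallyI finite_nat_iff_bounded lessThan_subset_iff order_trans)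
  then show ?thesis
  proof eventually_elim
    case (elim n)
    let ?S = "M \<inter> {..<n}"
    have "Suc k \<le> card ?S" using A elim by (metis Int_subset_iff card_mono finite_Int finite_lessThan)
    then have "\<bar>t n\<bar> ^ k * \<bar>t n\<bar> \<le> \<bar>t n\<bar> ^ card ?S"
      using power_increasing[of "Suc k" "card ?S" "\<bar>t n\<bar>"] one_le_abs_t by (simp add: mult.commute)
    moreover have P: "1 \<le> (\<Prod>i\<in>?S. \<bar>t i\<bar>)" "(\<Prod>i\<in>?S. \<bar>t i\<bar>) \<le> (\<Prod>i<n. \<bar>t i\<bar>)"
      using prod_subset_abs_t_le[of ?S n] by auto
    have "1 * (\<Prod>i<n. \<bar>t i\<bar>) \<le> 4^(n+2) * (\<Prod>i<n. \<bar>t i\<bar>)"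
      using one_le_prod_abs_t[of n] by (intro mult_right_mono one_le_power) auto
    then have "(\<Prod>i\<in>?S. \<bar>t i\<bar>) \<le> \<bar>t n\<bar>" using P(2) prod_abs_t_le[of n] by linarith
    then have "\<bar>t n\<bar> ^ k * (\<Prod>i\<in>?S. \<bar>t i\<bar>) \<le> \<bar>t n\<bar> ^ k * \<bar>t n\<bar>" by (intro mult_left_mono) auto
    ultimately have "\<bar>t n\<bar> ^ k * (\<Prod>i\<in>?S. \<bar>t i\<bar>) \<le> \<bar>t n\<bar> ^ card ?S" by linarith
    moreover have "0 < (\<Prod>i\<in>?S. \<bar>t i\<bar>)" using P(1) by linarith
    ultimately show ?case by (simp add: q_def prod_dividef pos_le_divide_eq)
  qed
qed

lemma summable_quarter: "summable (\<lambda>n. C / \<bar>t n\<bar>)"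
proof (rule summable_comparison_test')
  show "summable (\<lambda>n. \<bar>C\<bar> * (1/4)^n :: real)" by (intro summable_mult summable_geometric) auto
  fix n :: nat
  have "(4::real)^n \<le> 4^(n+2)" by (intro power_increasing) auto
  then have "4^n \<le> \<bar>t n\<bar>" using abs_t_ge[of n] by linarith
  then have "\<bar>C\<bar> / \<bar>t n\<bar> \<le> \<bar>C\<bar> / 4^n" by (intro divide_left_mono) auto
  then show "norm (C / \<bar>t n\<bar>) \<le> \<bar>C\<bar> * (1/4)^n" by (simp add: power_divide)
qed

lemma summable_power_div_q:
  assumes "infinite M"
  shows "summable (\<lambda>n. C * \<bar>t n\<bar> ^ k / q M n)"
proof -
  obtain N where N: "\<And>n. n \<ge> N \<Longrightarrow> \<bar>t n\<bar> ^ Suc k \<le> q M n"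
    using q_superpolynomial[OF assms, of "Suc k"] by (auto simp: eventually_sequentially)
  show ?thesis
  proof (rule summable_comparison_test'[OF summable_quarter[of "\<bar>C\<bar>"]])
    fix n assume "N \<le> n"
    have pos: "0 < \<bar>t n\<bar> ^ Suc k" by simp
    have "\<bar>C\<bar> * \<bar>t n\<bar> ^ k / q M n \<le> \<bar>C\<bar> * \<bar>t n\<bar> ^ k / \<bar>t n\<bar> ^ Suc k"
      by (rule divide_left_mono[OF N[OF \<open>N \<le> n\<close>]]) (use pos in auto)
    also have "\<dots> = \<bar>C\<bar> / \<bar>t n\<bar>" by simp
    finally show "norm (C * \<bar>t n\<bar> ^ k / q M n) \<le> \<bar>C\<bar> / \<bar>t n\<bar>" by (simp add: abs_mult abs_of_pos)
  qed
qed

lemma near_le_1: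
  assumes "near \<zeta>" shows "\<bar>\<zeta> j - t j\<bar> \<le> 1"
proof -
  have "(1/4::real)^(j+2) \<le> 1" by (rule power_le_one) auto
  then show ?thesis using assms unfolding near_def by (meson order_trans)
qed

lemma abs_head_le: "near \<zeta> \<Longrightarrow> \<bar>head M \<zeta> n\<bar> \<le> \<bar>t n\<bar>"
  using near_le_1[of \<zeta> n] one_le_abs_t[of n] by (auto simp: head_def)

section \<open>Vanishing of the residue sums\<close>

lemma prod_numerators:
  assumes "\<And>j. j \<in> J \<Longrightarrow> z \<noteq> t j"
  shows "(\<Prod>j\<in>J. if j \<in> M then - t j else z - \<zeta> j) = (\<Prod>j\<in>J. fac M \<zeta> j z) * (\<Prod>j\<in>J. z - t j)"
  unfolding prod.distrib[symmetric] by (rule prod.cong) (use assms in \<open>auto simp: fac_def\<close>)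

lemma prod_numerators_res:
  assumes "n < K"
  shows "(\<Prod>j<K. if j \<in> M then - t j else t n - \<zeta> j) = resK M \<zeta> K n * (\<Prod>j\<in>{..<K} - {n}. t n - t j)"
proof -
  have "(\<Prod>j<K. if j \<in> M then - t j else t n - \<zeta> j) =
      head M \<zeta> n * (\<Prod>j\<in>{..<K} - {n}. if j \<in> M then - t j else t n - \<zeta> j)"
    using assms by (subst prod.remove[of _ n]) (auto simp: head_def)
  also have "(\<Prod>j\<in>{..<K} - {n}. if j \<in> M then - t j else t n - \<zeta> j) =
      (\<Prod>j\<in>{..<K} - {n}. fac M \<zeta> j (t n)) * (\<Prod>j\<in>{..<K} - {n}. t n - t j)"
    by (rule prod_numerators) auto
  finally show ?thesis by (simp add: resK_def mult.assoc)
qed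

text \<open>The partial fraction expansion of \<open>z ^ k\<close> times the truncated product is
  evaluated at its zero \<open>\<zeta> j\<close>. Each index in \<open>M\<close> lowers the degree
  of the numerator by one, so the expansion is proper exactly when \<open>k\<close> is below their
  number.\<close>

lemma finite_residue_sum:
  assumes k: "k < card (M \<inter> {..<K})" and j: "j < K" "j \<notin> M" and \<zeta>: "\<And>n. \<zeta> j \<noteq> t n"
  shows "(\<Sum>n<K. resK M \<zeta> K n * t n ^ k / (t n - \<zeta> j)) = 0"
proof -
  define num :: "nat \<Rightarrow> real poly" where "num i = (if i \<in> M then [:- t i:] else [:- \<zeta> i, 1:])" for i
  define Q where "Q = monom 1 k * (\<Prod>i<K. num i)"
  have polyQ: "poly Q z = z ^ k * (\<Prod>i<K. if i \<in> M then - t i else z - \<zeta> i)" for z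
  proof -
    have "poly (num i) z = (if i \<in> M then - t i else z - \<zeta> i)" for i by (simp add: num_def)
    then show ?thesis unfolding Q_def by (simp add: poly_prod poly_monom)
  qed
  have "degree Q \<le> k + degree (\<Prod>i<K. num i)"
    unfolding Q_def by (rule order_trans[OF degree_mult_le]) (simp add: degree_monom_eq)
  also have "degree (\<Prod>i<K. num i) \<le> sum (degree \<circ> num) {..<K}"
    by (rule degree_prod_sum_le) auto
  also have "sum (degree \<circ> num) {..<K} = (\<Sum>i<K. if i \<in> M then 0 else 1)"
    by (intro sum.cong) (auto simp: num_def)
  also have "\<dots> = card ({..<K} - M)"
    by (simp add: sum.If_cases Diff_eq)
  also have "k + card ({..<K} - M) < card ({..<K} - M) + card ({..<K} \<inter> M)"
    using k by (simp add: Int_commute)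
  also have "\<dots> = card {..<K}"
    by (metis add.commute card_Diff_subset_Int card_Int_Diff finite_lessThan finite_Int)
  finally have deg: "degree Q < card {..<K}" by simp
  have "poly Q (\<zeta> j) = 0" using j by (auto simp: polyQ intro!: prod_zero)
  then have "0 = (\<Sum>n<K. poly Q (t n) / (\<Prod>i\<in>{..<K} - {n}. t n - t i) / (\<zeta> j - t n))"
    using partial_fraction_expansion[OF _ _ deg, of t "\<zeta> j"] \<zeta> inj_t
    by (auto simp: inj_on_def)
  also have "\<dots> = (\<Sum>n<K. - (resK M \<zeta> K n * t n ^ k / (t n - \<zeta> j)))"
  proof (rule sum.cong)
    fix n assume n: "n \<in> {..<K}"
    have "(\<Prod>i\<in>{..<K} - {n}. t n - t i) \<noteq> 0" by auto
    then have "poly Q (t n) / (\<Prod>i\<in>{..<K} - {n}. t n - t i) = resK M \<zeta> K n * t n ^ k"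
      using n by (simp add: polyQ prod_numerators_res)
    then have "poly Q (t n) / (\<Prod>i\<in>{..<K} - {n}. t n - t i) / (\<zeta> j - t n) =
        resK M \<zeta> K n * t n ^ k / (- (t n - \<zeta> j))" by simp
    then show "poly Q (t n) / (\<Prod>i\<in>{..<K} - {n}. t n - t i) / (\<zeta> j - t n) =
        - (resK M \<zeta> K n * t n ^ k / (t n - \<zeta> j))" by (simp only: divide_minus_right)
  qed simp
  finally show ?thesis by (simp add: sum_negf)
qed

text \<open>Only the pole accompanied by \<open>\<zeta> j\<close> can be close to it; every other
  node is at distance at least 7.\<close>

lemma abs_t_minus_node:
  assumes near: "near \<zeta>" and \<zeta>: "\<And>n. \<zeta> j \<noteq> t n"
  obtains c where "0 < c" "c \<le> 1" "\<And>n. c \<le> \<bar>t n - \<zeta> j\<bar>"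
proof
  show "0 < min 1 \<bar>t j - \<zeta> j\<bar>" using \<zeta>[of j] by auto
  fix n show "min 1 \<bar>t j - \<zeta> j\<bar> \<le> \<bar>t n - \<zeta> j\<bar>"
    using t_dist(3)[of j n] near_le_1[OF near, of j] by (cases "n = j") auto
qed simp

text \<open>Tannery's theorem carries \<open>finite_residue_sum\<close> to the limit. The constants
  in \<open>resK_bounds\<close> do not depend on \<open>K\<close>, which gives the uniform majorant,
  and the superpolynomial growth of \<open>q\<close> absorbs the power
  \<open>t n ^ k\<close>.\<close>

lemma residue_series:
  assumes near: "near \<zeta>" and inf: "infinite M" and j: "j \<notin> M" and \<zeta>: "\<And>n. \<zeta> j \<noteq> t n"
  shows "summable (\<lambda>n. \<bar>res M \<zeta> n * t n ^ k / (t n - \<zeta> j)\<bar>)"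
    "(\<Sum>n. res M \<zeta> n * t n ^ k / (t n - \<zeta> j)) = 0"
proof -
  obtain c where c: "0 < c" "\<And>n. c \<le> \<bar>t n - \<zeta> j\<bar>" using abs_t_minus_node[OF near \<zeta>] by metis
  define a where "a n K = (if n < K then resK M \<zeta> K n * t n ^ k / (t n - \<zeta> j) else 0)" for n K
  define B where "B n = 2 / c * \<bar>t n\<bar> ^ Suc k / q M n" for n
  have lim: "(\<lambda>K. a n K) \<longlonglongrightarrow> res M \<zeta> n * t n ^ k / (t n - \<zeta> j)" for n
  proof (rule Lim_transform_eventually)
    show "(\<lambda>K. resK M \<zeta> K n * t n ^ k / (t n - \<zeta> j)) \<longlonglongrightarrow> res M \<zeta> n * t n ^ k / (t n - \<zeta> j)"
      by (intro tendsto_intros resK_tendsto near) (use \<zeta>[of n] in auto)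
    show "\<forall>\<^sub>F K in sequentially. resK M \<zeta> K n * t n ^ k / (t n - \<zeta> j) = a n K"
      using eventually_gt_at_top[of n] by eventually_elim (simp add: a_def)
  qed
  have bound: "norm (a n K) \<le> B n" for n K
  proof (cases "n < K")
    case True
    have "\<bar>resK M \<zeta> K n\<bar> \<le> 2 * \<bar>head M \<zeta> n\<bar> / q M n" by (rule resK_bounds(2)[OF near True])
    also have "\<dots> \<le> 2 * \<bar>t n\<bar> / q M n"
      using abs_head_le[OF near, of M n] by (intro divide_right_mono mult_left_mono) (auto intro: less_imp_le)
    finally have "\<bar>resK M \<zeta> K n\<bar> * \<bar>t n\<bar> ^ k / \<bar>t n - \<zeta> j\<bar> \<le> (2 * \<bar>t n\<bar> / q M n) * \<bar>t n\<bar> ^ k / c"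
      using c by (intro frac_le mult_right_mono mult_nonneg_nonneg) (auto intro: less_imp_le)
    also have "\<dots> = B n" by (simp add: B_def mult_ac)
    finally show ?thesis using True by (simp add: a_def abs_mult power_abs)
  next
    case False
    have "0 \<le> B n" using c by (auto simp: B_def intro!: divide_nonneg_nonneg less_imp_le)
    then show ?thesis using False by (simp add: a_def)
  qed
  have "summable B" unfolding B_def by (rule summable_power_div_q[OF inf])
  moreover have "\<forall>\<^sub>F (n, K) in sequentially \<times>\<^sub>F sequentially. norm (a n K) \<le> B n"
    using bound by (intro always_eventually) auto
  ultimately have "(\<forall>\<^sub>F K in sequentially. summable (\<lambda>n. norm (a n K))) \<and>
      summable (\<lambda>n. norm (res M \<zeta> n * t n ^ k / (t n - \<zeta> j))) \<and>
      (\<lambda>K. \<Sum>n. a n K) \<longlonglongrightarrow> (\<Sum>n. res M \<zeta> n * t n ^ k / (t n - \<zeta> j))"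
    by (intro tannerys_theorem lim) auto
  then have T: "summable (\<lambda>n. norm (res M \<zeta> n * t n ^ k / (t n - \<zeta> j)))"
    "(\<lambda>K. \<Sum>n. a n K) \<longlonglongrightarrow> (\<Sum>n. res M \<zeta> n * t n ^ k / (t n - \<zeta> j))"
    by auto
  show "summable (\<lambda>n. \<bar>res M \<zeta> n * t n ^ k / (t n - \<zeta> j)\<bar>)" using T(1) by simp
  obtain A where A: "A \<subseteq> M" "finite A" "card A = Suc k"
    using infinite_arbitrarily_large[OF inf] by blast
  have "\<forall>\<^sub>F K in sequentially. A \<subseteq> {..<K}"
    using A(2) by (metis eventually_sequentiallyI finite_nat_iff_bounded lessThan_subset_iff order_trans)
  then have "\<forall>\<^sub>F K in sequentially. (\<Sum>n. a n K) = 0"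
    using eventually_gt_at_top[of j]
  proof eventually_elim
    case (elim K)
    have "Suc k \<le> card (M \<inter> {..<K})"
      using A elim by (metis Int_subset_iff card_mono finite_Int finite_lessThan)
    then have "k < card (M \<inter> {..<K})" by simp
    have "(\<Sum>n. a n K) = (\<Sum>n<K. a n K)" by (rule suminf_finite) (auto simp: a_def)
    also have "\<dots> = (\<Sum>n<K. resK M \<zeta> K n * t n ^ k / (t n - \<zeta> j))" by (intro sum.cong) (auto simp: a_def)
    also have "\<dots> = 0" by (rule finite_residue_sum) fact+
    finally show ?case .
  qed
  then have "(\<lambda>K. \<Sum>n. a n K) \<longlonglongrightarrow> 0" by (rule tendsto_eventually)
  with T(2) show "(\<Sum>n. res M \<zeta> n * t n ^ k / (t n - \<zeta> j)) = 0" using LIMSEQ_unique by blast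
qed

section \<open>Products of node differences\<close>

lemma near_t [simp]: "near t"
  by (simp add: near_def)

text \<open>With \<open>M = S\<close> every factor is \<open>- t i / (t n - t i)\<close>, so
  \<open>prod_fac_bounds\<close> becomes a two-sided estimate for products of differences.\<close>

lemma prod_diff_t:
  assumes "finite S" "n \<notin> S"
  shows "\<bar>\<Prod>i\<in>S. t n - t i\<bar> * \<bar>\<Prod>i\<in>S. fac S t i (t n)\<bar> = (\<Prod>i\<in>S. \<bar>t i\<bar>)"
proof -
  have "(\<Prod>i\<in>S. if i \<in> S then - t i else t n - t i) = (\<Prod>i\<in>S. fac S t i (t n)) * (\<Prod>i\<in>S. t n - t i)"
    by (rule prod_numerators) (use assms in auto)
  then have "(\<Prod>i\<in>S. fac S t i (t n)) * (\<Prod>i\<in>S. t n - t i) = (\<Prod>i\<in>S. - t i)" by simp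
  then have "\<bar>(\<Prod>i\<in>S. fac S t i (t n)) * (\<Prod>i\<in>S. t n - t i)\<bar> = (\<Prod>i\<in>S. \<bar>t i\<bar>)"
    by (simp add: abs_prod)
  then show ?thesis by (simp add: abs_mult mult.commute)
qed

lemma prod_ratio_le_1: "(\<Prod>j\<in>R. \<bar>t j\<bar> / \<bar>t n\<bar>) \<le> 1" if "R \<subseteq> {..<n}"
proof (rule prod_le_1)
  fix j assume "j \<in> R"
  then have "2 * \<bar>t j\<bar> \<le> \<bar>t n\<bar>" using that by (intro t_gap2) auto
  then show "0 \<le> \<bar>t j\<bar> / \<bar>t n\<bar> \<and> \<bar>t j\<bar> / \<bar>t n\<bar> \<le> 1" by simp
qed

lemma prod_diff_t_lower:
  assumes "finite S" "n \<notin> S"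
  shows "(\<Prod>i\<in>S. \<bar>t i\<bar>) / 2 \<le> \<bar>\<Prod>i\<in>S. t n - t i\<bar>"
proof -
  let ?f = "\<bar>\<Prod>i\<in>S. fac S t i (t n)\<bar>" and ?d = "\<bar>\<Prod>i\<in>S. t n - t i\<bar>"
  have "?f \<le> 2 * (\<Prod>j\<in>S \<inter> {..<n} \<inter> S. \<bar>t j\<bar> / \<bar>t n\<bar>)"
    by (rule prod_fac_bounds(2)[OF near_t assms refl])
  also have "\<dots> \<le> 2" using prod_ratio_le_1[of "S \<inter> {..<n} \<inter> S" n] by auto
  finally have "?d * ?f \<le> ?d * 2" by (intro mult_left_mono) auto
  then show ?thesis by (simp add: prod_diff_t[OF assms])
qed

lemma prod_diff_t_upper:
  assumes "finite S" "S \<subseteq> {n<..}"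
  shows "\<bar>\<Prod>i\<in>S. t n - t i\<bar> \<le> 2 * (\<Prod>i\<in>S. \<bar>t i\<bar>)"
proof -
  let ?f = "\<bar>\<Prod>i\<in>S. fac S t i (t n)\<bar>" and ?d = "\<bar>\<Prod>i\<in>S. t n - t i\<bar>"
  have n: "n \<notin> S" and R: "S \<inter> {..<n} \<inter> S = {}" using assms(2) by auto
  have "1/2 \<le> ?f" using prod_fac_bounds(1)[OF near_t assms(1) n R] by simp
  then have "?d * (1/2) \<le> ?d * ?f" by (intro mult_left_mono) auto
  then show ?thesis by (simp add: prod_diff_t[OF assms(1) n])
qed

lemma prod_diff_t_lower_far:
  assumes "finite S" "S \<subseteq> {..<n}"
  shows "\<bar>t n\<bar> ^ card S \<le> 2 * \<bar>\<Prod>i\<in>S. t n - t i\<bar>"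
proof -
  let ?f = "\<bar>\<Prod>i\<in>S. fac S t i (t n)\<bar>" and ?d = "\<bar>\<Prod>i\<in>S. t n - t i\<bar>"
  let ?P = "\<Prod>i\<in>S. \<bar>t i\<bar>"
  have n: "n \<notin> S" and R: "S \<inter> {..<n} \<inter> S = S" using assms(2) by auto
  have P: "0 < ?P" by (intro prod_pos) auto
  have "?f \<le> 2 * (?P / \<bar>t n\<bar> ^ card S)"
    using prod_fac_bounds(2)[OF near_t assms(1) n R] by (simp add: prod_dividef)
  then have "?d * ?f \<le> ?d * (2 * (?P / \<bar>t n\<bar> ^ card S))" by (intro mult_left_mono) auto
  then have "?P \<le> ?d * (2 * (?P / \<bar>t n\<bar> ^ card S))" by (simp add: prod_diff_t[OF assms(1) n])
  then have "?P * \<bar>t n\<bar> ^ card S \<le> ?P * (2 * ?d)" by (simp add: field_simps)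
  then show ?thesis using P by simp
qed

text \<open>Both quantities lie within a factor 2 of
  \<open>\<bar>head M \<zeta> n\<bar> / q M n\<close>, hence within a factor 4 of each
  other.\<close>

lemma resK_res_bounds:
  assumes "near \<zeta>" "n < K"
  shows "\<bar>resK M \<zeta> K n\<bar> \<le> 4 * \<bar>res M \<zeta> n\<bar>" "\<bar>res M \<zeta> n\<bar> \<le> 4 * \<bar>resK M \<zeta> K n\<bar>"
proof -
  have e: "2 * \<bar>head M \<zeta> n\<bar> / q M n = 4 * (\<bar>head M \<zeta> n\<bar> / (2 * q M n))" by simp
  show "\<bar>resK M \<zeta> K n\<bar> \<le> 4 * \<bar>res M \<zeta> n\<bar>" "\<bar>res M \<zeta> n\<bar> \<le> 4 * \<bar>resK M \<zeta> K n\<bar>"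
    using resK_bounds[OF assms, of M] res_bounds[OF assms(1), of M n] unfolding e by linarith+
qed

lemma res_nonzero:
  assumes "near \<zeta>" "n \<notin> M \<Longrightarrow> \<zeta> n \<noteq> t n"
  shows "res M \<zeta> n \<noteq> 0"
proof -
  have "0 < \<bar>head M \<zeta> n\<bar> / (2 * q M n)" using assms(2) by (auto simp: head_def)
  then show ?thesis using res_bounds(1)[OF assms(1), of M n] by auto
qed

text \<open>The combinations of \<open>v n / (t n - \<gamma> j)\<close> over \<open>j < K\<close> are the vectors \<open>v n * R (t n)\<close> for the rational
  functions \<open>R\<close> with simple poles at the \<open>\<gamma> j\<close> and a zero at infinity. Let \<open>R\<close> vanish at all \<open>t i\<close>, \<open>i < K\<close>, except
  for \<open>i = m\<close> and \<open>i \<in> N' \<inter> {n'..<K}\<close>; the condition \<open>room\<close> leaves enough degrees for this. At the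
  remaining \<open>n \<in> N'\<close> the value relative to the one at \<open>m\<close> is of order \<open>u m / u n\<close>, because the residue of
  the product is \<open>u n * v n\<close>.\<close>

lemma approximating_combination:
  assumes near: "near \<gamma>" and MN: "M \<union> N = UNIV" "M \<inter> N = {}" and inj: "inj_on \<gamma> N"
    and \<gamma>: "\<And>j n. j \<in> N \<Longrightarrow> \<gamma> j \<noteq> t n" and N': "N' \<subseteq> N"
    and room: "\<And>n'. \<exists>K\<ge>n'. card (M \<inter> {..<K}) + 2 \<le> card (N' \<inter> {n'..<K})"
    and vu: "\<And>n. v n * u n = res M \<gamma> n"
    and v: "\<And>n. \<bar>v n\<bar> \<le> C * \<bar>t n\<bar>" and u: "\<And>n. n \<in> N' \<Longrightarrow> 2^n * c \<le> \<bar>u n\<bar>" and c: "0 < c"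
  shows "\<exists>D. \<forall>n'>m. \<exists>F a. finite F \<and> F \<subseteq> N \<and>
    (\<forall>n. \<bar>(\<Sum>j\<in>F. a j * (v n / (t n - \<gamma> j))) - (if n = m then 1 else 0)\<bar> \<le> (if n < n' then 0 else D * (1/2)^n))"
proof -
  \<comment> \<open>Here \<open>128 = 8 * 4 * 4\<close>: a factor 8 from comparing products of
    differences, and a factor 4 for each passage between \<open>resK\<close> and \<open>res\<close>.
    Likewise \<open>64 = 16 * 4\<close> for nodes beyond the truncation. \<open>D\<close> must not
    depend on \<open>n'\<close>, since the total error is later made small by letting
    \<open>n'\<close> grow.\<close>
  define D where "D = 128 * \<bar>u m\<bar> / c + 64 * C * \<bar>u m\<bar>"
  have "\<exists>F a. finite F \<and> F \<subseteq> N \<and>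
    (\<forall>n. \<bar>(\<Sum>j\<in>F. a j * (v n / (t n - \<gamma> j))) - (if n = m then 1 else 0)\<bar> \<le> (if n < n' then 0 else D * (1/2)^n))" if n': "m < n'" for n'
  proof -
    obtain K where K: "n' \<le> K" "card (M \<inter> {..<K}) + 2 \<le> card (N' \<inter> {n'..<K})"
      using room by blast
    define S where "S = N' \<inter> {n'..<K}"
    define Z where "Z = {..<K} - S - {m}"
    define F where "F = N \<inter> {..<K}"
    define Q where "Q = (\<Prod>i\<in>Z. [:- t i, 1:])"
    define R where "R n = poly Q (t n) / (\<Prod>j\<in>F. t n - \<gamma> j)" for n
    define P where "P = (\<Prod>j\<in>M \<inter> {..<K}. - t j)"
    define a where "a j = poly Q (\<gamma> j) / (\<Prod>i\<in>F - {j}. \<gamma> j - \<gamma> i) / (v m * R m)" for j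
    have fin: "finite S" "finite Z" "finite F" by (auto simp: S_def Z_def F_def)
    have mK: "m < K" using n' K by simp
    have mS: "m \<notin> S" using n' by (auto simp: S_def)
    have SK: "S \<subseteq> {..<K}" by (auto simp: S_def)
    have res0: "res M \<gamma> n \<noteq> 0" for n
      using res_nonzero[OF near] MN \<gamma> by (metis UnE UNIV_I)
    then have vn0: "v n \<noteq> 0" and un0: "u n \<noteq> 0" for n using vu by (metis mult_zero_left mult_zero_right)+
    have prodF: "(\<Prod>j\<in>F. t n - \<gamma> j) \<noteq> 0" for n
      using \<gamma> fin by (auto simp: F_def) metis
    have polyQ: "poly Q x = (\<Prod>i\<in>Z. x - t i)" for x
      by (simp add: Q_def poly_prod)
    have num: "(\<Prod>j<K. if j \<in> M then - t j else t n - \<gamma> j) = P * (\<Prod>j\<in>F. t n - \<gamma> j)" for n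
    proof -
      have F: "{..<K} \<inter> - M = F" using MN by (auto simp: F_def)
      show ?thesis by (simp add: prod.If_cases F P_def Int_commute[of M "{..<K}"])
    qed
    have P0: "P \<noteq> 0" by (simp add: P_def)
    have "card Z = K - card S - 1"
      using mS mK SK by (simp add: Z_def card_Diff_subset fin)
    also have "\<dots> < K - card (M \<inter> {..<K})"
    proof -
      have "card S \<le> K" using card_mono[of "{..<K}" S] SK by simp
      then show ?thesis using K(2) mK unfolding S_def by linarith
    qed
    also have "\<dots> = card F"
    proof -
      have "F = {..<K} - (M \<inter> {..<K})" using MN by (auto simp: F_def)
      then show ?thesis by (simp add: card_Diff_subset)
    qed
    finally have "card Z < card F" .
    then have deg: "degree Q < card F"
      unfolding Q_def using degree_prod_sum_le[OF fin(2), of "\<lambda>i. [:- t i, 1:]"] by simp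
    have "inj_on \<gamma> F" using inj by (rule inj_on_subset) (auto simp: F_def)
    have RS: "R n = (\<Sum>j\<in>F. poly Q (\<gamma> j) / (\<Prod>i\<in>F - {j}. \<gamma> j - \<gamma> i) / (t n - \<gamma> j))" for n
      unfolding R_def
    proof (rule partial_fraction_expansion[OF fin(3) \<open>inj_on \<gamma> F\<close> deg])
      fix i assume "i \<in> F"
      then show "t n \<noteq> \<gamma> i" using \<gamma>[of i n] by (auto simp: F_def)
    qed
    have RZ: "R n = 0" if "n \<in> Z" for n
      using that fin by (auto simp: R_def polyQ)
    \<comment> \<open>\<open>R\<close> times the truncated product with poles \<open>t j\<close> and
      zeros \<open>\<gamma> j\<close> equals \<open>P\<close> divided by the product of
      \<open>z - t i\<close> over \<open>S\<close> and \<open>m\<close>. This is its residue at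
      \<open>t m\<close>; the cases below use the residue at a node of \<open>S\<close> and the
      value at a node beyond \<open>K\<close>.\<close>
    have Rm: "R m * resK M \<gamma> K m * (\<Prod>i\<in>S. t m - t i) = P"
    proof -
      have "(\<Prod>j\<in>{..<K} - {m}. t m - t j) = (\<Prod>j\<in>S. t m - t j) * poly Q (t m)"
      proof -
        have "{..<K} - {m} - S = Z" by (auto simp: Z_def)
        moreover have "S \<subseteq> {..<K} - {m}" using SK mS by auto
        ultimately show ?thesis unfolding polyQ by (metis finite_Diff finite_lessThan mult.commute prod.subset_diff)
      qed
      then have "P * (\<Prod>j\<in>F. t m - \<gamma> j) = resK M \<gamma> K m * ((\<Prod>j\<in>S. t m - t j) * poly Q (t m))"
        using prod_numerators_res[OF mK, of M \<gamma>] num by simp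
      then show ?thesis using prodF[of m] by (simp add: R_def field_simps)
    qed
    then have Rm0: "R m \<noteq> 0" and resKm0: "resK M \<gamma> K m \<noteq> 0" using P0 by auto
    have Am: "\<bar>\<Prod>i\<in>S. t m - t i\<bar> \<le> 2 * (\<Prod>i\<in>S. \<bar>t i\<bar>)"
      by (rule prod_diff_t_upper[OF fin(1)]) (use n' in \<open>auto simp: S_def\<close>)
    have PS: "0 < (\<Prod>i\<in>S. \<bar>t i\<bar>)" by (intro prod_pos) auto
    have resm: "\<bar>resK M \<gamma> K m\<bar> \<le> 4 * (\<bar>v m\<bar> * \<bar>u m\<bar>)"
      using resK_res_bounds(1)[OF near mK, of M] by (simp add: abs_mult flip: vu)
    have C0: "0 \<le> C"
    proof -
      have "0 \<le> C * \<bar>t 0\<bar>" using v[of 0] by linarith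
      then show ?thesis by (simp add: zero_le_mult_iff)
    qed
    have main: "\<bar>v n * R n / (v m * R m)\<bar> \<le> D * (1/2)^n" if n: "n' \<le> n" for n
    proof -
      have nm: "n \<noteq> m" using n n' by auto
      consider "n \<in> Z" | "n \<in> S" | "K \<le> n"
        using nm unfolding Z_def by (cases "n \<in> S"; cases "n < K") auto
      then show ?thesis
      proof cases
        case 1
        then show ?thesis using RZ c C0 by (auto simp: D_def)
      next
        \<comment> \<open>Comparing the residues at \<open>n\<close> and \<open>m\<close> eliminates
          \<open>P\<close>. The products of differences balance up to a factor 8, so the ratio of
          the values of \<open>R\<close> is bounded by that of the residues \<open>u m * v m\<close>
          and \<open>u n * v n\<close>.\<close>
        case 2
        then have nK: "n < K" using SK by auto
        have "(\<Prod>j\<in>{..<K} - {n}. t n - t j) = (\<Prod>j\<in>S - {n}. t n - t j) * ((t n - t m) * poly Q (t n))"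
        proof -
          have "{..<K} - {n} = (S - {n}) \<union> insert m Z" "(S - {n}) \<inter> insert m Z = {}" "m \<notin> Z"
            using SK mS mK 2 nm by (auto simp: Z_def)
          then show ?thesis unfolding polyQ using fin by (simp add: prod.union_disjoint)
        qed
        then have "P * (\<Prod>j\<in>F. t n - \<gamma> j) = resK M \<gamma> K n * ((\<Prod>j\<in>S - {n}. t n - t j) * ((t n - t m) * poly Q (t n)))"
          using prod_numerators_res[OF nK, of M \<gamma>] num by simp
        then have Rn: "R n * resK M \<gamma> K n * (\<Prod>i\<in>S - {n}. t n - t i) * (t n - t m) = P"
          using prodF[of n] by (simp add: R_def field_simps)
        let ?A = "\<Prod>i\<in>S. t m - t i" and ?B = "\<Prod>i\<in>S - {n}. t n - t i"
        have "(\<Prod>i\<in>S - {n}. \<bar>t i\<bar>) / 2 \<le> \<bar>?B\<bar>" by (rule prod_diff_t_lower) (use fin in auto)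
        then have "\<bar>t n\<bar> * (\<Prod>i\<in>S - {n}. \<bar>t i\<bar>) / 2 \<le> \<bar>t n\<bar> * \<bar>?B\<bar>"
          using mult_left_mono[of "(\<Prod>i\<in>S - {n}. \<bar>t i\<bar>) / 2" "\<bar>?B\<bar>" "\<bar>t n\<bar>"] by simp
        moreover have "(\<Prod>i\<in>S. \<bar>t i\<bar>) = \<bar>t n\<bar> * (\<Prod>i\<in>S - {n}. \<bar>t i\<bar>)" by (rule prod.remove) (use fin 2 in auto)
        ultimately have "\<bar>?A\<bar> \<le> 4 * (\<bar>t n\<bar> * \<bar>?B\<bar>)" using Am by linarith
        also have "\<dots> \<le> 8 * (\<bar>t n - t m\<bar> * \<bar>?B\<bar>)"
          using t_dist(1)[of m n] nm mult_right_mono[of "\<bar>t n\<bar>" "2 * \<bar>t n - t m\<bar>" "\<bar>?B\<bar>"] by simp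
        finally have A: "\<bar>?A\<bar> \<le> 8 * (\<bar>?B\<bar> * \<bar>t n - t m\<bar>)" by (simp add: mult.commute)
        have "R n * resK M \<gamma> K n * ?B * (t n - t m) = R m * resK M \<gamma> K m * ?A" using Rn Rm by simp
        then have "\<bar>R n\<bar> * \<bar>resK M \<gamma> K n\<bar> * (\<bar>?B\<bar> * \<bar>t n - t m\<bar>) = \<bar>R m\<bar> * \<bar>resK M \<gamma> K m\<bar> * \<bar>?A\<bar>"
          by (simp only: abs_mult[symmetric] mult.assoc)
        also have "\<dots> \<le> \<bar>R m\<bar> * \<bar>resK M \<gamma> K m\<bar> * (8 * (\<bar>?B\<bar> * \<bar>t n - t m\<bar>))"
          by (intro mult_left_mono A) auto
        finally have "(\<bar>R n\<bar> * \<bar>resK M \<gamma> K n\<bar>) * (\<bar>?B\<bar> * \<bar>t n - t m\<bar>) \<le> (8 * \<bar>R m\<bar> * \<bar>resK M \<gamma> K m\<bar>) * (\<bar>?B\<bar> * \<bar>t n - t m\<bar>)"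
          by (simp add: mult_ac)
        moreover have "0 < \<bar>?B\<bar> * \<bar>t n - t m\<bar>" using Rn P0 by auto
        ultimately have 1: "\<bar>R n\<bar> * \<bar>resK M \<gamma> K n\<bar> \<le> 8 * \<bar>R m\<bar> * \<bar>resK M \<gamma> K m\<bar>"
          by (simp only: mult_le_cancel_right_pos)
        have 2: "\<bar>v n\<bar> * \<bar>u n\<bar> \<le> 4 * \<bar>resK M \<gamma> K n\<bar>"
          using resK_res_bounds(2)[OF near nK, of M] by (simp add: abs_mult flip: vu)
        have "\<bar>R n\<bar> * (\<bar>v n\<bar> * \<bar>u n\<bar>) \<le> \<bar>R n\<bar> * (4 * \<bar>resK M \<gamma> K n\<bar>)"
          by (intro mult_left_mono 2) auto
        also have "\<dots> \<le> 32 * (\<bar>R m\<bar> * \<bar>resK M \<gamma> K m\<bar>)" using 1 by (simp add: mult_ac)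
        also have "\<dots> \<le> 32 * (\<bar>R m\<bar> * (4 * (\<bar>v m\<bar> * \<bar>u m\<bar>)))" by (intro mult_left_mono resm) auto
        finally have "(\<bar>v n\<bar> * \<bar>R n\<bar>) * \<bar>u n\<bar> \<le> 128 * \<bar>u m\<bar> * (\<bar>v m\<bar> * \<bar>R m\<bar>)" by (simp add: mult_ac)
        then have "\<bar>v n * R n / (v m * R m)\<bar> \<le> 128 * \<bar>u m\<bar> / \<bar>u n\<bar>"
          using un0[of n] vn0[of m] Rm0 by (simp add: abs_mult abs_divide field_simps)
        also have "\<dots> \<le> 128 * \<bar>u m\<bar> / (2^n * c)"
          using u[of n] 2 c \<open>n \<in> S\<close> un0[of n] by (intro divide_left_mono) (auto simp: S_def)
        also have "\<dots> = 128 * \<bar>u m\<bar> / c * (1/2)^n" using c by (simp add: power_divide)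
        also have "\<dots> \<le> D * (1/2)^n" unfolding D_def using C0 by (intro mult_right_mono) auto
        finally show ?thesis .
      next
        case 3
        let ?A = "\<Prod>i\<in>S. t m - t i" and ?B = "\<Prod>i\<in>S. t n - t i" and ?\<psi> = "\<Prod>j<K. fac M \<gamma> j (t n)"
        let ?k = "card (M \<inter> {..<K})"
        have "(\<Prod>j<K. t n - t j) = ?B * ((t n - t m) * poly Q (t n))"
        proof -
          have "{..<K} = S \<union> insert m Z" "S \<inter> insert m Z = {}" "m \<notin> Z"
            using SK mS mK by (auto simp: Z_def)
          then show ?thesis unfolding polyQ using fin by (simp add: prod.union_disjoint)
        qed
        moreover have "(\<Prod>j<K. if j \<in> M then - t j else t n - \<gamma> j) = ?\<psi> * (\<Prod>j<K. t n - t j)"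
          by (rule prod_numerators) (use 3 in auto)
        ultimately have "P * (\<Prod>j\<in>F. t n - \<gamma> j) = ?\<psi> * (?B * ((t n - t m) * poly Q (t n)))"
          using num by simp
        then have Rn: "R n * ?\<psi> * ?B * (t n - t m) = P"
          using prodF[of n] by (simp add: R_def field_simps)
        have \<psi>: "1 \<le> 2 * \<bar>?\<psi>\<bar> * \<bar>t n\<bar> ^ ?k"
        proof -
          have R: "M \<inter> {..<n} \<inter> {..<K} = M \<inter> {..<K}" using 3 by auto
          have "(\<Prod>j\<in>M \<inter> {..<K}. \<bar>t j\<bar> / \<bar>t n\<bar>) / 2 \<le> \<bar>?\<psi>\<bar>"
            by (rule prod_fac_bounds(1)[OF near _ _ R]) (use 3 in auto)
          then have "(\<Prod>j\<in>M \<inter> {..<K}. \<bar>t j\<bar>) \<le> 2 * \<bar>?\<psi>\<bar> * \<bar>t n\<bar> ^ ?k"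
            by (simp add: prod_dividef field_simps)
          moreover have "1 \<le> (\<Prod>j\<in>M \<inter> {..<K}. \<bar>t j\<bar>)" by (rule prod_subset_abs_t_le(1)[of _ K]) auto
          ultimately show ?thesis by linarith
        qed
        have B: "\<bar>t n\<bar> ^ card S \<le> 2 * \<bar>?B\<bar>"
          by (rule prod_diff_t_lower_far[OF fin(1)]) (use 3 SK in auto)
        \<comment> \<open>The surplus 2 in \<open>room\<close> is spent here: one power of
          \<open>\<bar>t n\<bar>\<close> compensates the growth of \<open>v n\<close>, the other
          yields the decay.\<close>
        have "\<bar>t n\<bar> ^ (?k + 2) \<le> \<bar>t n\<bar> ^ card S"
          using K one_le_abs_t by (intro power_increasing) (auto simp: S_def)
        with B have B2: "\<bar>t n\<bar> ^ ?k * \<bar>t n\<bar>\<^sup>2 \<le> 2 * \<bar>?B\<bar>" unfolding power_add by linarith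
        have "(\<Prod>i\<in>S. \<bar>t i\<bar>) \<le> (\<Prod>i<n. \<bar>t i\<bar>)"
          by (rule prod_subset_abs_t_le(2)) (use SK 3 in auto)
        moreover have "1 * (\<Prod>i<n. \<bar>t i\<bar>) \<le> 4^(n+2) * (\<Prod>i<n. \<bar>t i\<bar>)"
          using one_le_prod_abs_t[of n] by (intro mult_right_mono one_le_power) auto
        ultimately have "(\<Prod>i\<in>S. \<bar>t i\<bar>) \<le> \<bar>t n\<bar>" using prod_abs_t_le[of n] by linarith
        then have "2 * (\<Prod>i\<in>S. \<bar>t i\<bar>) \<le> 2 * (2 * \<bar>t n - t m\<bar>)"
          using t_dist(1)[OF nm[symmetric]] by (intro mult_left_mono) auto
        then have A: "\<bar>?A\<bar> \<le> 4 * \<bar>t n - t m\<bar>" using order_trans[OF Am] by fastforce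
        have "R n * ?\<psi> * ?B * (t n - t m) = R m * resK M \<gamma> K m * ?A" using Rn Rm by simp
        then have "\<bar>R n\<bar> * \<bar>?\<psi>\<bar> * \<bar>?B\<bar> * \<bar>t n - t m\<bar> = \<bar>R m\<bar> * \<bar>resK M \<gamma> K m\<bar> * \<bar>?A\<bar>"
          by (simp only: abs_mult[symmetric])
        also have "\<dots> \<le> \<bar>R m\<bar> * \<bar>resK M \<gamma> K m\<bar> * (4 * \<bar>t n - t m\<bar>)"
          by (intro mult_left_mono A) auto
        finally have "(\<bar>R n\<bar> * \<bar>?\<psi>\<bar> * \<bar>?B\<bar>) * \<bar>t n - t m\<bar> \<le> (4 * (\<bar>R m\<bar> * \<bar>resK M \<gamma> K m\<bar>)) * \<bar>t n - t m\<bar>"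
          by (simp add: mult_ac)
        moreover have "0 < \<bar>t n - t m\<bar>" using nm by simp
        ultimately have 1: "\<bar>R n\<bar> * \<bar>?\<psi>\<bar> * \<bar>?B\<bar> \<le> 4 * (\<bar>R m\<bar> * \<bar>resK M \<gamma> K m\<bar>)"
          by (simp only: mult_le_cancel_right_pos)
        have "\<bar>R n\<bar> * \<bar>t n\<bar>\<^sup>2 * 1 \<le> \<bar>R n\<bar> * \<bar>t n\<bar>\<^sup>2 * (2 * \<bar>?\<psi>\<bar> * \<bar>t n\<bar> ^ ?k)"
          by (intro mult_left_mono \<psi>) auto
        also have "\<dots> = 2 * \<bar>R n\<bar> * \<bar>?\<psi>\<bar> * (\<bar>t n\<bar> ^ ?k * \<bar>t n\<bar>\<^sup>2)" by (simp add: mult_ac)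
        also have "\<dots> \<le> 2 * \<bar>R n\<bar> * \<bar>?\<psi>\<bar> * (2 * \<bar>?B\<bar>)" by (intro mult_left_mono B2) auto
        also have "\<dots> \<le> 16 * (\<bar>R m\<bar> * \<bar>resK M \<gamma> K m\<bar>)" using 1 by (simp add: mult_ac)
        also have "\<dots> \<le> 16 * (\<bar>R m\<bar> * (4 * (\<bar>v m\<bar> * \<bar>u m\<bar>)))" by (intro mult_left_mono resm) auto
        finally have 2: "\<bar>R n\<bar> * \<bar>t n\<bar>\<^sup>2 \<le> 64 * \<bar>u m\<bar> * (\<bar>v m\<bar> * \<bar>R m\<bar>)" by (simp add: mult_ac)
        have "\<bar>v n\<bar> * \<bar>R n\<bar> * \<bar>t n\<bar> \<le> (C * \<bar>t n\<bar>) * \<bar>R n\<bar> * \<bar>t n\<bar>"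
          by (intro mult_right_mono v) auto
        also have "\<dots> = C * (\<bar>R n\<bar> * \<bar>t n\<bar>\<^sup>2)" by (simp add: power2_eq_square mult_ac)
        also have "\<dots> \<le> C * (64 * \<bar>u m\<bar> * (\<bar>v m\<bar> * \<bar>R m\<bar>))" by (intro mult_left_mono 2 C0)
        finally have "\<bar>v n\<bar> * \<bar>R n\<bar> * \<bar>t n\<bar> \<le> 64 * C * \<bar>u m\<bar> * (\<bar>v m\<bar> * \<bar>R m\<bar>)" by (simp add: mult_ac)
        then have "\<bar>v n * R n / (v m * R m)\<bar> \<le> 64 * C * \<bar>u m\<bar> / \<bar>t n\<bar>"
          using vn0[of m] Rm0 by (simp add: abs_mult abs_divide field_simps)
        also have "\<dots> \<le> 64 * C * \<bar>u m\<bar> / 2^n"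
        proof (intro divide_left_mono)
          have "(2::real)^n \<le> 4^n" by (intro power_mono) auto
          also have "(4::real)^n \<le> 4^(n+2)" by (intro power_increasing) auto
          finally show "2^n \<le> \<bar>t n\<bar>" using abs_t_ge[of n] by linarith
        qed (use C0 in auto)
        also have "\<dots> = 64 * C * \<bar>u m\<bar> * (1/2)^n" by (simp add: power_divide)
        also have "\<dots> \<le> D * (1/2)^n" unfolding D_def using c by (intro mult_right_mono) auto
        finally show ?thesis .
      qed
    qed
    have sum: "(\<Sum>j\<in>F. a j * (v n / (t n - \<gamma> j))) = v n * R n / (v m * R m)" for n
      unfolding RS[of n] sum_distrib_left sum_divide_distrib by (intro sum.cong) (auto simp: a_def mult_ac)
    have "\<bar>v n * R n / (v m * R m) - (if n = m then 1 else 0)\<bar> \<le> (if n < n' then 0 else D * (1/2)^n)" for n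
    proof (cases "n < n'")
      case True
      show ?thesis
      proof (cases "n = m")
        case False
        then have "n \<in> Z" using True K by (auto simp: Z_def S_def)
        then show ?thesis using RZ False True by simp
      qed (use vn0 Rm0 True in auto)
    next
      case False
      then show ?thesis using main[of n] n' by auto
    qed
    then have "finite F \<and> F \<subseteq> N \<and> (\<forall>n. \<bar>(\<Sum>j\<in>F. a j * (v n / (t n - \<gamma> j))) - (if n = m then 1 else 0)\<bar>
        \<le> (if n < n' then 0 else D * (1/2)^n))"
      unfolding sum using fin by (auto simp: F_def)
    then show ?thesis by blast
  qed
  then show ?thesis by blast
qed

end

section \<open>Choice of the parameters\<close>

lemma card_residues_lessThan:
  assumes "R \<subseteq> {..<8::nat}"
  shows "card ({n. n mod 8 \<in> R} \<inter> {..<8 * L}) = L * card R"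
proof -
  have "{n. n mod 8 \<in> R} \<inter> {..<8 * L} = (\<lambda>(i, r). 8 * i + r) ` ({..<L} \<times> R)" (is "?A = ?f ` ?B")
  proof (intro equalityI subsetI)
    fix n assume n: "n \<in> ?A"
    then have "n div 8 < L" by (auto simp: less_mult_imp_div_less mult.commute)
    then show "n \<in> ?f ` ?B" using n by (intro image_eqI[of _ _ "(n div 8, n mod 8)"]) auto
  qed (use assms in \<open>force simp: subset_iff\<close>)
  moreover have "inj_on ?f ?B"
    by (intro inj_on_inverseI[where g = "\<lambda>n. (n div 8, n mod 8)"]) (use assms in \<open>auto simp: subset_iff\<close>)
  ultimately show ?thesis by (simp add: card_image card_cartesian_product)
qed

lemma infinite_residues:
  assumes "r < (8::nat)" shows "infinite {n. n mod 8 \<in> insert r R}"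
proof -
  have "inj (\<lambda>i. 8 * i + r)" by (auto simp: inj_on_def)
  then have "infinite (range (\<lambda>i. 8 * i + r))" by (rule range_inj_infinite)
  moreover have "range (\<lambda>i. 8 * i + r) \<subseteq> {n. n mod 8 \<in> insert r R}" using assms by auto
  ultimately show ?thesis using finite_subset by blast
qed

text \<open>Below \<open>8 * L\<close> the surplus is at least \<open>L\<close>. Discarding the
  indices below \<open>n'\<close> loses at most \<open>n'\<close> of it, so
  \<open>L = n' + 2\<close> suffices.\<close>

lemma residue_room:
  assumes "R \<subseteq> {..<8::nat}" "R' \<subseteq> {..<8::nat}" "card R < card R'"
  shows "\<exists>K\<ge>n'. card ({n. n mod 8 \<in> R} \<inter> {..<K}) + 2 \<le> card ({n. n mod 8 \<in> R'} \<inter> {n'..<K})"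
proof (intro exI conjI)
  let ?L = "n' + 2" and ?S = "{n. n mod 8 \<in> R'}"
  show "n' \<le> 8 * ?L" by simp
  have "?S \<inter> {..<8 * ?L} \<subseteq> {..<n'} \<union> (?S \<inter> {n'..<8 * ?L})" by auto
  then have "card (?S \<inter> {..<8 * ?L}) \<le> card ({..<n'} \<union> (?S \<inter> {n'..<8 * ?L}))"
    by (intro card_mono) auto
  also have "\<dots> \<le> n' + card (?S \<inter> {n'..<8 * ?L})"
    using card_Un_le[of "{..<n'}"] by simp
  finally have "?L * card R' \<le> n' + card (?S \<inter> {n'..<8 * ?L})"
    by (simp only: card_residues_lessThan[OF assms(2)])
  moreover have "?L * (card R + 1) \<le> ?L * card R'" using assms(3) by (intro mult_left_mono) auto
  ultimately show "card ({n. n mod 8 \<in> R} \<inter> {..<8 * ?L}) + 2 \<le> card (?S \<inter> {n'..<8 * ?L})"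
    unfolding card_residues_lessThan[OF assms(1)] by (simp add: algebra_simps)
qed

context sparse
begin

lemma q_nonzero [simp]: "q M n \<noteq> 0"
  by (rule less_imp_neq[symmetric]) simp

text \<open>For \<open>M = {}\<close> every pole is accompanied: \<open>q\<close> equals 1 and the
  other factors are nonnegative at \<open>t n\<close>, so the residue is the squared distance up to
  a factor 2. Its positivity permits the real square root used for \<open>b\<close>.\<close>

lemma unit_residue_bounds:
  assumes near: "near s" and s: "t n - s n = (d::real)\<^sup>2" and d: "0 < d"
  shows "0 < res {} s n" "d / 2 \<le> sqrt (res {} s n)" "sqrt (res {} s n) \<le> 2 * d"
    "res {} s n \<le> 2 * d\<^sup>2"
proof -
  have q: "q {} n = 1" and h: "head {} s n = d\<^sup>2" using s by (auto simp: q_def head_def)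
  have "0 \<le> resK {} s K n" for K
  proof -
    have "0 \<le> fac {} s j (t n)" if "j \<noteq> n" for j
    proof -
      have "\<bar>dev {} s n j\<bar> \<le> (1/2)^(j+3)" by (rule dev_bound[OF near that[symmetric]])
      also have "\<dots> \<le> 1" by (rule power_le_one) auto
      finally show ?thesis unfolding fac_eq by (simp add: wt_def)
    qed
    then show ?thesis unfolding resK_def h by (intro mult_nonneg_nonneg prod_nonneg) auto
  qed
  then have "0 \<le> res {} s n" by (intro LIMSEQ_le_const[OF resK_tendsto[OF near]]) auto
  then have b: "d\<^sup>2 / 2 \<le> res {} s n" "res {} s n \<le> 2 * d\<^sup>2"
    using res_bounds[OF near, of "{}" n] by (auto simp: q h)
  show "res {} s n \<le> 2 * d\<^sup>2" by fact
  show "0 < res {} s n" 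
  proof -
    have "0 < d\<^sup>2 / 2" using d by simp
    then show ?thesis using b(1) by linarith
  qed
  show "d / 2 \<le> sqrt (res {} s n)"
  proof (rule real_le_rsqrt)
    have "(d / 2)\<^sup>2 = d\<^sup>2 / 4" by (simp add: power_divide)
    then show "(d / 2)\<^sup>2 \<le> res {} s n" using b(1) zero_le_power2[of d] by linarith
  qed
  show "sqrt (res {} s n) \<le> 2 * d"
  proof (rule real_le_lsqrt)
    have "(2 * d)\<^sup>2 = 4 * d\<^sup>2" by (simp add: power_mult_distrib)
    then show "res {} s n \<le> (2 * d)\<^sup>2" using b(2) zero_le_power2[of d] by linarith
  qed (use d in simp)
qed

text \<open>Serves both weights: \<open>v\<close> with \<open>M1\<close>, \<open>N1\<close> and
  \<open>\<bar>u\<bar>\<close> with \<open>M2\<close>, \<open>N2\<close>. The weight is comparable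
  to \<open>\<bar>head M \<zeta> n\<bar> / (q M n * d n)\<close>, hence at most of order
  \<open>\<bar>t n\<bar> * 8^(n+2) / sqrt (q M n)\<close> on \<open>M\<close>, of order
  \<open>2^n\<close> on \<open>N\<close>, and bounded elsewhere.\<close>

lemma weight_bounds:
  assumes near: "near s" "near \<zeta>" and d: "\<And>n. 0 < d n" "\<And>n. d n \<le> 1"
    and s: "\<And>n. t n - s n = (d n)\<^sup>2"
    and M: "infinite M" "M \<inter> N = {}" and dM: "\<And>n. n \<in> M \<Longrightarrow> d n = (1/8)^(n+2) / sqrt (q M n)"
    and N: "\<And>n. n \<in> N \<Longrightarrow> 2^n * d n * q M n \<le> \<zeta> n - t n" "\<And>n. n \<in> N \<Longrightarrow> \<zeta> n - t n \<le> 2 * (2^n * d n * q M n)"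
    and J: "\<And>n. n \<notin> M \<Longrightarrow> n \<notin> N \<Longrightarrow> t n - \<zeta> n = (d n)\<^sup>2"
    and w: "\<And>n. w n = \<bar>res M \<zeta> n\<bar> / sqrt (res {} s n)"
  shows "summable (\<lambda>n. (w n)\<^sup>2 / ((t n)\<^sup>2 + 1))" "\<exists>C. \<forall>n. w n \<le> C * \<bar>t n\<bar>"
    "\<And>n. n \<in> N \<Longrightarrow> 2^n * (1/4) \<le> w n"
proof -
  \<comment> \<open>The first term covers \<open>M\<close>, where \<open>8^2 = 4^3\<close> and
    \<open>4^(n+2) \<le> \<bar>t n\<bar>\<close> replace the exponential by
    \<open>\<bar>t n\<bar>^3\<close>. The second covers the other two cases, whose constants are 64
    and 16.\<close>
  define B where "B n = 16 * \<bar>t n\<bar>^3 / q M n + 80 / \<bar>t n\<bar>" for n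
  have summB: "summable B"
    unfolding B_def by (intro summable_add summable_power_div_q summable_quarter M)
  note b = unit_residue_bounds[OF near(1) s d(1)]
  have w0: "0 \<le> w n" for n using less_imp_le[OF b(1)[of n]] by (simp add: w)
  have up: "w n \<le> 4 * (\<bar>head M \<zeta> n\<bar> / (q M n * d n))" for n
  proof -
    have "w n \<le> (2 * \<bar>head M \<zeta> n\<bar> / q M n) / (d n / 2)"
      unfolding w using b[of n] d[of n] res_bounds(2)[OF near(2)]
      by (intro frac_le) (auto intro!: divide_nonneg_nonneg intro: less_imp_le)
    then show ?thesis by (simp add: field_simps)
  qed
  have low: "\<bar>head M \<zeta> n\<bar> / (q M n * d n) \<le> 4 * w n" for n
  proof -
    have "(\<bar>head M \<zeta> n\<bar> / (2 * q M n)) / (2 * d n) \<le> w n"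
      unfolding w using b[of n] d[of n] res_bounds(1)[OF near(2)]
      by (intro frac_le) auto
    then show ?thesis by (simp add: field_simps)
  qed
  show wN: "2^n * (1/4) \<le> w n" if "n \<in> N" for n
  proof -
    have "2^n * d n * q M n \<le> \<bar>head M \<zeta> n\<bar>" using N(1)[OF that] that M by (auto simp: head_def)
    then have "2^n \<le> \<bar>head M \<zeta> n\<bar> / (q M n * d n)" using d[of n]
      by (simp add: pos_le_divide_eq mult_ac)
    then show ?thesis using low[of n] by linarith
  qed
  have t4: "4^n \<le> \<bar>t n\<bar>" for n
    using abs_t_ge[of n] power_increasing[of n "n+2" "4::real"] by simp
  have t2: "\<bar>t n\<bar> \<le> (t n)\<^sup>2" for n
    using one_le_abs_t[of n] self_le_power[of "\<bar>t n\<bar>" 2] by simp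
  have wB: "(w n)\<^sup>2 / (t n)\<^sup>2 \<le> B n" for n
  proof -
    consider "n \<in> M" | "n \<in> N" "n \<notin> M" | "n \<notin> M" "n \<notin> N" by blast
    then show ?thesis
    proof cases
      case 1
      have "w n \<le> 4 * (\<bar>t n\<bar> / (q M n * ((1/8)^(n+2) / sqrt (q M n))))"
        using up[of n] 1 by (simp add: head_def dM)
      also have "\<dots> = 4 * \<bar>t n\<bar> * 8^(n+2) * (sqrt (q M n) / q M n)"
        by (simp add: power_divide field_simps)
      also have "\<dots> = 4 * \<bar>t n\<bar> * 8^(n+2) / sqrt (q M n)"
      proof -
        have "sqrt (q M n) / q M n = 1 / sqrt (q M n)"
          by (metis inverse_divide inverse_eq_divide less_imp_le q_pos real_div_sqrt)
        then show ?thesis by simp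
      qed
      finally have "(w n)\<^sup>2 \<le> (4 * \<bar>t n\<bar> * 8^(n+2) / sqrt (q M n))\<^sup>2"
        by (intro power_mono w0)
      also have "\<dots> = 16 * (t n)\<^sup>2 * (8^(n+2))\<^sup>2 / q M n"
        by (simp add: power_divide power_mult_distrib less_imp_le)
      also have "((8::real)^(n+2))\<^sup>2 = (4^(n+2))^3"
      proof -
        have "(8::real)\<^sup>2 = 4^3" by simp
        then show ?thesis by (metis mult.commute power_mult)
      qed
      also have "16 * (t n)\<^sup>2 * (4^(n+2))^3 / q M n \<le> 16 * (t n)\<^sup>2 * \<bar>t n\<bar>^3 / q M n"
        by (intro divide_right_mono mult_left_mono power_mono abs_t_ge) (auto intro: less_imp_le)
      finally have "(w n)\<^sup>2 / (t n)\<^sup>2 \<le> 16 * \<bar>t n\<bar>^3 / q M n" by (simp add: field_simps)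
      then show ?thesis by (simp add: B_def add_increasing2)
    next
      case 2
      have h: "\<bar>head M \<zeta> n\<bar> \<le> 2 * (2^n * d n * q M n)"
        using N[OF 2(1)] 2 mult_nonneg_nonneg[of "2^n * d n" "q M n"] d[of n] by (simp add: head_def less_imp_le)
      have "w n \<le> 4 * (2 * (2^n * d n * q M n) / (q M n * d n))"
        by (intro order_trans[OF up] mult_left_mono divide_right_mono h) (use d(1)[of n] in \<open>auto intro: less_imp_le\<close>)
      also have "\<dots> = 8 * 2^n" using d(1)[of n] by simp
      finally have "(w n)\<^sup>2 \<le> (8 * 2^n)\<^sup>2" by (intro power_mono w0)
      also have "\<dots> = 64 * 4^n" by (simp add: power_mult_distrib power2_eq_square flip: power_mult_distrib)
      also have "\<dots> \<le> 64 * \<bar>t n\<bar>" using t4 by simp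
      finally have "(w n)\<^sup>2 / (t n)\<^sup>2 \<le> 64 * \<bar>t n\<bar> / (t n)\<^sup>2" by (intro divide_right_mono) auto
      also have "\<dots> = 64 / \<bar>t n\<bar>" 
      proof -
        have "64 * x / (x * x) = 64 / x" for x :: real by simp
        moreover have "(t n)\<^sup>2 = \<bar>t n\<bar> * \<bar>t n\<bar>" by (simp add: power2_eq_square)
        ultimately show ?thesis by metis
      qed
      also have "\<dots> \<le> 80 / \<bar>t n\<bar>" by (intro divide_right_mono) auto
      finally show ?thesis by (simp add: B_def add_increasing less_imp_le)
    next
      case 3
      have "\<bar>head M \<zeta> n\<bar> / (q M n * d n) = d n / q M n"
        using J[OF 3] 3 d(1)[of n] by (simp add: head_def power2_eq_square)
      also have "\<dots> \<le> 1 / 1" using d[of n] q_ge_1[of M n] by (intro frac_le) (auto intro: less_imp_le)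
      finally have "w n \<le> 4" using up[of n] by linarith
      then have "(w n)\<^sup>2 \<le> 4\<^sup>2" by (intro power_mono w0)
      then have "(w n)\<^sup>2 / (t n)\<^sup>2 \<le> 16 / \<bar>t n\<bar>" using t2[of n] by (intro frac_le) auto
      also have "\<dots> \<le> 80 / \<bar>t n\<bar>" by (intro divide_right_mono) auto
      finally show ?thesis by (simp add: B_def add_increasing less_imp_le)
    qed
  qed
  show "summable (\<lambda>n. (w n)\<^sup>2 / ((t n)\<^sup>2 + 1))"
  proof (rule summable_comparison_test'[OF summB])
    fix n
    have "(w n)\<^sup>2 / ((t n)\<^sup>2 + 1) \<le> (w n)\<^sup>2 / (t n)\<^sup>2" by (intro divide_left_mono mult_pos_pos add_nonneg_pos) auto
    then show "norm ((w n)\<^sup>2 / ((t n)\<^sup>2 + 1)) \<le> B n" using wB[of n] by simp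
  qed
  have B0: "0 \<le> B n" for n by (auto simp: B_def intro!: add_nonneg_nonneg divide_nonneg_nonneg intro: less_imp_le)
  have "w n \<le> sqrt (suminf B) * \<bar>t n\<bar>" for n
  proof -
    have "(w n)\<^sup>2 / (t n)\<^sup>2 \<le> suminf B"
      using wB[of n] sum_le_suminf[OF summB, of "{n}"] B0 by simp
    then have "(w n)\<^sup>2 \<le> suminf B * (t n)\<^sup>2" by (simp add: field_simps)
    then have "sqrt ((w n)\<^sup>2) \<le> sqrt (suminf B * (t n)\<^sup>2)" by (rule real_sqrt_le_mono)
    then show ?thesis using w0 by (simp add: real_sqrt_mult)
  qed
  then show "\<exists>C. \<forall>n. w n \<le> C * \<bar>t n\<bar>" by blast
qed

text \<open>The identity holds factor by factor: in each of the four classes the two numerators on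
  the left are the two on the right, possibly exchanged.\<close>

lemma residue_product:
  assumes n: "near \<zeta>1" "near \<zeta>2" "near \<gamma>" "near s"
    and D: "M1 \<inter> M2 = {}" "M1 \<inter> N1 = {}" "M2 \<inter> N2 = {}"
      "N1 \<inter> N2 = {}" "N1 \<inter> M2 = {}" "N2 \<inter> M1 = {}" "M1 \<union> M2 \<union> N1 \<union> N2 = UNIV"
    and \<zeta>2: "\<zeta>2 = (\<lambda>n. if n \<in> N1 then \<gamma> n else s n)" and \<zeta>1: "\<zeta>1 = (\<lambda>n. if n \<in> N2 then \<gamma> n else s n)"
  shows "res M1 \<zeta>2 n * res M2 \<zeta>1 n = res (M1 \<union> M2) \<gamma> n * res {} s n"
proof -
  have mem: "(x \<in> M1 \<and> x \<notin> M2 \<and> x \<notin> N1 \<and> x \<notin> N2) \<or> (x \<notin> M1 \<and> x \<in> M2 \<and> x \<notin> N1 \<and> x \<notin> N2) \<or>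
      (x \<notin> M1 \<and> x \<notin> M2 \<and> x \<in> N1 \<and> x \<notin> N2) \<or> (x \<notin> M1 \<and> x \<notin> M2 \<and> x \<notin> N1 \<and> x \<in> N2)" for x
    using D by blast
  have h: "head M1 \<zeta>2 n * head M2 \<zeta>1 n = head (M1 \<union> M2) \<gamma> n * head {} s n"
    using mem[of n] by (auto simp: head_def \<zeta>1 \<zeta>2)
  have f: "fac M1 \<zeta>2 j z * fac M2 \<zeta>1 j z = fac (M1 \<union> M2) \<gamma> j z * fac {} s j z" for j z
    using mem[of j] by (auto simp: fac_def \<zeta>1 \<zeta>2)
  have "resK M1 \<zeta>2 K n * resK M2 \<zeta>1 K n = resK (M1 \<union> M2) \<gamma> K n * resK {} s K n" for K
  proof -
    have "resK M1 \<zeta>2 K n * resK M2 \<zeta>1 K n = (head M1 \<zeta>2 n * head M2 \<zeta>1 n) *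
        (\<Prod>j\<in>{..<K} - {n}. fac M1 \<zeta>2 j (t n) * fac M2 \<zeta>1 j (t n))"
      unfolding resK_def prod.distrib by (simp add: mult_ac)
    also have "\<dots> = resK (M1 \<union> M2) \<gamma> K n * resK {} s K n"
      unfolding f h resK_def prod.distrib by (simp add: mult_ac)
    finally show ?thesis .
  qed
  moreover have "(\<lambda>K. resK M1 \<zeta>2 K n * resK M2 \<zeta>1 K n) \<longlonglongrightarrow> res M1 \<zeta>2 n * res M2 \<zeta>1 n"
    "(\<lambda>K. resK (M1 \<union> M2) \<gamma> K n * resK {} s K n) \<longlonglongrightarrow> res (M1 \<union> M2) \<gamma> n * res {} s n"
    by (intro tendsto_mult resK_tendsto n)+
  ultimately show ?thesis using LIMSEQ_unique by auto
qed

section \<open>The two biorthogonal systems on the sparse sequence\<close>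

lemma cauchy_systems_exist:
  assumes T: "\<And>r. finite {x \<in> T. \<bar>x\<bar> \<le> r}"
  obtains v u b \<gamma> :: "nat \<Rightarrow> real" and N1 N2 :: "nat set" where
    "\<And>n. 0 < v n" "\<And>n. u n \<noteq> 0" "\<And>n. b n \<noteq> 0"
    "summable (\<lambda>n. (v n)\<^sup>2 / ((t n)\<^sup>2 + 1))" "summable (\<lambda>n. (u n)\<^sup>2 / ((t n)\<^sup>2 + 1))"
    "N1 \<inter> N2 = {}" "inj \<gamma>" "\<And>j. \<gamma> j \<notin> T" "\<And>j n. \<gamma> j \<noteq> t n"
    "\<And>j. j \<in> N1 \<union> N2 \<Longrightarrow> summable (\<lambda>n. \<bar>u n * v n / (t n - \<gamma> j)\<bar>)"
    "\<And>j. j \<in> N1 \<union> N2 \<Longrightarrow> (\<Sum>n. u n * v n / (t n - \<gamma> j)) = 0"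
    "\<And>j k. j \<in> N1 \<Longrightarrow> summable (\<lambda>n. \<bar>b n * v n * t n ^ k / (t n - \<gamma> j)\<bar>)"
    "\<And>j k. j \<in> N1 \<Longrightarrow> (\<Sum>n. b n * v n * t n ^ k / (t n - \<gamma> j)) = 0"
    "\<And>j k. j \<in> N2 \<Longrightarrow> summable (\<lambda>n. \<bar>b n * u n * t n ^ k / (t n - \<gamma> j)\<bar>)"
    "\<And>j k. j \<in> N2 \<Longrightarrow> (\<Sum>n. b n * u n * t n ^ k / (t n - \<gamma> j)) = 0"
    "\<And>k. summable (\<lambda>n. (b n * t n ^ k)\<^sup>2)"
    "\<And>m. \<exists>D. \<forall>n'>m. \<exists>F a. finite F \<and> F \<subseteq> N1 \<union> N2 \<and>
      (\<forall>n. \<bar>(\<Sum>j\<in>F. a j * (v n / (t n - \<gamma> j))) - (if n = m then 1 else 0)\<bar> \<le> (if n < n' then 0 else D * (1/2)^n))"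
    "\<And>m. \<exists>D. \<forall>n'>m. \<exists>F a. finite F \<and> F \<subseteq> N1 \<union> N2 \<and>
      (\<forall>n. \<bar>(\<Sum>j\<in>F. a j * (u n / (t n - \<gamma> j))) - (if n = m then 1 else 0)\<bar> \<le> (if n < n' then 0 else D * (1/2)^n))"
proof -
  \<comment> \<open>Poles in \<open>M1\<close> and \<open>M2\<close> are unaccompanied; the period 8 lets each of \<open>N1\<close> and \<open>N2\<close> outnumber \<open>M1 \<union> M2\<close>.\<close>
  define cls where "cls R = {n::nat. n mod 8 \<in> R}" for R :: "nat set"
  define M1 where "M1 = cls {0}"
  define M2 where "M2 = cls {1}"
  define N1 where "N1 = cls {2, 4, 6}"
  define N2 where "N2 = cls {3, 5, 7}"
  have disj: "M1 \<inter> M2 = {}" "M1 \<inter> N1 = {}" "M2 \<inter> N2 = {}" "N1 \<inter> N2 = {}" "N1 \<inter> M2 = {}" "N2 \<inter> M1 = {}"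
    by (auto simp: M1_def M2_def N1_def N2_def cls_def)
  have cover: "M1 \<union> M2 \<union> N1 \<union> N2 = UNIV"
  proof -
    have "n mod 8 \<in> {0, 1, 2, 3, 4, 5, 6, 7}" for n :: nat
      using mod_less_divisor[of 8 n] by (simp only: insert_iff empty_iff) arith
    then show ?thesis by (auto simp: M1_def M2_def N1_def N2_def cls_def)
  qed
  have M12: "M1 \<union> M2 = cls {0, 1}" by (auto simp: M1_def M2_def cls_def)
  have inf: "infinite M1" "infinite M2" "infinite (M1 \<union> M2)"
    unfolding M1_def M2_def cls_def using infinite_residues[of 0 "{}"] infinite_residues[of 1 "{}"] by auto
  have room1: "\<exists>K\<ge>n'. card ((M1 \<union> M2) \<inter> {..<K}) + 2 \<le> card (N1 \<inter> {n'..<K})" for n'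
    unfolding M12 N1_def cls_def by (rule residue_room) auto
  have room2: "\<exists>K\<ge>n'. card ((M1 \<union> M2) \<inter> {..<K}) + 2 \<le> card (N2 \<inter> {n'..<K})" for n'
    unfolding M12 N2_def cls_def by (rule residue_room) auto
  \<comment> \<open>\<open>b n\<close> will be of order \<open>d n\<close>, and \<open>E n\<close> is chosen such that \<open>v n\<close> on \<open>N1\<close> and \<open>u n\<close> on \<open>N2\<close> are of order \<open>2 ^ n\<close>.\<close>
  define d where "d n = (if n \<in> M1 then (1/8)^(n+2) / sqrt (q M1 n) else if n \<in> M2 then (1/8)^(n+2) / sqrt (q M2 n)
    else (1/8)^(n+2) / (q M1 n * q M2 n))" for n
  define E where "E n = (if n \<in> N1 then 2^n * d n * q M1 n else if n \<in> N2 then 2^n * d n * q M2 n else (1/8)^(n+2))" for n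
  have d0: "0 < d n" for n by (auto simp: d_def intro!: divide_pos_pos mult_pos_pos)
  have sq1: "1 \<le> sqrt (q M n)" for M n using q_ge_1[of M n] by simp
  have qq1: "1 \<le> q M1 n * q M2 n" for n
    using mult_mono[OF q_ge_1[of M1 n] q_ge_1[of M2 n]] by (simp add: less_imp_le)
  have d8: "d n \<le> (1/8)^(n+2)" for n
    using sq1[of M1 n] sq1[of M2 n] qq1[of n]
    by (auto simp: d_def divide_le_eq_1 intro!: divide_left_mono[where b = 1, simplified])
  have d1: "d n \<le> 1" for n
    using d8[of n] power_le_one[of "1/8::real" "n+2"] by linarith
  \<comment> \<open>Which \<open>q\<close> controls \<open>d n\<close> depends on the class of
    \<open>n\<close>; the sum of both reciprocals is a common bound and makes all moments of
    \<open>b\<close> finite.\<close>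
  have ddq: "(d n)\<^sup>2 \<le> 1 / q M1 n + 1 / q M2 n" for n
  proof -
    have e2: "(1/8::real)^(n+2) \<le> 1" by (rule power_le_one) auto
    have e1: "((1/8::real)^(n+2))\<^sup>2 \<le> 1" by (intro power_le_one e2) auto
    have sq: "(c / sqrt x)\<^sup>2 \<le> 1 / x" if "c\<^sup>2 \<le> 1" "0 < x" for c x :: real
      using that by (simp add: power_divide divide_right_mono)
    have q0: "0 \<le> 1 / q M1 n" "0 \<le> 1 / q M2 n" by (auto intro: less_imp_le)
    consider "n \<in> M1" | "n \<notin> M1" "n \<in> M2" | "n \<notin> M1" "n \<notin> M2" by blast
    then show ?thesis
    proof cases
      case 1
      then have "(d n)\<^sup>2 \<le> 1 / q M1 n"
        using sq[OF e1 q_pos[of M1 n]] by (simp only: d_def if_True)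
      then show ?thesis using q0 by linarith
    next
      case 2
      then have "(d n)\<^sup>2 \<le> 1 / q M2 n"
        using sq[OF e1 q_pos[of M2 n]] by (simp only: d_def if_True if_False)
      then show ?thesis using q0 by linarith
    next
      case 3
      have "(d n)\<^sup>2 \<le> d n" using d0[of n] d1[of n] by (simp add: power2_eq_square mult_le_cancel_left1)
      also have "\<dots> \<le> 1 / (q M1 n * q M2 n)"
        using divide_right_mono[OF e2, of "q M1 n * q M2 n"] 3
        by (simp only: d_def if_False) (simp add: less_imp_le)
      also have "\<dots> \<le> 1 / q M1 n"
        using mult_left_mono[OF q_ge_1[of M2 n], of "q M1 n"] by (intro divide_left_mono) (auto simp: less_imp_le)
      finally show ?thesis using q0 by linarith
    qed
  qed
  have E0: "0 < E n" for n by (auto simp: E_def intro!: mult_pos_pos d0)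
  \<comment> \<open>Off \<open>M1\<close> and \<open>M2\<close> the divisor
    \<open>q M1 n * q M2 n\<close> in \<open>d n\<close> cancels the factor \<open>q\<close> in
    \<open>E n\<close>; the remaining powers give
    \<open>2^n * (1/8)^(n+2) = (1/4)^(n+2) / 4\<close>, which is what \<open>near\<close>
    tolerates.\<close>
  have E4: "2 * E n \<le> (1/4)^(n+2)" for n
  proof -
    have e: "(2::real)^n * (1/8)^(n+2) = (1/4)^(n+2) / 4"
    proof -
      have "(1/8::real)^(n+2) * 2^(n+2) = (1/8 * 2)^(n+2)" by (rule power_mult_distrib[symmetric])
      then show ?thesis by (simp add: power_add)
    qed
    have "d n * q M1 n \<le> (1/8)^(n+2)" if "n \<in> N1"
    proof -
      have "n \<notin> M1" "n \<notin> M2" using that disj by auto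
      then have "d n * q M1 n = (1/8)^(n+2) / q M2 n" by (simp add: d_def)
      also have "\<dots> \<le> (1/8)^(n+2) / 1" using q_ge_1[of M2 n] by (intro divide_left_mono) auto
      finally show ?thesis by simp
    qed
    moreover have "d n * q M2 n \<le> (1/8)^(n+2)" if "n \<in> N2"
    proof -
      have "n \<notin> M1" "n \<notin> M2" using that disj by auto
      then have "d n * q M2 n = (1/8)^(n+2) / q M1 n" by (simp add: d_def)
      also have "\<dots> \<le> (1/8)^(n+2) / 1" using q_ge_1[of M1 n] by (intro divide_left_mono) auto
      finally show ?thesis by simp
    qed
    moreover have "(1/8::real)^(n+2) \<le> 2^n * (1/8)^(n+2)"
      using one_le_power[of "2::real" n] by (simp add: mult_le_cancel_right1)
    ultimately have "E n \<le> 2^n * (1/8)^(n+2)"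
      unfolding E_def by (auto simp: mult.assoc intro!: mult_left_mono)
    then show ?thesis using e zero_le_power[of "1/4::real" "n+2"] by linarith
  qed
  \<comment> \<open>Local finiteness of \<open>T\<close> leaves points off \<open>T\<close> in this
    interval, so the kernels at the \<open>\<gamma> n\<close> will be multiples of Cauchy
    vectors.\<close>
  have "\<exists>x. t n + E n < x \<and> x < t n + 2 * E n \<and> x \<notin> T" for n
  proof -
    have "infinite {t n + E n<..<t n + 2 * E n}" using E0[of n] by (simp add: infinite_Ioo)
    moreover have "finite (T \<inter> {t n + E n<..<t n + 2 * E n})"
      by (rule finite_subset[OF _ T[of "\<bar>t n\<bar> + 2 * E n"]]) (use E0[of n] in auto)
    ultimately have "\<not> {t n + E n<..<t n + 2 * E n} \<subseteq> T"
      by (metis inf.absorb_iff2)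
    then show ?thesis by auto
  qed
  then obtain \<gamma> where \<gamma>: "\<And>n. t n + E n < \<gamma> n" "\<And>n. \<gamma> n < t n + 2 * E n" "\<And>n. \<gamma> n \<notin> T" by metis
  \<comment> \<open>Zeros of the fully accompanied product are placed below their poles, which makes
    its residues positive.\<close>
  define s where "s n = t n - (d n)\<^sup>2" for n
  define \<zeta>1 where "\<zeta>1 = (\<lambda>n. if n \<in> N2 then \<gamma> n else s n)"
  define \<zeta>2 where "\<zeta>2 = (\<lambda>n. if n \<in> N1 then \<gamma> n else s n)"
  have near\<gamma>: "near \<gamma>" unfolding near_def
  proof
    fix j show "\<bar>\<gamma> j - t j\<bar> \<le> (1/4)^(j+2)"
      using \<gamma>(1,2)[of j] E0[of j] E4[of j] by linarith
  qed
  have nears: "near s" unfolding near_def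
  proof
    fix j
    have "(d j)\<^sup>2 \<le> d j" using d0[of j] d1[of j] by (simp add: power2_eq_square mult_le_cancel_left1)
    also note d8[of j]
    also have "(1/8::real)^(j+2) \<le> (1/4)^(j+2)" by (intro power_mono) auto
    finally show "\<bar>s j - t j\<bar> \<le> (1/4)^(j+2)" by (simp add: s_def)
  qed
  have near1: "near \<zeta>1" and near2: "near \<zeta>2"
    using near\<gamma> nears by (auto simp: near_def \<zeta>1_def \<zeta>2_def)
  have st: "s n \<noteq> t n" for n using d0[of n] by (simp add: s_def)
  have \<gamma>t: "\<gamma> j \<noteq> t n" for j n
  proof (cases "j = n")
    case True then show ?thesis using \<gamma>(1)[of n] E0[of n] by auto
  next
    case False then show ?thesis using near_le_1[OF near\<gamma>, of j] t_dist(3)[OF False] by auto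
  qed
  have inj\<gamma>: "inj \<gamma>"
  proof (rule injI)
    fix i j assume "\<gamma> i = \<gamma> j"
    then show "i = j" using near_le_1[OF near\<gamma>, of i] near_le_1[OF near\<gamma>, of j] t_dist(3)[of i j] by force
  qed
  define r1 where "r1 = res M2 \<zeta>1"
  define r2 where "r2 = res M1 \<zeta>2"
  define \<beta> where "\<beta> = res {} s"
  \<comment> \<open>The sign goes into \<open>b\<close> because \<open>v\<close> must be positive,
    being the square root of a mass of \<open>\<mu>\<close>. No sign is imposed on
    \<open>u\<close>.\<close>
  define b where "b n = sgn (r2 n) * sqrt (\<beta> n)" for n
  define v where "v n = \<bar>r2 n\<bar> / sqrt (\<beta> n)" for n
  define u where "u n = r1 n / b n" for n
  have sd: "t n - s n = (d n)\<^sup>2" for n by (simp add: s_def)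
  note ub = unit_residue_bounds[OF nears sd d0, folded \<beta>_def]
  have r1: "r1 n \<noteq> 0" for n unfolding r1_def
    by (rule res_nonzero[OF near1]) (use st \<gamma>t in \<open>auto simp: \<zeta>1_def\<close>)
  have r2: "r2 n \<noteq> 0" for n unfolding r2_def
    by (rule res_nonzero[OF near2]) (use st \<gamma>t in \<open>auto simp: \<zeta>2_def\<close>)
  have b0: "b n \<noteq> 0" for n using r2[of n] ub(1)[of n] by (simp add: b_def sgn_zero_iff)
  have bb: "(b n)\<^sup>2 = \<beta> n" for n
    using r2[of n] ub(1)[of n] by (simp add: b_def power_mult_distrib sgn_if less_imp_le)
  have bv: "b n * v n = r2 n" for n
    using ub(1)[of n] by (simp add: b_def v_def sgn_mult_abs)
  have bu: "b n * u n = r1 n" for n using b0 by (simp add: u_def)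
  have uv: "u n * v n = res (M1 \<union> M2) \<gamma> n" for n
  proof -
    have "(b n)\<^sup>2 * (u n * v n) = r2 n * r1 n" by (simp add: power2_eq_square flip: bv bu)
    also have "\<dots> = res (M1 \<union> M2) \<gamma> n * \<beta> n"
      unfolding r1_def r2_def \<beta>_def
      by (rule residue_product[OF near1 near2 near\<gamma> nears disj cover \<zeta>2_def \<zeta>1_def])
    finally show ?thesis using ub(1)[of n] by (simp add: bb)
  qed
  have absu: "\<bar>u n\<bar> = \<bar>r1 n\<bar> / sqrt (\<beta> n)" for n
    using r2[of n] ub(1)[of n] by (simp add: u_def b_def abs_mult abs_divide sgn_if less_imp_le)
  have W2: "summable (\<lambda>n. (v n)\<^sup>2 / ((t n)\<^sup>2 + 1))" "\<exists>C. \<forall>n. v n \<le> C * \<bar>t n\<bar>" "\<And>n. n \<in> N1 \<Longrightarrow> 2^n * (1/4) \<le> v n"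
  proof -
    have p1: "d n = (1/8)^(n+2) / sqrt (q M1 n)" if "n \<in> M1" for n
      using that by (simp only: d_def if_True)
    have p2: "2^n * d n * q M1 n \<le> \<zeta>2 n - t n" "\<zeta>2 n - t n \<le> 2 * (2^n * d n * q M1 n)" if "n \<in> N1" for n
      using \<gamma>(1,2)[of n] that by (simp_all add: E_def \<zeta>2_def)
    have p3: "t n - \<zeta>2 n = (d n)\<^sup>2" if "n \<notin> M1" "n \<notin> N1" for n
      using that by (simp add: \<zeta>2_def sd)
    have p4: "v n = \<bar>res M1 \<zeta>2 n\<bar> / sqrt (res {} s n)" for n
      by (simp add: v_def r2_def \<beta>_def)
    show "summable (\<lambda>n. (v n)\<^sup>2 / ((t n)\<^sup>2 + 1))" by (rule weight_bounds(1)[OF nears near2 d0 d1 sd inf(1) disj(2) p1 p2 p3 p4])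
    show "\<exists>C. \<forall>n. v n \<le> C * \<bar>t n\<bar>" by (rule weight_bounds(2)[OF nears near2 d0 d1 sd inf(1) disj(2) p1 p2 p3 p4])
    show "2^n * (1/4) \<le> v n" if "n \<in> N1" for n by (rule weight_bounds(3)[OF nears near2 d0 d1 sd inf(1) disj(2) p1 p2 p3 p4]) (use that in auto)
  qed
  have W1: "summable (\<lambda>n. \<bar>u n\<bar>\<^sup>2 / ((t n)\<^sup>2 + 1))" "\<exists>C. \<forall>n. \<bar>u n\<bar> \<le> C * \<bar>t n\<bar>" "\<And>n. n \<in> N2 \<Longrightarrow> 2^n * (1/4) \<le> \<bar>u n\<bar>"
  proof -
    have p1: "d n = (1/8)^(n+2) / sqrt (q M2 n)" if "n \<in> M2" for n
    proof -
      have "n \<notin> M1" using that disj by auto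
      then show ?thesis using that by (simp only: d_def if_True if_False)
    qed
    have p2: "2^n * d n * q M2 n \<le> \<zeta>1 n - t n" "\<zeta>1 n - t n \<le> 2 * (2^n * d n * q M2 n)" if "n \<in> N2" for n
    proof -
      have "n \<notin> N1" using that disj by auto
      then show "2^n * d n * q M2 n \<le> \<zeta>1 n - t n" "\<zeta>1 n - t n \<le> 2 * (2^n * d n * q M2 n)"
        using \<gamma>(1,2)[of n] that by (simp_all add: E_def \<zeta>1_def)
    qed
    have p3: "t n - \<zeta>1 n = (d n)\<^sup>2" if "n \<notin> M2" "n \<notin> N2" for n
      using that by (simp add: \<zeta>1_def sd)
    have p4: "\<bar>u n\<bar> = \<bar>res M2 \<zeta>1 n\<bar> / sqrt (res {} s n)" for n
      by (simp add: absu r1_def \<beta>_def)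
    show "summable (\<lambda>n. \<bar>u n\<bar>\<^sup>2 / ((t n)\<^sup>2 + 1))" by (rule weight_bounds(1)[OF nears near1 d0 d1 sd inf(2) disj(3) p1 p2 p3 p4])
    show "\<exists>C. \<forall>n. \<bar>u n\<bar> \<le> C * \<bar>t n\<bar>" by (rule weight_bounds(2)[OF nears near1 d0 d1 sd inf(2) disj(3) p1 p2 p3 p4])
    show "2^n * (1/4) \<le> \<bar>u n\<bar>" if "n \<in> N2" for n by (rule weight_bounds(3)[OF nears near1 d0 d1 sd inf(2) disj(3) p1 p2 p3 p4]) (use that in auto)
  qed
  have v0: "0 < v n" for n using r2[of n] ub(1)[of n] by (simp add: v_def)
  have u0: "u n \<noteq> 0" for n using r1 b0 by (simp add: u_def)
  obtain C1 C2 where C1: "\<And>n. v n \<le> C1 * \<bar>t n\<bar>" and C2: "\<And>n. \<bar>u n\<bar> \<le> C2 * \<bar>t n\<bar>"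
    using W1(2) W2(2) by blast
  have part: "(M1 \<union> M2) \<union> (N1 \<union> N2) = UNIV" "(M1 \<union> M2) \<inter> (N1 \<union> N2) = {}"
    using disj cover by auto
  have notM: "j \<notin> M1 \<union> M2" if "j \<in> N1 \<union> N2" for j using that part by blast
  show thesis
  proof (rule that[of v u b N1 N2 \<gamma>])
    show "0 < v n" "u n \<noteq> 0" "b n \<noteq> 0" for n by (rule v0 u0 b0)+
    show "summable (\<lambda>n. (v n)\<^sup>2 / ((t n)\<^sup>2 + 1))" "summable (\<lambda>n. (u n)\<^sup>2 / ((t n)\<^sup>2 + 1))"
      using W1(1) W2(1) by auto
    show "N1 \<inter> N2 = {}" "inj \<gamma>" "\<gamma> j \<notin> T" "\<gamma> j \<noteq> t n" for j n by (rule disj(4) inj\<gamma> \<gamma>(3) \<gamma>t)+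
    show "summable (\<lambda>n. \<bar>u n * v n / (t n - \<gamma> j)\<bar>)" "(\<Sum>n. u n * v n / (t n - \<gamma> j)) = 0"
      if "j \<in> N1 \<union> N2" for j
      using residue_series[OF near\<gamma> inf(3) notM[OF that] \<gamma>t, of 0] by (simp_all add: uv)
    show "summable (\<lambda>n. \<bar>b n * v n * t n ^ k / (t n - \<gamma> j)\<bar>)" "(\<Sum>n. b n * v n * t n ^ k / (t n - \<gamma> j)) = 0"
      if "j \<in> N1" for j k
    proof -
      have "\<zeta>2 j = \<gamma> j" "j \<notin> M1" using that disj by (auto simp: \<zeta>2_def)
      then show "summable (\<lambda>n. \<bar>b n * v n * t n ^ k / (t n - \<gamma> j)\<bar>)" "(\<Sum>n. b n * v n * t n ^ k / (t n - \<gamma> j)) = 0"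
        using residue_series[OF near2 inf(1), of j k] \<gamma>t by (simp_all add: bv r2_def)
    qed
    show "summable (\<lambda>n. \<bar>b n * u n * t n ^ k / (t n - \<gamma> j)\<bar>)" "(\<Sum>n. b n * u n * t n ^ k / (t n - \<gamma> j)) = 0"
      if "j \<in> N2" for j k
    proof -
      have "\<zeta>1 j = \<gamma> j" "j \<notin> M2" using that disj by (auto simp: \<zeta>1_def)
      then show "summable (\<lambda>n. \<bar>b n * u n * t n ^ k / (t n - \<gamma> j)\<bar>)" "(\<Sum>n. b n * u n * t n ^ k / (t n - \<gamma> j)) = 0"
        using residue_series[OF near1 inf(2), of j k] \<gamma>t by (simp_all add: bu r1_def)
    qed
    show "summable (\<lambda>n. (b n * t n ^ k)\<^sup>2)" for k
    proof (rule summable_comparison_test')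
      show "summable (\<lambda>n. 2 * \<bar>t n\<bar> ^ (2*k) / q M1 n + 2 * \<bar>t n\<bar> ^ (2*k) / q M2 n)"
        by (intro summable_add summable_power_div_q inf)
      fix n
      have "\<beta> n \<le> 2 * (1 / q M1 n + 1 / q M2 n)" 
        by (rule order_trans[OF ub(4) mult_left_mono[OF ddq]]) simp
      then have "\<beta> n * \<bar>t n\<bar> ^ (2*k) \<le> 2 * (1 / q M1 n + 1 / q M2 n) * \<bar>t n\<bar> ^ (2*k)"
        by (rule mult_right_mono) simp
      also have "\<dots> = 2 * \<bar>t n\<bar> ^ (2*k) / q M1 n + 2 * \<bar>t n\<bar> ^ (2*k) / q M2 n" by (simp add: algebra_simps)
      finally have *: "\<beta> n * \<bar>t n\<bar> ^ (2*k) \<le> 2 * \<bar>t n\<bar> ^ (2*k) / q M1 n + 2 * \<bar>t n\<bar> ^ (2*k) / q M2 n" .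
      have sq: "(b n * t n ^ k)\<^sup>2 = \<beta> n * \<bar>t n\<bar> ^ (2*k)"
        by (simp add: power_mult_distrib bb power_mult[symmetric] mult.commute[of k] power_even_abs)
      show "norm ((b n * t n ^ k)\<^sup>2) \<le> 2 * \<bar>t n\<bar> ^ (2*k) / q M1 n + 2 * \<bar>t n\<bar> ^ (2*k) / q M2 n"
        unfolding real_norm_def abs_power2 unfolding sq by (rule *)
    qed
    \<comment> \<open>Errors of combinations of the \<open>v\<close> vectors are governed by
      \<open>1 / u n\<close>, so the nodes left free come from \<open>N2\<close>, where
      \<open>u\<close> is large. For the \<open>u\<close> vectors the roles are exchanged and the
      free nodes come from \<open>N1\<close>.\<close>
    show "\<exists>D. \<forall>n'>m. \<exists>F a. finite F \<and> F \<subseteq> N1 \<union> N2 \<and>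
      (\<forall>n. \<bar>(\<Sum>j\<in>F. a j * (v n / (t n - \<gamma> j))) - (if n = m then 1 else 0)\<bar> \<le> (if n < n' then 0 else D * (1/2)^n))" for m
    proof (rule approximating_combination[OF near\<gamma> part _ \<gamma>t _ room2, where u = u])
      show "inj_on \<gamma> (N1 \<union> N2)" using inj\<gamma> inj_on_subset by blast
      show "\<bar>v n\<bar> \<le> C1 * \<bar>t n\<bar>" for n using C1[of n] v0[of n] by simp
      show "2^n * (1/4) \<le> \<bar>u n\<bar>" if "n \<in> N2" for n by (rule W1(3)[OF that])
    qed (auto simp: uv mult.commute[of "v _"])
    show "\<exists>D. \<forall>n'>m. \<exists>F a. finite F \<and> F \<subseteq> N1 \<union> N2 \<and>
      (\<forall>n. \<bar>(\<Sum>j\<in>F. a j * (u n / (t n - \<gamma> j))) - (if n = m then 1 else 0)\<bar> \<le> (if n < n' then 0 else D * (1/2)^n))" for m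
    proof (rule approximating_combination[OF near\<gamma> part _ \<gamma>t _ room1, where u = v])
      show "inj_on \<gamma> (N1 \<union> N2)" using inj\<gamma> inj_on_subset by blast
      show "\<bar>u n\<bar> \<le> C2 * \<bar>t n\<bar>" for n by (rule C2)
      show "2^n * (1/4) \<le> \<bar>v n\<bar>" if "n \<in> N1" for n using W2(3)[OF that] v0[of n] by simp
    qed (auto simp: uv)
  qed
qed

end

section \<open>Transfer from the sparse sequence to \<open>T\<close>\<close>

lemma spectral_seq_unbounded:
  assumes "spectral_seq T" shows "\<exists>x\<in>T. B \<le> \<bar>x\<bar>"
proof (rule ccontr)
  assume "\<not> ?thesis"
  then have "T \<subseteq> {x \<in> T. \<bar>x\<bar> \<le> B}" by auto
  moreover have "finite {x \<in> T. \<bar>x\<bar> \<le> B}" using assms by (simp add: spectral_seq_def)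
  ultimately have "finite T" by (rule finite_subset)
  then show False using assms by (simp add: spectral_seq_def)
qed

lemma spectral_seq_countable:
  assumes "spectral_seq T" shows "countable T"
proof -
  have "countable (\<Union>n::nat. {x \<in> T. \<bar>x\<bar> \<le> real n})"
    using assms by (intro countable_UN) (auto simp: spectral_seq_def intro: countable_finite)
  moreover have "T = (\<Union>n::nat. {x \<in> T. \<bar>x\<bar> \<le> real n})" using real_arch_simple by auto
  ultimately show ?thesis by simp
qed

lemma sparse_subsequence:
  assumes "spectral_seq T"
  obtains t where "sparse t" "range t \<subseteq> T"
proof -
  obtain pick where pick: "\<And>B. pick B \<in> T" "\<And>B. B \<le> \<bar>pick B\<bar>"
    using spectral_seq_unbounded[OF assms] by metis
  \<comment> \<open>\<open>P\<close> carries the running product, so each node can be picked beyond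
    a bound involving all earlier ones.\<close>
  define P where "P = rec_nat 1 (\<lambda>n p. p * \<bar>pick (4^(n+2) * p\<^sup>2)\<bar>)"
  define t where "t n = pick (4^(n+2) * (P n)\<^sup>2)" for n
  have P: "P n = (\<Prod>i<n. \<bar>t i\<bar>)" for n
    by (induction n) (simp_all add: P_def t_def)
  have "sparse t"
  proof
    fix n
    have "4^(n+2) * (P n)\<^sup>2 \<le> \<bar>t n\<bar>" using pick(2) by (simp only: t_def)
    then show "4^(n+2) * (\<Prod>i<n. \<bar>t i\<bar>)\<^sup>2 \<le> \<bar>t n\<bar>" by (simp only: P)
  qed
  moreover have "range t \<subseteq> T" using pick(1) by (auto simp: t_def)
  ultimately show thesis by (rule that)
qed

lemma has_sum_range:
  fixes f :: "'a \<Rightarrow> real"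
  assumes inj: "inj t" and sub: "range t \<subseteq> T" and z: "\<And>s. s \<in> T - range t \<Longrightarrow> f s = 0"
    and sm: "summable (\<lambda>n. \<bar>f (t n)\<bar>)"
  shows "(f has_sum (\<Sum>n. f (t n))) T"
proof -
  have "((\<lambda>n. f (t n)) has_sum (\<Sum>n. f (t n))) UNIV"
    using sm by (intro norm_summable_imp_has_sum summable_sums) (auto intro: summable_rabs_cancel)
  then have "(f has_sum (\<Sum>n. f (t n))) (range t)"
    by (subst has_sum_reindex[OF inj]) (simp add: o_def)
  then show ?thesis
    by (subst has_sum_cong_neutral[of "range t" T f f]) (use sub z in auto)
qed

lemma cauchy_weights_exist:
  assumes T: "spectral_seq T"
  obtains T' :: "real set" and V U B :: "real \<Rightarrow> real" and \<Gamma>1 \<Gamma>2 :: "real set" where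
    "T' \<subseteq> T" "infinite T'" "\<And>s. s \<in> T \<Longrightarrow> 0 < V s" "\<And>s. s \<in> T' \<longleftrightarrow> U s \<noteq> 0" "\<And>s. s \<in> T' \<longleftrightarrow> B s \<noteq> 0"
    "(\<lambda>s. (V s)\<^sup>2 / (s\<^sup>2 + 1)) summable_on T" "(\<lambda>s. (U s)\<^sup>2 / (s\<^sup>2 + 1)) summable_on T"
    "\<And>k. (\<lambda>s. (B s * s ^ k)\<^sup>2) summable_on T"
    "\<Gamma>1 \<inter> \<Gamma>2 = {}" "(\<Gamma>1 \<union> \<Gamma>2) \<inter> T = {}"
    "\<And>\<gamma>. \<gamma> \<in> \<Gamma>1 \<union> \<Gamma>2 \<Longrightarrow> ((\<lambda>s. U s * V s / (s - \<gamma>)) has_sum 0) T"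
    "\<And>\<gamma> k. \<gamma> \<in> \<Gamma>2 \<Longrightarrow> ((\<lambda>s. B s * s ^ k * V s / (s - \<gamma>)) has_sum 0) T"
    "\<And>\<gamma> k. \<gamma> \<in> \<Gamma>1 \<Longrightarrow> ((\<lambda>s. B s * s ^ k * U s / (s - \<gamma>)) has_sum 0) T"
    "\<And>s0 e. s0 \<in> T' \<Longrightarrow> 0 < e \<Longrightarrow> \<exists>F a x. finite F \<and> F \<subseteq> \<Gamma>1 \<union> \<Gamma>2 \<and> x < e \<and>
      ((\<lambda>s. ((\<Sum>\<gamma>\<in>F. a \<gamma> * (V s / (s - \<gamma>))) - (if s = s0 then 1 else 0))\<^sup>2) has_sum x) T'"
    "\<And>s0 e. s0 \<in> T' \<Longrightarrow> 0 < e \<Longrightarrow> \<exists>F a x. finite F \<and> F \<subseteq> \<Gamma>1 \<union> \<Gamma>2 \<and> x < e \<and>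
      ((\<lambda>s. ((\<Sum>\<gamma>\<in>F. a \<gamma> * (U s / (s - \<gamma>))) - (if s = s0 then 1 else 0))\<^sup>2) has_sum x) T'"
proof -
  obtain t where t: "sparse t" "range t \<subseteq> T" using sparse_subsequence[OF T] .
  interpret sparse t by fact
  have fin: "finite {x \<in> T. \<bar>x\<bar> \<le> r}" for r using T by (simp add: spectral_seq_def)
  obtain v u b \<gamma> :: "nat \<Rightarrow> real" and N1 N2 :: "nat set" where
    v0: "\<And>n. 0 < v n" and u0: "\<And>n. u n \<noteq> 0" and b0: "\<And>n. b n \<noteq> 0"
    and vs: "summable (\<lambda>n. (v n)\<^sup>2 / ((t n)\<^sup>2 + 1))" and us: "summable (\<lambda>n. (u n)\<^sup>2 / ((t n)\<^sup>2 + 1))"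
    and N12: "N1 \<inter> N2 = {}" and inj\<gamma>: "inj \<gamma>" and \<gamma>T: "\<And>j. \<gamma> j \<notin> T" and \<gamma>t: "\<And>j n. \<gamma> j \<noteq> t n"
    and uv: "\<And>j. j \<in> N1 \<union> N2 \<Longrightarrow> summable (\<lambda>n. \<bar>u n * v n / (t n - \<gamma> j)\<bar>)"
      "\<And>j. j \<in> N1 \<union> N2 \<Longrightarrow> (\<Sum>n. u n * v n / (t n - \<gamma> j)) = 0"
    and bv: "\<And>j k. j \<in> N1 \<Longrightarrow> summable (\<lambda>n. \<bar>b n * v n * t n ^ k / (t n - \<gamma> j)\<bar>)"
      "\<And>j k. j \<in> N1 \<Longrightarrow> (\<Sum>n. b n * v n * t n ^ k / (t n - \<gamma> j)) = 0"
    and bu: "\<And>j k. j \<in> N2 \<Longrightarrow> summable (\<lambda>n. \<bar>b n * u n * t n ^ k / (t n - \<gamma> j)\<bar>)"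
      "\<And>j k. j \<in> N2 \<Longrightarrow> (\<Sum>n. b n * u n * t n ^ k / (t n - \<gamma> j)) = 0"
    and bs: "\<And>k. summable (\<lambda>n. (b n * t n ^ k)\<^sup>2)"
    and av: "\<And>m. \<exists>D. \<forall>n'>m. \<exists>F a. finite F \<and> F \<subseteq> N1 \<union> N2 \<and>
      (\<forall>n. \<bar>(\<Sum>j\<in>F. a j * (v n / (t n - \<gamma> j))) - (if n = m then 1 else 0)\<bar> \<le> (if n < n' then 0 else D * (1/2)^n))"
    and au: "\<And>m. \<exists>D. \<forall>n'>m. \<exists>F a. finite F \<and> F \<subseteq> N1 \<union> N2 \<and>
      (\<forall>n. \<bar>(\<Sum>j\<in>F. a j * (u n / (t n - \<gamma> j))) - (if n = m then 1 else 0)\<bar> \<le> (if n < n' then 0 else D * (1/2)^n))"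
    by (rule cauchy_systems_exist[OF fin], rule that)
  define T' where "T' = range t"
  \<comment> \<open>Off \<open>T'\<close> any positive square-summable values serve; powers of 1/2
    along an enumeration of \<open>T\<close> provide them.\<close>
  define V where "V s = (if s \<in> T' then v (inv t s) else sqrt ((1/2) ^ to_nat_on T s))" for s
  define U where "U s = (if s \<in> T' then u (inv t s) else 0)" for s
  define B where "B s = (if s \<in> T' then b (inv t s) else 0)" for s
  have inv: "inv t (t n) = n" for n using inj_t by simp
  have tT: "t n \<in> T'" for n by (simp add: T'_def)
  have [simp]: "V (t n) = v n" "U (t n) = u n" "B (t n) = b n" for n
    by (simp_all add: V_def U_def B_def tT inv)
  have U0: "U s = 0" and B0: "B s = 0" if "s \<notin> range t" for s
    using that by (simp_all add: U_def B_def T'_def)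
  note hs = has_sum_range[OF inj_t t(2)]
  have appr: "\<exists>F a x. finite F \<and> F \<subseteq> \<gamma> ` N2 \<union> \<gamma> ` N1 \<and> x < e \<and>
      ((\<lambda>s. ((\<Sum>\<gamma>\<in>F. a \<gamma> * (W s / (s - \<gamma>))) - (if s = s0 then 1 else 0))\<^sup>2) has_sum x) T'"
    if ap: "\<And>m. \<exists>D. \<forall>n'>m. \<exists>F a. finite F \<and> F \<subseteq> N1 \<union> N2 \<and>
      (\<forall>n. \<bar>(\<Sum>j\<in>F. a j * (W (t n) / (t n - \<gamma> j))) - (if n = m then 1 else 0)\<bar> \<le> (if n < n' then 0 else D * (1/2)^n))"
      and s0: "s0 \<in> T'" and e: "0 < e" for W :: "real \<Rightarrow> real" and s0 e :: real
  proof -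
    obtain m where m: "s0 = t m" using s0 by (auto simp: T'_def)
    obtain D where D: "\<forall>n'>m. \<exists>F a. finite F \<and> F \<subseteq> N1 \<union> N2 \<and>
      (\<forall>n. \<bar>(\<Sum>j\<in>F. a j * (W (t n) / (t n - \<gamma> j))) - (if n = m then 1 else 0)\<bar> \<le> (if n < n' then 0 else D * (1/2)^n))"
      using ap[of m] by (rule exE)
    \<comment> \<open>With \<open>D\<close> fixed, the squared error is at most the tail of this
      geometric series from \<open>n'\<close> on, hence below \<open>e\<close> for large
      \<open>n'\<close>.\<close>
    have geo: "summable (\<lambda>n. D\<^sup>2 * (1/4)^n)" by (intro summable_mult summable_geometric) auto
    then have "(\<lambda>n'. \<Sum>n. D\<^sup>2 * (1/4)^(n + n')) \<longlonglongrightarrow> 0" by (rule suminf_exist_split2)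
    then have "\<forall>\<^sub>F n' in sequentially. (\<Sum>n. D\<^sup>2 * (1/4)^(n + n')) < e"
      using e by (auto dest: order_tendstoD)
    then obtain n' where n': "m < n'" "(\<Sum>n. D\<^sup>2 * (1/4)^(n + n')) < e"
      using eventually_gt_at_top[of m] by (metis (mono_tags, lifting) eventually_conj eventually_sequentially le_refl)
    from D[rule_format, OF n'(1)] obtain F a where "finite F \<and> F \<subseteq> N1 \<union> N2 \<and>
      (\<forall>n. \<bar>(\<Sum>j\<in>F. a j * (W (t n) / (t n - \<gamma> j))) - (if n = m then 1 else 0)\<bar> \<le> (if n < n' then 0 else D * (1/2)^n))"
      by (elim exE)
    then have F: "finite F" "F \<subseteq> N1 \<union> N2"
      "\<And>n. \<bar>(\<Sum>j\<in>F. a j * (W (t n) / (t n - \<gamma> j))) - (if n = m then 1 else 0)\<bar> \<le> (if n < n' then 0 else D * (1/2)^n)"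
      by blast+
    define f where "f n = (\<Sum>j\<in>F. a j * (W (t n) / (t n - \<gamma> j))) - (if n = m then 1 else 0)" for n
    have f0: "f n = 0" if "n < n'" for n using F(3)[of n] that by (simp add: f_def)
    have f1: "(f n)\<^sup>2 \<le> D\<^sup>2 * (1/4)^n" if "n' \<le> n" for n
    proof -
      have "\<bar>f n\<bar> \<le> D * (1/2)^n" using F(3)[of n] that by (simp add: f_def)
      then have "\<bar>f n\<bar>\<^sup>2 \<le> (D * (1/2)^n)\<^sup>2" by (intro power_mono) auto
      also have "\<dots> = D\<^sup>2 * ((1/2)\<^sup>2)^n" by (simp add: power_mult_distrib flip: power_mult) (simp add: mult.commute)
      finally show ?thesis by (simp add: power2_eq_square)
    qed
    have sf: "summable (\<lambda>n. (f n)\<^sup>2)"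
      by (rule summable_comparison_test'[OF geo, of n']) (use f1 in auto)
    have "(\<Sum>n. (f n)\<^sup>2) = (\<Sum>n. (f (n + n'))\<^sup>2) + (\<Sum>n<n'. (f n)\<^sup>2)"
      by (rule suminf_split_initial_segment[OF sf])
    also have "(\<Sum>n<n'. (f n)\<^sup>2) = 0" by (intro sum.neutral) (auto simp: f0)
    also have "(\<Sum>n. (f (n + n'))\<^sup>2) \<le> (\<Sum>n. D\<^sup>2 * (1/4)^(n + n'))"
      by (intro suminf_le f1 summable_ignore_initial_segment[OF sf] summable_ignore_initial_segment[OF geo]) auto
    finally have lt: "(\<Sum>n. (f n)\<^sup>2) < e" using n'(2) by linarith
    have inv\<gamma>: "inv \<gamma> (\<gamma> j) = j" for j using inj\<gamma> by simp
    define g where "g s = ((\<Sum>\<gamma>'\<in>\<gamma> ` F. a (inv \<gamma> \<gamma>') * (W s / (s - \<gamma>'))) - (if s = s0 then 1 else 0))\<^sup>2" for s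
    have g: "g (t n) = (f n)\<^sup>2" for n
      unfolding g_def f_def m using inj\<gamma> by (subst sum.reindex) (auto simp: inv\<gamma> intro: inj_on_subset)
    have "(g has_sum (\<Sum>n. g (t n))) T'"
      using has_sum_range[OF inj_t order_refl, of g] sf by (simp add: g T'_def)
    then have "(g has_sum (\<Sum>n. (f n)\<^sup>2)) T'" by (simp add: g)
    then show ?thesis using F(1,2) lt unfolding g_def
      by (intro exI[of _ "\<gamma> ` F"] exI[of _ "\<lambda>\<gamma>'. a (inv \<gamma> \<gamma>')"] exI[of _ "\<Sum>n. (f n)\<^sup>2"]) auto
  qed
  \<comment> \<open>The indices are crossed: \<open>b\<close> is orthogonal to the \<open>v\<close>
    vectors on \<open>N1\<close>, which therefore supplies the kernel side \<open>\<Gamma>2\<close>,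
    and to the \<open>u\<close> vectors on \<open>N2\<close>, which supplies the biorthogonal side
    \<open>\<Gamma>1\<close>.\<close>
  show thesis
  proof (rule that[of T' V U B "\<gamma> ` N2" "\<gamma> ` N1"])
    show "T' \<subseteq> T" using t(2) by (simp add: T'_def)
    show "infinite T'" unfolding T'_def by (rule range_inj_infinite[OF inj_t])
    show "0 < V s" for s using v0 by (simp add: V_def)
    show "s \<in> T' \<longleftrightarrow> U s \<noteq> 0" "s \<in> T' \<longleftrightarrow> B s \<noteq> 0" for s using u0 b0 by (simp_all add: U_def B_def)
    show "(\<lambda>s. (U s)\<^sup>2 / (s\<^sup>2 + 1)) summable_on T"
    proof (rule has_sum_imp_summable[OF hs])
      show "summable (\<lambda>n. \<bar>(U (t n))\<^sup>2 / ((t n)\<^sup>2 + 1)\<bar>)" using us by (simp add: abs_of_nonneg)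
    qed (simp add: U_def T'_def)
    show "(\<lambda>s. (B s * s ^ k)\<^sup>2) summable_on T" for k
    proof (rule has_sum_imp_summable[OF hs])
      show "summable (\<lambda>n. \<bar>(B (t n) * (t n) ^ k)\<^sup>2\<bar>)" using bs[of k] by simp
    qed (simp add: B_def T'_def)
    show "(\<lambda>s. (V s)\<^sup>2 / (s\<^sup>2 + 1)) summable_on T"
    proof -
      have "summable (\<lambda>n. \<bar>(V (t n))\<^sup>2 / ((t n)\<^sup>2 + 1)\<bar>)" using vs by (simp add: abs_of_nonneg)
      then have 1: "(\<lambda>s. (V s)\<^sup>2 / (s\<^sup>2 + 1)) summable_on T'"
        using has_sum_range[OF inj_t order_refl, of "\<lambda>s. (V s)\<^sup>2 / (s\<^sup>2 + 1)"] has_sum_imp_summable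
        unfolding T'_def by blast
      have "(\<lambda>n. (1/2::real)^n) summable_on UNIV"
        by (subst summable_on_UNIV_nonneg_real_iff) (auto intro: summable_geometric)
      then have "(\<lambda>n. (1/2::real)^n) summable_on to_nat_on T ` (T - T')"
        by (rule summable_on_subset_banach) simp
      moreover have "inj_on (to_nat_on T) (T - T')"
        using inj_on_to_nat_on[OF spectral_seq_countable[OF T]] by (rule inj_on_subset) auto
      ultimately have "(\<lambda>s. (1/2::real)^to_nat_on T s) summable_on (T - T')"
        by (simp add: summable_on_reindex o_def)
      then have 2: "(\<lambda>s. (V s)\<^sup>2 / (s\<^sup>2 + 1)) summable_on (T - T')"
      proof (rule summable_on_comparison_test)
        fix s assume s: "s \<in> T - T'"
        have "(V s)\<^sup>2 / (s\<^sup>2 + 1) \<le> (V s)\<^sup>2 / 1" by (intro divide_left_mono) (auto intro: add_nonneg_pos)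
        then show "(V s)\<^sup>2 / (s\<^sup>2 + 1) \<le> (1/2) ^ to_nat_on T s" using s by (simp add: V_def)
      qed (auto intro: divide_nonneg_nonneg)
      have "T' \<union> (T - T') = T" using t(2) by (auto simp: T'_def)
      then show ?thesis using summable_on_Un_disjoint[OF 1 2] by auto
    qed
    show "\<gamma> ` N2 \<inter> \<gamma> ` N1 = {}" using N12 inj\<gamma> by (auto simp: inj_def)
    show "(\<gamma> ` N2 \<union> \<gamma> ` N1) \<inter> T = {}" using \<gamma>T by auto
    show "((\<lambda>s. U s * V s / (s - x)) has_sum 0) T" if "x \<in> \<gamma> ` N2 \<union> \<gamma> ` N1" for x
    proof -
      obtain j where j: "j \<in> N1 \<union> N2" "x = \<gamma> j" using \<open>x \<in> _\<close> by auto
      show ?thesis using hs[of "\<lambda>s. U s * V s / (s - x)"] uv[OF j(1)] by (simp add: j(2) U0)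
    qed
    show "((\<lambda>s. B s * s ^ k * V s / (s - x)) has_sum 0) T" if "x \<in> \<gamma> ` N1" for x k
    proof -
      obtain j where j: "j \<in> N1" "x = \<gamma> j" using \<open>x \<in> _\<close> by auto
      have e: "B s * s ^ k * V s = B s * V s * s ^ k" for s by simp
      show ?thesis using hs[of "\<lambda>s. B s * V s * s ^ k / (s - x)"] bv[OF j(1), of k] unfolding e by (simp add: j(2) B0)
    qed
    show "((\<lambda>s. B s * s ^ k * U s / (s - x)) has_sum 0) T" if "x \<in> \<gamma> ` N2" for x k
    proof -
      obtain j where j: "j \<in> N2" "x = \<gamma> j" using \<open>x \<in> _\<close> by auto
      have e: "B s * s ^ k * U s = B s * U s * s ^ k" for s by simp
      show ?thesis using hs[of "\<lambda>s. B s * U s * s ^ k / (s - x)"] bu[OF j(1), of k] unfolding e by (simp add: j(2) B0)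
    qed
  qed (use appr[of V] appr[of U] av au in auto)
qed

section \<open>Square-summable families\<close>

definition sqnorm :: "real set \<Rightarrow> (real \<Rightarrow> complex) \<Rightarrow> real" where
  "sqnorm T a = (\<Sum>\<^sub>\<infinity>t\<in>T. (norm (a t))\<^sup>2)"

definition ip :: "real set \<Rightarrow> (real \<Rightarrow> complex) \<Rightarrow> (real \<Rightarrow> complex) \<Rightarrow> complex" where
  "ip T a b = (\<Sum>\<^sub>\<infinity>t\<in>T. a t * cnj (b t))"

lemma norm_add_square_le:
  fixes x y :: complex
  shows "(norm (x + y))\<^sup>2 \<le> 2 * (norm x)\<^sup>2 + 2 * (norm y)\<^sup>2"
proof -
  have "(norm (x + y))\<^sup>2 \<le> (norm x + norm y)\<^sup>2" by (intro power_mono norm_triangle_ineq) auto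
  also have "\<dots> \<le> 2 * (norm x)\<^sup>2 + 2 * (norm y)\<^sup>2"
    using zero_le_power2[of "norm x - norm y"] by (simp add: power2_eq_square algebra_simps)
  finally show ?thesis .
qed

lemma l2_summable: "l2_on T a \<Longrightarrow> (\<lambda>t. (norm (a t))\<^sup>2) summable_on T"
  by (simp add: l2_on_def)

lemma l2_zero: "l2_on T a \<Longrightarrow> t \<notin> T \<Longrightarrow> a t = 0"
  by (simp add: l2_on_def)

lemma l2_add: "l2_on T a \<Longrightarrow> l2_on T b \<Longrightarrow> l2_on T (\<lambda>t. a t + b t)"
  unfolding l2_on_def
  by (auto intro!: summable_on_comparison_test[OF _ norm_add_square_le] summable_on_add summable_on_cmult_right)

lemma l2_scale: "l2_on T a \<Longrightarrow> l2_on T (\<lambda>t. c * a t)"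
  unfolding l2_on_def by (auto simp: norm_mult power_mult_distrib intro!: summable_on_cmult_right)

lemma l2_diff: "l2_on T a \<Longrightarrow> l2_on T b \<Longrightarrow> l2_on T (\<lambda>t. a t - b t)"
  using l2_add[of T a "\<lambda>t. -1 * b t"] l2_scale[of T b "-1"] by simp

lemma l2_0: "l2_on T (\<lambda>t. 0)"
  by (simp add: l2_on_def)

lemma l2_finite_support:
  assumes "finite S" "S \<subseteq> T" "\<And>t. t \<notin> S \<Longrightarrow> a t = 0"
  shows "l2_on T a"
proof -
  have "(\<lambda>t. (norm (a t))\<^sup>2) summable_on S" using assms(1) by simp
  then have "(\<lambda>t. (norm (a t))\<^sup>2) summable_on T"
    by (rule summable_on_cong_neutral[THEN iffD1, rotated -1]) (use assms in auto)
  then show ?thesis using assms by (auto simp: l2_on_def)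
qed

lemma l2_mult_abs_summable:
  assumes "l2_on T a" "l2_on T b"
  shows "(\<lambda>t. norm (a t * b t)) summable_on T"
proof (rule summable_on_comparison_test)
  show "(\<lambda>t. (norm (a t))\<^sup>2 + (norm (b t))\<^sup>2) summable_on T"
    by (intro summable_on_add l2_summable assms)
  fix t
  have "2 * (norm (a t) * norm (b t)) \<le> (norm (a t))\<^sup>2 + (norm (b t))\<^sup>2"
    using zero_le_power2[of "norm (a t) - norm (b t)"] by (simp add: power2_eq_square algebra_simps)
  moreover have "0 \<le> norm (a t) * norm (b t)" by simp
  ultimately show "norm (a t * b t) \<le> (norm (a t))\<^sup>2 + (norm (b t))\<^sup>2" unfolding norm_mult by linarith
qed simp

lemma l2_cnj: "l2_on T a \<Longrightarrow> l2_on T (\<lambda>t. cnj (a t))"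
  by (simp add: l2_on_def)

lemma ip_summable:
  assumes "l2_on T a" "l2_on T b"
  shows "(\<lambda>t. a t * cnj (b t)) summable_on T"
  using l2_mult_abs_summable[OF assms(1) l2_cnj[OF assms(2)]] by (rule abs_summable_summable)

lemma ip_add_left:
  assumes "l2_on T a" "l2_on T b" "l2_on T c"
  shows "ip T (\<lambda>t. a t + b t) c = ip T a c + ip T b c"
  unfolding ip_def by (simp add: distrib_right infsum_add ip_summable assms)

lemma ip_scale_left: "ip T (\<lambda>t. k * a t) c = k * ip T a c"
  unfolding ip_def by (simp add: mult.assoc infsum_cmult_right')

lemma ip_scale_right: "ip T a (\<lambda>t. k * c t) = cnj k * ip T a c"
  unfolding ip_def by (simp add: infsum_cmult_right'[symmetric] mult_ac)

lemma ip_diff_left: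
  assumes "l2_on T a" "l2_on T b" "l2_on T c"
  shows "ip T (\<lambda>t. a t - b t) c = ip T a c - ip T b c"
  using ip_add_left[of T a "\<lambda>t. -1 * b t" c] ip_scale_left[of T "-1" b c] assms l2_scale[of T b "-1"]
  by simp

lemma ip_cnj: "ip T b a = cnj (ip T a b)"
  unfolding ip_def by (simp add: infsum_cnj[symmetric] mult.commute)

lemma ip_self: "l2_on T a \<Longrightarrow> ip T a a = of_real (sqnorm T a)"
  unfolding ip_def sqnorm_def complex_norm_square[symmetric]
  by (intro infsumI has_sum_of_real has_sum_infsum l2_summable)

lemma sqnorm_nonneg: "0 \<le> sqnorm T a"
  unfolding sqnorm_def by (rule infsum_nonneg) simp

lemma sqnorm_add_le:
  assumes "l2_on T a" "l2_on T b"
  shows "sqnorm T (\<lambda>t. a t + b t) \<le> 2 * sqnorm T a + 2 * sqnorm T b"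
proof -
  have "sqnorm T (\<lambda>t. a t + b t) \<le> (\<Sum>\<^sub>\<infinity>t\<in>T. 2 * (norm (a t))\<^sup>2 + 2 * (norm (b t))\<^sup>2)"
    unfolding sqnorm_def
    by (intro infsum_mono norm_add_square_le l2_summable l2_add assms summable_on_add summable_on_cmult_right)
  also have "\<dots> = 2 * sqnorm T a + 2 * sqnorm T b"
    unfolding sqnorm_def
    by (simp add: infsum_add summable_on_cmult_right l2_summable assms infsum_cmult_right')
  finally show ?thesis .
qed

lemma sqnorm_scale: "sqnorm T (\<lambda>t. c * a t) = (norm c)\<^sup>2 * sqnorm T a"
  unfolding sqnorm_def by (simp add: norm_mult power_mult_distrib infsum_cmult_right')

lemma sqnorm_eq_0D:
  assumes "l2_on T a" "sqnorm T a = 0" shows "a t = 0"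
proof (cases "t \<in> T")
  case True
  have "sum (\<lambda>t. (norm (a t))\<^sup>2) {t} \<le> sqnorm T a"
    unfolding sqnorm_def by (rule finite_sum_le_infsum) (use assms True in \<open>auto intro: l2_summable\<close>)
  then show ?thesis using assms(2) by simp
qed (use assms in \<open>simp add: l2_zero\<close>)

text \<open>A termwise weighted arithmetic-geometric mean inequality in the role of Cauchy-Schwarz;
  the parameter \<open>s\<close> lets a small first argument outweigh a large second one.\<close>

lemma norm_ip_le:
  assumes "l2_on T a" "l2_on T b" "0 < s"
  shows "norm (ip T a b) \<le> s * sqnorm T a + sqnorm T b / s"
proof -
  have "norm (ip T a b) \<le> (\<Sum>\<^sub>\<infinity>t\<in>T. norm (a t * cnj (b t)))"
    unfolding ip_def by (rule norm_infsum_bound[OF l2_mult_abs_summable[OF assms(1) l2_cnj[OF assms(2)]]])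
  also have "\<dots> \<le> (\<Sum>\<^sub>\<infinity>t\<in>T. s * (norm (a t))\<^sup>2 + (1/s) * (norm (b t))\<^sup>2)"
  proof (rule infsum_mono)
    show "(\<lambda>t. norm (a t * cnj (b t))) summable_on T"
      by (rule l2_mult_abs_summable[OF assms(1) l2_cnj[OF assms(2)]])
    show "(\<lambda>t. s * (norm (a t))\<^sup>2 + (1/s) * (norm (b t))\<^sup>2) summable_on T"
      by (intro summable_on_add summable_on_cmult_right l2_summable assms)
    fix t
    let ?x = "norm (a t)" and ?y = "norm (b t)"
    have "0 \<le> (s * ?x - ?y)\<^sup>2 / s" using assms(3) by simp
    also have "\<dots> = s * ?x\<^sup>2 + (1/s) * ?y\<^sup>2 - 2 * (?x * ?y)"
      using assms(3) by (simp add: power2_eq_square field_simps)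
    finally have "2 * (?x * ?y) \<le> s * ?x\<^sup>2 + (1/s) * ?y\<^sup>2" by simp
    moreover have "0 \<le> ?x * ?y" by simp
    ultimately show "norm (a t * cnj (b t)) \<le> s * ?x\<^sup>2 + (1/s) * ?y\<^sup>2"
      unfolding norm_mult complex_mod_cnj by linarith
  qed
  also have "\<dots> = s * sqnorm T a + sqnorm T b / s"
    unfolding sqnorm_def
    by (subst infsum_add, (intro summable_on_cmult_right l2_summable assms)+, simp only: infsum_cmult_right', simp)
  finally show ?thesis .
qed

section \<open>Spans and closures in coordinates\<close>

inductive_set lspan :: "(real \<Rightarrow> complex) set \<Rightarrow> (real \<Rightarrow> complex) set" for B where
  zero: "(\<lambda>t. 0) \<in> lspan B"
| step: "x \<in> lspan B \<Longrightarrow> f \<in> B \<Longrightarrow> (\<lambda>t. x t + c * f t) \<in> lspan B"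

lemma lspan_base: "f \<in> B \<Longrightarrow> f \<in> lspan B"
  using lspan.step[OF lspan.zero, of f B 1] by simp

lemma lspan_add:
  assumes "y \<in> lspan B" "x \<in> lspan B" shows "(\<lambda>t. x t + y t) \<in> lspan B"
  using assms
proof (induction rule: lspan.induct)
  case (step y f c)
  then show ?case using lspan.step[of "\<lambda>t. x t + y t" B f c] by (simp add: add.assoc)
qed simp

lemma lspan_scale:
  assumes "x \<in> lspan B" shows "(\<lambda>t. k * x t) \<in> lspan B"
  using assms
proof (induction rule: lspan.induct)
  case (step x f c)
  then show ?case using lspan.step[of "\<lambda>t. k * x t" B f "k * c"] by (simp add: distrib_left mult.assoc)
qed (simp add: lspan.zero)

lemma lspan_l2:
  assumes "x \<in> lspan B" "\<And>f. f \<in> B \<Longrightarrow> l2_on T f" shows "l2_on T x"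
  using assms
proof (induction rule: lspan.induct)
  case (step x f c)
  then show ?case by (intro l2_add l2_scale) auto
qed (simp add: l2_0)

definition l2_closure :: "real set \<Rightarrow> (real \<Rightarrow> complex) set \<Rightarrow> (real \<Rightarrow> complex) set" where
  "l2_closure T B = {a. l2_on T a \<and> (\<forall>e>0. \<exists>x\<in>lspan B. sqnorm T (\<lambda>t. a t - x t) < e)}"

context
  fixes T :: "real set" and B :: "(real \<Rightarrow> complex) set"
  assumes B: "\<And>f. f \<in> B \<Longrightarrow> l2_on T f"
begin

lemma lspan_in_closure: "x \<in> lspan B \<Longrightarrow> x \<in> l2_closure T B"
  using lspan_l2[OF _ B] by (auto simp: l2_closure_def sqnorm_def intro!: bexI[of _ x])

lemma closure_add:
  assumes "a \<in> l2_closure T B" "b \<in> l2_closure T B"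
  shows "(\<lambda>t. a t + b t) \<in> l2_closure T B"
proof -
  have l2: "l2_on T a" "l2_on T b" using assms by (auto simp: l2_closure_def)
  have "\<exists>z\<in>lspan B. sqnorm T (\<lambda>t. a t + b t - z t) < e" if "0 < e" for e
  proof -
    have "0 < e / 4" using that by simp
    then obtain x y where xy: "x \<in> lspan B" "y \<in> lspan B"
      "sqnorm T (\<lambda>t. a t - x t) < e / 4" "sqnorm T (\<lambda>t. b t - y t) < e / 4"
      using assms unfolding l2_closure_def by blast
    have "sqnorm T (\<lambda>t. (a t - x t) + (b t - y t)) \<le> 2 * sqnorm T (\<lambda>t. a t - x t) + 2 * sqnorm T (\<lambda>t. b t - y t)"
      by (intro sqnorm_add_le l2_diff l2 lspan_l2[OF xy(1) B] lspan_l2[OF xy(2) B])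
    then have "sqnorm T (\<lambda>t. a t + b t - (x t + y t)) < e" using xy by (simp add: algebra_simps)
    then show ?thesis using lspan_add[OF xy(2,1)] by (intro bexI[of _ "\<lambda>t. x t + y t"])
  qed
  then show ?thesis using l2_add[OF l2] by (simp add: l2_closure_def)
qed

lemma closure_scale:
  assumes "a \<in> l2_closure T B" shows "(\<lambda>t. c * a t) \<in> l2_closure T B"
proof -
  have l2: "l2_on T a" using assms by (auto simp: l2_closure_def)
  have "\<exists>z\<in>lspan B. sqnorm T (\<lambda>t. c * a t - z t) < e" if "0 < e" for e
  proof -
    have "0 < (norm c)\<^sup>2 + 1" by (simp add: add_nonneg_pos)
    then have "0 < e / ((norm c)\<^sup>2 + 1)" using that by simp
    then obtain x where x: "x \<in> lspan B" "sqnorm T (\<lambda>t. a t - x t) < e / ((norm c)\<^sup>2 + 1)"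
      using assms unfolding l2_closure_def by blast
    have "sqnorm T (\<lambda>t. c * a t - c * x t) = (norm c)\<^sup>2 * sqnorm T (\<lambda>t. a t - x t)"
      by (simp add: right_diff_distrib[symmetric] sqnorm_scale)
    also have "\<dots> \<le> ((norm c)\<^sup>2 + 1) * sqnorm T (\<lambda>t. a t - x t)"
      using sqnorm_nonneg by (intro mult_right_mono) auto
    also have "\<dots> < e" using x(2) \<open>0 < (norm c)\<^sup>2 + 1\<close> by (simp add: pos_less_divide_eq mult.commute)
    finally show ?thesis using lspan_scale[OF x(1)] by (intro bexI[of _ "\<lambda>t. c * x t"])
  qed
  then show ?thesis using l2_scale[OF l2] by (simp add: l2_closure_def)
qed

lemma closure_limit:
  assumes a: "l2_on T a" and lim: "\<And>e. 0 < e \<Longrightarrow> \<exists>b\<in>l2_closure T B. sqnorm T (\<lambda>t. a t - b t) < e"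
  shows "a \<in> l2_closure T B"
proof -
  have "\<exists>x\<in>lspan B. sqnorm T (\<lambda>t. a t - x t) < e" if "0 < e" for e
  proof -
    have e: "0 < e / 4" using that by simp
    obtain b where b: "b \<in> l2_closure T B" "sqnorm T (\<lambda>t. a t - b t) < e / 4" using lim[OF e] by blast
    then obtain x where x: "x \<in> lspan B" "sqnorm T (\<lambda>t. b t - x t) < e / 4"
      using e unfolding l2_closure_def by blast
    have lb: "l2_on T b" using b by (simp add: l2_closure_def)
    have "sqnorm T (\<lambda>t. (a t - b t) + (b t - x t)) \<le> 2 * sqnorm T (\<lambda>t. a t - b t) + 2 * sqnorm T (\<lambda>t. b t - x t)"
      by (rule sqnorm_add_le[OF l2_diff[OF a lb] l2_diff[OF lb lspan_l2[OF x(1) B]]])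
    then have "sqnorm T (\<lambda>t. a t - x t) < e" using b x by simp
    then show ?thesis using x(1) by blast
  qed
  then show ?thesis using a by (simp add: l2_closure_def)
qed

lemma closure_truncation:
  assumes unit: "\<And>s. s \<in> S \<Longrightarrow> (\<lambda>t. if t = s then 1 else 0) \<in> l2_closure T B"
    and "finite F" "F \<subseteq> S"
  shows "(\<lambda>t. if t \<in> F then a t else 0) \<in> l2_closure T B"
  using assms(2,3)
proof (induction F rule: finite_induct)
  case empty
  then show ?case using lspan_in_closure[OF lspan.zero] by simp
next
  case (insert s F)
  have "(\<lambda>t. (if t \<in> F then a t else 0) + a s * (if t = s then 1 else 0)) \<in> l2_closure T B"
    using insert unit by (intro closure_add closure_scale) auto
  moreover have "(\<lambda>t. (if t \<in> F then a t else 0) + a s * (if t = s then 1 else 0)) = (\<lambda>t. if t \<in> insert s F then a t else 0)"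
    using insert.hyps by auto
  ultimately show ?case by simp
qed

text \<open>Finite truncations are combinations of the unit vectors, and they converge to
  \<open>a\<close> because the squares are summable.\<close>

lemma closure_supported:
  assumes unit: "\<And>s. s \<in> S \<Longrightarrow> (\<lambda>t. if t = s then 1 else 0) \<in> l2_closure T B"
    and S: "S \<subseteq> T" and a: "l2_on T a" and supp: "\<And>t. t \<notin> S \<Longrightarrow> a t = 0"
  shows "a \<in> l2_closure T B"
proof (rule closure_limit[OF a])
  fix e :: real assume e: "0 < e"
  define f where "f = (\<lambda>t. (norm (a t))\<^sup>2)"
  have f: "f summable_on T" using a by (simp add: f_def l2_summable)
  have fS: "f summable_on S" using f S by (rule summable_on_subset_banach)
  obtain F where F: "finite F" "F \<subseteq> S" "dist (sum f F) (infsum f S) \<le> e / 2"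
    using infsum_finite_approximation[OF fS, of "e/2"] e by auto
  let ?b = "\<lambda>t. if t \<in> F then a t else 0"
  have b: "?b \<in> l2_closure T B" by (rule closure_truncation[OF unit]) (use F in auto)
  have "sqnorm T (\<lambda>t. a t - ?b t) = infsum f (S - F)"
    unfolding sqnorm_def by (rule infsum_cong_neutral) (use S F supp in \<open>auto simp: f_def\<close>)
  moreover have "infsum f S = infsum f F + infsum f (S - F)"
  proof -
    have "F \<union> (S - F) = S" using F by auto
    moreover have "f summable_on (S - F)" using fS by (rule summable_on_subset_banach) auto
    ultimately show ?thesis using infsum_Un_disjoint[of f F "S - F"] F(1) by auto
  qed
  ultimately have "sqnorm T (\<lambda>t. a t - ?b t) < e" using F e by (simp add: dist_real_def)
  then show "\<exists>b\<in>l2_closure T B. sqnorm T (\<lambda>t. a t - b t) < e" using b by (intro bexI[of _ ?b])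
qed

lemma ip_closure_zero:
  assumes a: "a \<in> l2_closure T B" and g: "l2_on T g" and orth: "\<And>f. f \<in> B \<Longrightarrow> ip T f g = 0"
  shows "ip T a g = 0"
proof (rule ccontr)
  assume ne: "ip T a g \<noteq> 0"
  let ?d = "norm (ip T a g)" and ?n = "sqnorm T g + 1"
  have d: "0 < ?d" using ne by simp
  have n: "0 < ?n" using sqnorm_nonneg[of T g] by linarith
  \<comment> \<open>Balances the two terms of \<open>norm_ip_le\<close>: each is at most half of the
    norm, the first strictly.\<close>
  define s where "s = 2 * ?n / ?d"
  have s: "0 < s" using d n by (simp add: s_def)
  have l2: "l2_on T a" using a by (simp add: l2_closure_def)
  have "0 < ?d / (2 * s)" using d s by simp
  then obtain x where x: "x \<in> lspan B" "sqnorm T (\<lambda>t. a t - x t) < ?d / (2 * s)"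
    using a unfolding l2_closure_def by blast
  have lx: "l2_on T x" by (rule lspan_l2[OF x(1) B])
  have "ip T x g = 0" using x(1)
  proof (induction rule: lspan.induct)
    case (step x f c)
    then show ?case
      using ip_add_left[OF lspan_l2[OF step(1) B] l2_scale[OF B[OF step(2)]] g, of c] by (simp add: ip_scale_left orth)
  qed (simp add: ip_def)
  then have "?d = norm (ip T (\<lambda>t. a t - x t) g)" by (simp add: ip_diff_left l2 lx g)
  also have "\<dots> \<le> s * sqnorm T (\<lambda>t. a t - x t) + sqnorm T g / s"
    by (intro norm_ip_le l2_diff l2 lx g s)
  also have "\<dots> < s * (?d / (2 * s)) + ?n / s"
  proof (rule add_less_le_mono)
    show "s * sqnorm T (\<lambda>t. a t - x t) < s * (?d / (2 * s))" using x(2) s by (rule mult_strict_left_mono)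
    show "sqnorm T g / s \<le> ?n / s" using s by (intro divide_right_mono) auto
  qed
  also have "s * (?d / (2 * s)) = ?d / 2" using s by simp
  also have "?n / s = ?d / 2"
  proof -
    have "x / (2 * x / y) = y / 2" if "0 < x" "0 < y" for x y :: real using that by simp
    then show ?thesis unfolding s_def using n d by blast
  qed
  finally show False by simp
qed

end

lemma ip_zero_imp_zero:
  assumes a: "l2_on T a" and orth: "\<And>b. l2_on T b \<Longrightarrow> ip T b a = 0"
  shows "a t = 0"
  using orth[OF a] sqnorm_eq_0D[OF a] by (simp add: ip_self[OF a])

section \<open>De Branges spaces in coordinates\<close>

lemma far_node:
  assumes "norm w \<le> r" "2 * r + 1 \<le> \<bar>t\<bar>"
  shows "(t\<^sup>2 + 1) / 8 \<le> (norm (w - complex_of_real t))\<^sup>2"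
proof -
  have r: "0 \<le> r" using assms(1) norm_ge_zero order_trans by blast
  have "\<bar>t\<bar> - r \<le> norm (w - complex_of_real t)"
    using norm_triangle_ineq2[of "complex_of_real t" w] assms(1) by (simp add: norm_minus_commute)
  then have "\<bar>t\<bar> / 2 \<le> norm (w - complex_of_real t)" using assms(2) by linarith
  then have le: "(\<bar>t\<bar> / 2)\<^sup>2 \<le> (norm (w - complex_of_real t))\<^sup>2" by (intro power_mono) auto
  have "1 \<le> t\<^sup>2" using assms(2) r one_le_power[of "\<bar>t\<bar>" 2] by simp
  then have "(t\<^sup>2 + 1) / 8 \<le> (\<bar>t\<bar> / 2)\<^sup>2" by (simp add: power_divide)
  then show ?thesis using le by (rule order_trans)
qed

text \<open>Only finitely many nodes are close to \<open>w\<close>; the others are dominated through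
  \<open>far_node\<close>. A node equal to \<open>w\<close> contributes 0 by division by zero, so
  \<open>w\<close> may lie in \<open>T\<close>.\<close>

lemma l2_cauchy:
  fixes W :: "real \<Rightarrow> real"
  assumes spec: "spectral_seq T" and W: "(\<lambda>t. (W t)\<^sup>2 / (t\<^sup>2 + 1)) summable_on T"
  shows "l2_on T (\<lambda>t. if t \<in> T then of_real (W t) / (w - of_real t) else 0)"
proof -
  define S where "S = {t \<in> T. \<bar>t\<bar> \<le> 2 * norm w + 1}"
  let ?f = "\<lambda>t. (norm (complex_of_real (W t) / (w - of_real t)))\<^sup>2"
  have fin: "finite S" using spec by (simp add: S_def spectral_seq_def)
  have "?f summable_on (T - S)"
  proof (rule summable_on_comparison_test)
    show "(\<lambda>t. 8 * ((W t)\<^sup>2 / (t\<^sup>2 + 1))) summable_on (T - S)"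
      by (intro summable_on_cmult_right summable_on_subset_banach[OF W]) auto
    fix t assume "t \<in> T - S"
    then have d: "(t\<^sup>2 + 1) / 8 \<le> (norm (w - complex_of_real t))\<^sup>2"
      by (intro far_node[of _ "norm w"]) (auto simp: S_def)
    have p: "0 < (t\<^sup>2 + 1) / 8" by (simp add: add_nonneg_pos)
    have "(W t)\<^sup>2 / (norm (w - complex_of_real t))\<^sup>2 \<le> (W t)\<^sup>2 / ((t\<^sup>2 + 1) / 8)"
      by (rule divide_left_mono[OF d zero_le_power2 mult_pos_pos[OF less_le_trans[OF p d] p]])
    then show "?f t \<le> 8 * ((W t)\<^sup>2 / (t\<^sup>2 + 1))"
      by (simp add: norm_divide power_divide mult.commute)
  qed simp
  moreover have "?f summable_on S" using fin by simp
  moreover have "S \<union> (T - S) = T" by (auto simp: S_def)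
  ultimately have "?f summable_on T" using summable_on_Un_disjoint[of ?f S "T - S"] by auto
  then have "(\<lambda>t. (norm (if t \<in> T then complex_of_real (W t) / (w - of_real t) else 0))\<^sup>2) summable_on T"
    by (rule summable_on_cong[THEN iffD1, rotated]) auto
  then show ?thesis by (simp add: l2_on_def)
qed

locale de_Branges =
  fixes T :: "real set" and \<mu> :: "real \<Rightarrow> real" and A :: "complex \<Rightarrow> complex"
  assumes spec: "spectral_seq T" and \<mu>_pos: "\<And>t. t \<in> T \<Longrightarrow> 0 < \<mu> t"
    and \<mu>_summable: "(\<lambda>t. \<mu> t / (t\<^sup>2 + 1)) summable_on T" and adm: "dB_admissible T A"
begin

abbreviation CT :: "complex set" where "CT \<equiv> complex_of_real ` T"

lemma A_holomorphic: "A holomorphic_on UNIV" and A_zero_iff: "A z = 0 \<longleftrightarrow> z \<in> CT"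
  and deriv_A_nonzero: "t \<in> T \<Longrightarrow> deriv A (of_real t) \<noteq> 0"
  using adm by (auto simp: dB_admissible_def)

lemma finite_T_bounded: "finite {t \<in> T. \<bar>t\<bar> \<le> r}"
  using spec by (simp add: spectral_seq_def)

lemma sqrt_\<mu>_nonzero: "t \<in> T \<Longrightarrow> complex_of_real (sqrt (\<mu> t)) \<noteq> 0"
  using \<mu>_pos[of t] by simp

definition cvec :: "complex \<Rightarrow> real \<Rightarrow> complex" where
  "cvec w t = (if t \<in> T then of_real (sqrt (\<mu> t)) / (w - of_real t) else 0)"

lemma l2_cvec: "l2_on T (cvec w)"
proof -
  have "(\<lambda>t. (sqrt (\<mu> t))\<^sup>2 / (t\<^sup>2 + 1)) summable_on T"
    using \<mu>_summable by (rule summable_on_cong[THEN iffD1, rotated]) (use \<mu>_pos in \<open>auto simp: less_imp_le\<close>)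
  from l2_cauchy[OF spec this, of w] show ?thesis unfolding cvec_def[abs_def] .
qed

lemma cauchy_term: "t \<in> T \<Longrightarrow> a t * of_real (sqrt (\<mu> t)) / (w - of_real t) = a t * cvec w t"
  by (simp add: cvec_def)

lemma cauchy_summable:
  assumes "l2_on T a"
  shows "(\<lambda>t. a t * of_real (sqrt (\<mu> t)) / (w - of_real t)) summable_on T"
proof -
  have "(\<lambda>t. a t * cvec w t) summable_on T"
    by (rule abs_summable_summable[OF l2_mult_abs_summable[OF assms l2_cvec]])
  then show ?thesis by (rule summable_on_cong[THEN iffD1, rotated]) (simp add: cauchy_term)
qed

text \<open>The inverse of the coefficient map. At a node the removable singularity is filled by its
  limit: only the term of that node survives, with \<open>A z / (z - t)\<close> tending to the
  derivative.\<close>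

definition lift :: "(real \<Rightarrow> complex) \<Rightarrow> complex \<Rightarrow> complex" where
  "lift a z = (if z \<in> CT then deriv A z * (a (Re z) * of_real (sqrt (\<mu> (Re z))))
     else A z * infsum (\<lambda>t. a t * of_real (sqrt (\<mu> t)) / (z - of_real t)) T)"

text \<open>For \<open>t\<close> in \<open>T\<close> this is the entire function
  \<open>A z / (z - t)\<close>, since \<open>A\<close> vanishes there; the difference quotient form
  matches \<open>pole_lemma\<close>.\<close>

definition quot :: "real \<Rightarrow> complex \<Rightarrow> complex" where
  "quot t z = (if z = of_real t then deriv A (of_real t) else (A z - A (of_real t)) / (z - of_real t))"

lemma quot_holomorphic: "quot t holomorphic_on UNIV"
  unfolding quot_def by (rule pole_lemma[OF A_holomorphic]) simp

text \<open>Weierstrass' M-test on the closed ball. The majorant comes from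
  \<open>2 * x * y \<le> x^2 + y^2\<close>, and its constant 8 from \<open>far_node\<close>.\<close>

lemma tail_holomorphic:
  assumes a: "l2_on T a" and X: "X \<subseteq> T" "\<And>t. t \<in> X \<Longrightarrow> 2 * r + 1 \<le> \<bar>t\<bar>"
  shows "(\<lambda>z. infsum (\<lambda>t. a t * of_real (sqrt (\<mu> t)) / (z - of_real t)) X) holomorphic_on ball 0 r"
proof -
  let ?f = "\<lambda>t z. a t * of_real (sqrt (\<mu> t)) / (z - complex_of_real t)"
  define M where "M t = (norm (a t))\<^sup>2 + 8 * (\<mu> t / (t\<^sup>2 + 1))" for t
  have M: "M summable_on X" unfolding M_def
    by (intro summable_on_subset_banach[OF _ X(1)] summable_on_add summable_on_cmult_right l2_summable a \<mu>_summable)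
  have ulim: "uniform_limit (cball 0 r) (\<lambda>F z. \<Sum>t\<in>F. ?f t z) (\<lambda>z. infsum (\<lambda>t. ?f t z) X) (finite_subsets_at_top X)"
  proof (rule Weierstrass_m_test_general[OF _ M])
    fix t z assume t: "t \<in> X" and z: "z \<in> cball (0::complex) r"
    let ?x = "norm (a t)" and ?y = "norm (complex_of_real (sqrt (\<mu> t)) / (z - of_real t))"
    have d: "(t\<^sup>2 + 1) / 8 \<le> (norm (z - complex_of_real t))\<^sup>2"
      using z X(2)[OF t] by (intro far_node[of _ r]) auto
    have p: "0 < (t\<^sup>2 + 1) / 8" by (simp add: add_nonneg_pos)
    have "\<mu> t / (norm (z - complex_of_real t))\<^sup>2 \<le> \<mu> t / ((t\<^sup>2 + 1) / 8)"
      using t X(1) \<mu>_pos d p by (intro divide_left_mono mult_pos_pos) (auto intro: less_imp_le order_less_le_trans)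
    then have "?y\<^sup>2 \<le> 8 * (\<mu> t / (t\<^sup>2 + 1))"
      using t X(1) \<mu>_pos[of t] by (auto simp: norm_divide power_divide mult.commute)
    moreover have "2 * (?x * ?y) \<le> ?x\<^sup>2 + ?y\<^sup>2"
      using zero_le_power2[of "?x - ?y"] by (simp add: power2_eq_square algebra_simps)
    moreover have "0 \<le> ?x * ?y" by simp
    moreover have "norm (?f t z) = ?x * ?y" by (simp add: norm_mult norm_divide)
    ultimately show "norm (?f t z) \<le> M t" unfolding M_def by linarith
  qed
  have hol: "(\<lambda>z. \<Sum>t\<in>F. ?f t z) holomorphic_on cball 0 r" if "F \<subseteq> X" for F
  proof (intro holomorphic_intros)
    fix t z assume "t \<in> F" "z \<in> cball (0::complex) r"
    then have "(t\<^sup>2 + 1) / 8 \<le> (norm (z - complex_of_real t))\<^sup>2"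
      using that X(2) by (intro far_node[of _ r]) auto
    moreover have "0 < (t\<^sup>2 + 1) / 8" by (simp add: add_nonneg_pos)
    ultimately show "z - complex_of_real t \<noteq> 0" by auto
  qed
  have ev: "\<forall>\<^sub>F F in finite_subsets_at_top X. continuous_on (cball 0 r) (\<lambda>z. \<Sum>t\<in>F. ?f t z) \<and>
      (\<lambda>z. \<Sum>t\<in>F. ?f t z) holomorphic_on ball 0 r"
    by (rule eventually_finite_subsets_at_top_weakI)
      (auto intro: holomorphic_on_imp_continuous_on[OF hol] holomorphic_on_subset[OF hol])
  show ?thesis by (rule holomorphic_uniform_limit[OF ev ulim]) auto
qed

text \<open>On a ball only the finitely many nodes in \<open>S\<close> can produce poles; these are
  absorbed into \<open>quot\<close>, and the remaining series is a holomorphic tail.\<close>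

lemma lift_holomorphic:
  assumes a: "l2_on T a" shows "lift a holomorphic_on UNIV"
proof -
  have "lift a holomorphic_on ball 0 r" if r: "0 < r" for r
  proof -
    define S where "S = {t \<in> T. \<bar>t\<bar> \<le> 2 * r + 1}"
    let ?f = "\<lambda>z t. a t * of_real (sqrt (\<mu> t)) / (z - complex_of_real t)"
    have fin: "finite S" unfolding S_def by (rule finite_T_bounded)
    have "(\<lambda>z. (\<Sum>t\<in>S. a t * of_real (sqrt (\<mu> t)) * quot t z) + A z * infsum (?f z) (T - S)) holomorphic_on ball 0 r"
      by (intro holomorphic_intros tail_holomorphic[OF a] holomorphic_on_subset[OF quot_holomorphic]
          holomorphic_on_subset[OF A_holomorphic]) (auto simp: S_def)
    then show ?thesis
    proof (rule holomorphic_transform)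
      fix z assume z: "z \<in> ball (0::complex) r"
      show "(\<Sum>t\<in>S. a t * of_real (sqrt (\<mu> t)) * quot t z) + A z * infsum (?f z) (T - S) = lift a z"
      proof (cases "z \<in> CT")
        case True
        then obtain s where s: "s \<in> T" "z = of_real s" by auto
        have sS: "s \<in> S" using s z by (auto simp: S_def)
        have Az: "A z = 0" using True A_zero_iff by blast
        have "(\<Sum>t\<in>S. a t * of_real (sqrt (\<mu> t)) * quot t z) =
            (\<Sum>t\<in>S. if t = s then a s * of_real (sqrt (\<mu> s)) * deriv A z else 0)"
        proof (rule sum.cong)
          fix t assume t: "t \<in> S"
          then have "A (of_real t) = 0" using A_zero_iff by (auto simp: S_def)
          then show "a t * of_real (sqrt (\<mu> t)) * quot t z = (if t = s then a s * of_real (sqrt (\<mu> s)) * deriv A z else 0)"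
            using s Az by (auto simp: quot_def)
        qed simp
        also have "\<dots> = lift a z" using sS fin True s by (simp add: lift_def mult.commute)
        finally show ?thesis using Az by simp
      next
        case False
        have "infsum (?f z) T = infsum (?f z) S + infsum (?f z) (T - S)"
        proof -
          have "S \<union> (T - S) = T" by (auto simp: S_def)
          moreover have "?f z summable_on (T - S)"
            using cauchy_summable[OF a] by (rule summable_on_subset_banach) auto
          ultimately show ?thesis using infsum_Un_disjoint[of "?f z" S "T - S"] fin by auto
        qed
        then have "lift a z = A z * (\<Sum>t\<in>S. ?f z t) + A z * infsum (?f z) (T - S)"
          using False fin by (simp add: lift_def distrib_left)
        moreover have "A z * (\<Sum>t\<in>S. ?f z t) = (\<Sum>t\<in>S. a t * of_real (sqrt (\<mu> t)) * quot t z)"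
          unfolding sum_distrib_left
        proof (rule sum.cong)
          fix t assume t: "t \<in> S"
          then have "A (of_real t) = 0" "z \<noteq> of_real t" using A_zero_iff False by (auto simp: S_def)
          then show "A z * ?f z t = a t * of_real (sqrt (\<mu> t)) * quot t z" by (simp add: quot_def)
        qed simp
        ultimately show ?thesis by simp
      qed
    qed
  qed
  then have "lift a field_differentiable at z" for z
    using holomorphic_on_imp_differentiable_at[of "lift a" "ball 0 (norm z + 1)" z]
    by (simp add: add_nonneg_pos)
  then show ?thesis by (simp add: holomorphic_on_def)
qed

lemma rep_lift: "l2_on T a \<Longrightarrow> dB_rep T \<mu> A a (lift a)"
  unfolding dB_rep_def using lift_holomorphic[of a] by (simp add: lift_def)

text \<open>The representation prescribes \<open>F\<close> only off the nodes; as these are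
  isolated, continuity determines the values there.\<close>

lemma rep_unique:
  assumes "dB_rep T \<mu> A a F" shows "F = lift a"
proof
  fix z
  have a: "l2_on T a" and F: "F holomorphic_on UNIV" using assms by (auto simp: dB_rep_def)
  have off: "F w = lift a w" if "w \<notin> CT" for w
    using assms that by (simp add: dB_rep_def lift_def)
  show "F z = lift a z"
  proof (cases "z \<in> CT")
    case True
    define S where "S = {t \<in> T. \<bar>t\<bar> \<le> norm z + 1}"
    have "finite (complex_of_real ` S)" unfolding S_def by (intro finite_imageI finite_T_bounded)
    then have "\<not> z islimpt (complex_of_real ` S)" by (rule islimpt_finite)
    then have "\<forall>\<^sub>F w in at z. w \<notin> complex_of_real ` S" by (simp add: islimpt_iff_eventually)
    moreover have "\<forall>\<^sub>F w in at z. w \<in> ball z 1"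
      by (rule eventually_at_in_open'[OF open_ball]) simp
    ultimately have "\<forall>\<^sub>F w in at z. F w = lift a w"
    proof eventually_elim
      case (elim w)
      have "w \<notin> CT"
      proof
        assume "w \<in> CT"
        then obtain t where t: "t \<in> T" "w = of_real t" by auto
        have "norm w \<le> norm z + 1" using elim(2) norm_triangle_sub[of w z] by (simp add: dist_norm norm_minus_commute)
        then show False using elim(1) t by (auto simp: S_def)
      qed
      then show ?case by (rule off)
    qed
    then have cong: "F \<midarrow>z\<rightarrow> l \<longleftrightarrow> lift a \<midarrow>z\<rightarrow> l" for l by (rule tendsto_cong)
    have lims: "F \<midarrow>z\<rightarrow> F z" "lift a \<midarrow>z\<rightarrow> lift a z"
      using holomorphic_on_imp_continuous_on[OF F] holomorphic_on_imp_continuous_on[OF lift_holomorphic[OF a]]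
      by (auto simp: continuous_on_eq_continuous_at isCont_def)
    show ?thesis by (rule LIM_unique[OF lims(1)]) (use cong lims(2) in simp)
  qed (use off in auto)
qed

lemma lift_at_node: "t \<in> T \<Longrightarrow> lift a (of_real t) = deriv A (of_real t) * (a t * of_real (sqrt (\<mu> t)))"
  by (simp add: lift_def)

text \<open>Coefficients are read off from the values at the nodes, which is where the simplicity of
  the zeros of \<open>A\<close> enters.\<close>

lemma lift_inj:
  assumes "l2_on T a" "l2_on T b" "lift a = lift b" shows "a = b"
proof
  fix t
  show "a t = b t"
  proof (cases "t \<in> T")
    case True
    have "lift a (of_real t) = lift b (of_real t)" using assms(3) by simp
    then show ?thesis using lift_at_node[OF True] deriv_A_nonzero[OF True] sqrt_\<mu>_nonzero[OF True] by simp
  qed (use assms in \<open>simp add: l2_zero\<close>)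
qed

lemma space_eq: "dB_space T \<mu> A = lift ` {a. l2_on T a}"
proof (intro equalityI subsetI)
  fix F assume "F \<in> dB_space T \<mu> A"
  then obtain a where a: "dB_rep T \<mu> A a F" by (auto simp: dB_space_def)
  then have "l2_on T a" by (simp add: dB_rep_def)
  then show "F \<in> lift ` {a. l2_on T a}" using rep_unique[OF a] by blast
next
  fix F assume "F \<in> lift ` {a. l2_on T a}"
  then show "F \<in> dB_space T \<mu> A" using rep_lift by (auto simp: dB_space_def)
qed

lemma coef_lift:
  assumes "l2_on T a" shows "dB_coef T \<mu> A (lift a) = a"
  unfolding dB_coef_def
proof (rule the_equality)
  show "dB_rep T \<mu> A a (lift a)" by (rule rep_lift[OF assms])
  fix b assume "dB_rep T \<mu> A b (lift a)"
  then show "b = a" using rep_unique lift_inj assms by (metis dB_rep_def)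
qed

lemma lift_add:
  assumes "l2_on T a" "l2_on T b" shows "lift (\<lambda>t. a t + b t) z = lift a z + lift b z"
  using infsum_add[OF cauchy_summable[OF assms(1), of z] cauchy_summable[OF assms(2), of z]]
  by (simp add: lift_def algebra_simps add_divide_distrib)

lemma lift_scale: "lift (\<lambda>t. c * a t) z = c * lift a z"
  using infsum_cmult_right'[of c "\<lambda>t. a t * of_real (sqrt (\<mu> t)) / (z - of_real t)" T]
  by (simp add: lift_def mult_ac)

lemma lift_diff:
  assumes "l2_on T a" "l2_on T b" shows "lift (\<lambda>t. a t - b t) z = lift a z - lift b z"
  using lift_add[OF assms(1) l2_scale[OF assms(2)], of "-1" z] lift_scale[of "-1" b z] by simp

lemma lift_zero: "lift (\<lambda>t. 0) z = 0"
  using lift_scale[of 0 "\<lambda>t. 0" z] by simp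

lemma inner_lift:
  assumes "l2_on T a" "l2_on T b"
  shows "dB_inner T \<mu> A (lift a) (lift b) = of_real (pi\<^sup>2) * ip T a b"
  using assms by (simp add: dB_inner_def coef_lift ip_def)

text \<open>The Riesz vector of evaluation at \<open>w\<close>, with \<open>pi^2\<close> cancelling
  the normalization of the inner product. At a node, evaluation sees a single coefficient.\<close>

definition kvec :: "complex \<Rightarrow> real \<Rightarrow> complex" where
  "kvec w = (if w \<in> CT then (\<lambda>t. if t = Re w then cnj (deriv A w * of_real (sqrt (\<mu> t))) / of_real (pi\<^sup>2) else 0)
     else (\<lambda>t. cnj (A w * cvec w t) / of_real (pi\<^sup>2)))"

lemma l2_kvec: "l2_on T (kvec w)"
proof (cases "w \<in> CT")
  case True
  then show ?thesis by (intro l2_finite_support[of "{Re w}"]) (auto simp: kvec_def)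
next
  case False
  have "kvec w = (\<lambda>t. (cnj (A w) / of_real (pi\<^sup>2)) * cnj (cvec w t))"
    using False by (auto simp: kvec_def)
  then show ?thesis using l2_scale[OF l2_cnj[OF l2_cvec]] by metis
qed

lemma eval_lift:
  assumes "l2_on T a" shows "lift a w = of_real (pi\<^sup>2) * ip T a (kvec w)"
proof (cases "w \<in> CT")
  case True
  then obtain s where s: "s \<in> T" "w = of_real s" by auto
  have "ip T a (kvec w) = (\<Sum>\<^sub>\<infinity>t\<in>{s}. a t * cnj (kvec w t))"
    unfolding ip_def by (rule infsum_cong_neutral) (use s True in \<open>auto simp: kvec_def\<close>)
  then show ?thesis using s True by (simp add: kvec_def lift_def)
next
  case False
  have "ip T a (kvec w) = (\<Sum>\<^sub>\<infinity>t\<in>T. A w / of_real (pi\<^sup>2) * (a t * of_real (sqrt (\<mu> t)) / (w - of_real t)))"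
    unfolding ip_def by (rule infsum_cong) (use False in \<open>simp add: kvec_def cvec_def mult_ac\<close>)
  then show ?thesis using False unfolding infsum_cmult_right' by (simp add: lift_def)
qed

lemma kernel_eq: "dB_kernel T \<mu> A w = lift (kvec w)"
  unfolding dB_kernel_def
proof (rule the_equality)
  show "lift (kvec w) \<in> dB_space T \<mu> A \<and> (\<forall>F\<in>dB_space T \<mu> A. dB_inner T \<mu> A F (lift (kvec w)) = F w)"
    by (auto simp: space_eq l2_kvec inner_lift eval_lift)
  fix k assume k: "k \<in> dB_space T \<mu> A \<and> (\<forall>F\<in>dB_space T \<mu> A. dB_inner T \<mu> A F k = F w)"
  then obtain b where b: "l2_on T b" "k = lift b" by (auto simp: space_eq)
  have "ip T a (\<lambda>t. b t - kvec w t) = 0" if a: "l2_on T a" for a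
  proof -
    have "of_real (pi\<^sup>2) * ip T a b = of_real (pi\<^sup>2) * ip T a (kvec w)"
      using k a b by (auto simp: space_eq inner_lift eval_lift)
    then have "ip T a b = ip T a (kvec w)" by simp
    then have "ip T (\<lambda>t. b t - kvec w t) a = 0"
      using ip_diff_left[OF b(1) l2_kvec a, of w] by (metis cancel_comm_monoid_add_class.diff_cancel ip_cnj)
    then show ?thesis by (metis ip_cnj complex_cnj_zero)
  qed
  then have "b t - kvec w t = 0" for t
    using ip_zero_imp_zero[OF l2_diff[OF b(1) l2_kvec, of w]] by blast
  then show "k = lift (kvec w)" using b(2) by (metis eq_iff_diff_eq_0 ext)
qed

end

section \<open>Completeness, minimality and defect in coordinates\<close>

context de_Branges
begin

abbreviation H where "H \<equiv> dB_space T \<mu> A"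
abbreviation inn where "inn \<equiv> dB_inner T \<mu> A"

lemma lift_in_H: "l2_on T a \<Longrightarrow> lift a \<in> H"
  by (simp add: space_eq)

lemma fspan_lift:
  assumes B: "\<And>f. f \<in> B \<Longrightarrow> l2_on T f"
  shows "fspan (lift ` B) = lift ` lspan B"
proof (intro equalityI subsetI)
  fix G assume "G \<in> fspan (lift ` B)"
  then obtain n :: nat and c f where f: "\<forall>i<n. f i \<in> lift ` B" and G: "G = (\<lambda>z. \<Sum>i<n. c i * f i z)"
    by (auto simp: fspan_def)
  have "(\<lambda>z. \<Sum>i<m. c i * f i z) \<in> lift ` lspan B" if "m \<le> n" for m
    using that
  proof (induction m)
    case 0
    then show ?case using lspan.zero by (auto simp: image_iff fun_eq_iff lift_zero intro!: bexI[of _ "\<lambda>t. 0"])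
  next
    case (Suc m)
    then obtain x where x: "x \<in> lspan B" "(\<lambda>z. \<Sum>i<m. c i * f i z) = lift x" by auto
    have "f m \<in> lift ` B" using f Suc.prems by simp
    then obtain b where b: "b \<in> B" "f m = lift b" by auto
    have "lift (\<lambda>t. x t + c m * b t) z = lift x z + c m * lift b z" for z
      by (simp add: lift_add[OF lspan_l2[OF x(1) B] l2_scale[OF B[OF b(1)]]] lift_scale)
    then have "(\<lambda>z. \<Sum>i<Suc m. c i * f i z) = lift (\<lambda>t. x t + c m * b t)"
      using fun_cong[OF x(2)] b(2) by (simp add: fun_eq_iff)
    then show ?case using lspan.step[OF x(1) b(1)] by blast
  qed
  then show "G \<in> lift ` lspan B" using G by simp
next
  fix G assume "G \<in> lift ` lspan B"
  then obtain x where x: "x \<in> lspan B" "G = lift x" by auto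
  from x(1) have "lift x \<in> fspan (lift ` B)"
  proof (induction rule: lspan.induct)
    case zero
    show ?case unfolding fspan_def by (auto intro!: exI[of _ "0::nat"] simp: fun_eq_iff lift_zero)
  next
    case (step x f c)
    then obtain n :: nat and d g where g: "\<forall>i<n. g i \<in> lift ` B" and x: "lift x = (\<lambda>z. \<Sum>i<n. d i * g i z)"
      by (auto simp: fspan_def)
    have "lift (\<lambda>t. x t + c * f t) z = lift x z + c * lift f z" for z
      by (simp add: lift_add[OF lspan_l2[OF step(1) B] l2_scale[OF B[OF step(2)]]] lift_scale)
    then have "lift (\<lambda>t. x t + c * f t) = (\<lambda>z. \<Sum>i<Suc n. (d(n := c)) i * (g(n := lift f)) i z)"
      using x by (simp add: fun_eq_iff)
    moreover have "\<forall>i<Suc n. (g(n := lift f)) i \<in> lift ` B" using g step(2) by (auto simp: less_Suc_eq)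
    ultimately show ?case unfolding fspan_def by blast
  qed
  then show "G \<in> fspan (lift ` B)" using x(2) by simp
qed

lemma norm_lift_diff:
  assumes "l2_on T a" "l2_on T x"
  shows "sqrt (Re (inn (\<lambda>z. lift a z - lift x z) (\<lambda>z. lift a z - lift x z))) = pi * sqrt (sqnorm T (\<lambda>t. a t - x t))"
proof -
  have l2: "l2_on T (\<lambda>t. a t - x t)" by (rule l2_diff[OF assms])
  have "(\<lambda>z. lift a z - lift x z) = lift (\<lambda>t. a t - x t)" using lift_diff[OF assms] by (simp add: fun_eq_iff)
  then have "inn (\<lambda>z. lift a z - lift x z) (\<lambda>z. lift a z - lift x z) = of_real (pi\<^sup>2 * sqnorm T (\<lambda>t. a t - x t))"
    using inner_lift[OF l2 l2] by (simp add: ip_self[OF l2])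
  then show ?thesis by (simp add: real_sqrt_mult)
qed

lemma clspan_lift:
  assumes B: "\<And>f. f \<in> B \<Longrightarrow> l2_on T f"
  shows "clspan H inn (lift ` B) = lift ` l2_closure T B"
proof -
  have iff: "(\<forall>e>0. \<exists>G\<in>fspan (lift ` B). sqrt (Re (inn (\<lambda>z. lift a z - G z) (\<lambda>z. lift a z - G z))) < e) \<longleftrightarrow>
      a \<in> l2_closure T B" (is "?L \<longleftrightarrow> _") if a: "l2_on T a" for a
  proof -
    have "?L \<longleftrightarrow> (\<forall>e>0. \<exists>x\<in>lspan B. pi * sqrt (sqnorm T (\<lambda>t. a t - x t)) < e)"
    proof -
      have fs: "fspan (lift ` B) = lift ` lspan B" by (rule fspan_lift[OF B])
      have "sqrt (Re (inn (\<lambda>z. lift a z - lift x z) (\<lambda>z. lift a z - lift x z))) = pi * sqrt (sqnorm T (\<lambda>t. a t - x t))"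
        if "x \<in> lspan B" for x
        by (rule norm_lift_diff[OF a lspan_l2[OF that B]])
      then show ?thesis unfolding fs by (simp cong: bex_cong)
    qed
    also have "\<dots> \<longleftrightarrow> (\<forall>e>0. \<exists>x\<in>lspan B. sqnorm T (\<lambda>t. a t - x t) < e)"
    proof (intro iffI allI impI)
      fix e :: real assume L: "\<forall>e>0. \<exists>x\<in>lspan B. pi * sqrt (sqnorm T (\<lambda>t. a t - x t)) < e" and e: "0 < e"
      have "0 < pi * sqrt e" using e by simp
      then obtain x where "x \<in> lspan B" "pi * sqrt (sqnorm T (\<lambda>t. a t - x t)) < pi * sqrt e" using L by blast
      then show "\<exists>x\<in>lspan B. sqnorm T (\<lambda>t. a t - x t) < e" by auto
    next
      fix e :: real assume R: "\<forall>e>0. \<exists>x\<in>lspan B. sqnorm T (\<lambda>t. a t - x t) < e" and e: "0 < e"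
      have "0 < (e / pi)\<^sup>2" using e by simp
      then obtain x where x: "x \<in> lspan B" "sqnorm T (\<lambda>t. a t - x t) < (e / pi)\<^sup>2" using R by blast
      then have "sqrt (sqnorm T (\<lambda>t. a t - x t)) < sqrt ((e / pi)\<^sup>2)" by (intro real_sqrt_less_mono)
      moreover have "sqrt ((e / pi)\<^sup>2) = e / pi" using e by simp
      ultimately have "pi * sqrt (sqnorm T (\<lambda>t. a t - x t)) < pi * (e / pi)"
        by (intro mult_strict_left_mono) auto
      then have "pi * sqrt (sqnorm T (\<lambda>t. a t - x t)) < e" by simp
      then show "\<exists>x\<in>lspan B. pi * sqrt (sqnorm T (\<lambda>t. a t - x t)) < e" using x(1) by blast
    qed
    finally show ?thesis using a by (simp add: l2_closure_def)
  qed
  have "l2_on T a" if "a \<in> l2_closure T B" for a using that by (simp add: l2_closure_def)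
  then show ?thesis unfolding clspan_def space_eq using iff by auto
qed

lemma complete_lift:
  assumes B: "\<And>f. f \<in> B \<Longrightarrow> l2_on T f" and cl: "\<And>a. l2_on T a \<Longrightarrow> a \<in> l2_closure T B"
  shows "complete_sys H inn (lift ` B)"
proof -
  have "clspan H inn (lift ` B) = lift ` l2_closure T B" by (rule clspan_lift[OF B])
  then show ?thesis unfolding complete_sys_def using B cl by (auto simp: space_eq)
qed

lemma kernel_image: "dB_kernel T \<mu> A ` X = lift ` kvec ` X"
  by (auto simp: kernel_eq)

text \<open>Minimality follows from biorthogonality: a kernel in the closed span of the others would
  be orthogonal to its own dual element.\<close>

lemma M_basis_lift:
  assumes g: "\<And>l. l \<in> \<Lambda> \<Longrightarrow> l2_on T (g l)"
    and bi: "\<And>l \<nu>. l \<in> \<Lambda> \<Longrightarrow> \<nu> \<in> \<Lambda> \<Longrightarrow> of_real (pi\<^sup>2) * ip T (g l) (kvec \<nu>) = (if l = \<nu> then 1 else 0)"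
    and k: "\<And>a. l2_on T a \<Longrightarrow> a \<in> l2_closure T (kvec ` \<Lambda>)"
    and gc: "\<And>a. l2_on T a \<Longrightarrow> a \<in> l2_closure T (g ` \<Lambda>)"
  shows "biorth_fam H inn \<Lambda> (dB_kernel T \<mu> A) (\<lambda>l. lift (g l))"
    "M_basis_fam H inn \<Lambda> (dB_kernel T \<mu> A)"
proof -
  show bo: "biorth_fam H inn \<Lambda> (dB_kernel T \<mu> A) (\<lambda>l. lift (g l))"
    unfolding biorth_fam_def using g bi by (auto simp: lift_in_H kernel_eq inner_lift l2_kvec)
  have "complete_sys H inn (lift ` kvec ` \<Lambda>)" by (rule complete_lift) (use k l2_kvec in auto)
  moreover have "complete_sys H inn (lift ` g ` \<Lambda>)" by (rule complete_lift) (use gc g in auto)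
  moreover have "minimal_fam H inn \<Lambda> (dB_kernel T \<mu> A)"
    unfolding minimal_fam_def
  proof (intro ballI conjI notI)
    fix l assume l: "l \<in> \<Lambda>"
    show "dB_kernel T \<mu> A l \<in> H" by (simp add: kernel_eq lift_in_H l2_kvec)
    assume "dB_kernel T \<mu> A l \<in> clspan H inn (dB_kernel T \<mu> A ` (\<Lambda> - {l}))"
    moreover have "clspan H inn (dB_kernel T \<mu> A ` (\<Lambda> - {l})) = lift ` l2_closure T (kvec ` (\<Lambda> - {l}))"
      unfolding kernel_image by (rule clspan_lift) (auto simp: l2_kvec)
    ultimately obtain a where a: "a \<in> l2_closure T (kvec ` (\<Lambda> - {l}))" "lift (kvec l) = lift a"
      by (auto simp: kernel_eq)
    have "kvec l = a" by (rule lift_inj[OF l2_kvec _ a(2)]) (use a in \<open>simp add: l2_closure_def\<close>)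
    have "ip T a (g l) = 0"
    proof (rule ip_closure_zero[OF _ a(1) g[OF l]])
      fix f assume "f \<in> kvec ` (\<Lambda> - {l})"
      then obtain \<nu> where \<nu>: "\<nu> \<in> \<Lambda>" "\<nu> \<noteq> l" "f = kvec \<nu>" by auto
      then have "ip T (g l) f = 0" using bi[OF l \<nu>(1)] by auto
      then show "ip T f (g l) = 0" by (metis ip_cnj complex_cnj_zero)
    qed (auto simp: l2_kvec)
    then have "ip T (g l) (kvec l) = 0" unfolding \<open>kvec l = a\<close> by (metis ip_cnj complex_cnj_zero)
    then show False using bi[OF l l] by simp
  qed
  ultimately show "M_basis_fam H inn \<Lambda> (dB_kernel T \<mu> A)"
    unfolding M_basis_fam_def exact_fam_def kernel_image using bo by (auto simp: image_image)
qed

lemma defect_infinite_lift: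
  assumes \<beta>: "\<And>k::nat. l2_on T (\<beta> k)" and g: "\<And>l. l \<in> \<Lambda>1 \<Longrightarrow> l2_on T (g l)"
    and o1: "\<And>k l. l \<in> \<Lambda>1 \<Longrightarrow> ip T (\<beta> k) (g l) = 0"
    and o2: "\<And>k l. l \<in> \<Lambda>2 \<Longrightarrow> ip T (\<beta> k) (kvec l) = 0"
    and indep: "\<And>n c. (\<And>t. (\<Sum>i<n. c i * \<beta> i t) = 0) \<Longrightarrow> (\<forall>i<n. c i = 0)"
  shows "defect_infinite H inn \<Lambda>1 \<Lambda>2 (dB_kernel T \<mu> A) (\<lambda>l. lift (g l))"
  unfolding defect_infinite_def infinite_dim_def
proof (intro allI exI conjI impI)
  fix n i :: nat assume "i < n"
  show "lift (\<beta> i) \<in> orth_compl H inn ((\<lambda>l. lift (g l)) ` \<Lambda>1 \<union> dB_kernel T \<mu> A ` \<Lambda>2)"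
    unfolding orth_compl_def by (auto simp: lift_in_H \<beta> kernel_eq inner_lift l2_kvec g o1 o2)
next
  fix n i c assume 0: "(\<lambda>z. \<Sum>i<n. c i * lift (\<beta> i) z) = (\<lambda>z. 0)" and i: "i < n"
  have l: "l2_on T (\<lambda>t. \<Sum>i<m. c i * \<beta> i t) \<and> lift (\<lambda>t. \<Sum>i<m. c i * \<beta> i t) = (\<lambda>z. \<Sum>i<m. c i * lift (\<beta> i) z)" for m
  proof (induction m)
    case 0 then show ?case by (simp add: l2_0 lift_zero fun_eq_iff)
  next
    case (Suc m)
    then have l2: "l2_on T (\<lambda>t. \<Sum>i<m. c i * \<beta> i t)" by blast
    have "lift (\<lambda>t. (\<Sum>i<m. c i * \<beta> i t) + c m * \<beta> m t) z =
        lift (\<lambda>t. \<Sum>i<m. c i * \<beta> i t) z + c m * lift (\<beta> m) z" for z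
      by (simp add: lift_add[OF l2 l2_scale[OF \<beta>]] lift_scale)
    then show ?case using Suc l2_add[OF l2 l2_scale[OF \<beta>]] by (simp add: fun_eq_iff)
  qed
  have "lift (\<lambda>t. \<Sum>i<n. c i * \<beta> i t) = lift (\<lambda>t. 0)" using l[of n] 0 by (simp add: fun_eq_iff lift_zero)
  then have "(\<lambda>t. \<Sum>i<n. c i * \<beta> i t) = (\<lambda>t. 0)" using lift_inj l l2_0 by blast
  then have "\<forall>i<n. c i = 0" by (intro indep) (simp add: fun_eq_iff)
  then show "c i = 0" using i by blast
qed

end

section \<open>The mixed system\<close>

lemma closure_sum:
  assumes B: "\<And>f. f \<in> B \<Longrightarrow> l2_on T f" and "finite F" "\<And>i. i \<in> F \<Longrightarrow> x i \<in> l2_closure T B"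
  shows "(\<lambda>t. \<Sum>i\<in>F. c i * x i t) \<in> l2_closure T B"
  using assms(2,3)
proof (induction F rule: finite_induct)
  case empty
  then show ?case using lspan_in_closure[OF B lspan.zero] by simp
next
  case (insert i F)
  have "(\<lambda>t. c i * x i t + (\<Sum>i\<in>F. c i * x i t)) \<in> l2_closure T B"
    by (intro closure_add[OF B] closure_scale[OF B]) (use insert in auto)
  then show ?case using insert.hyps by simp
qed

text \<open>\<open>appr\<close> controls a combination of Cauchy vectors on \<open>T'\<close> only;
  what it leaves outside is subtracted by means of unit vectors. For \<open>W = V\<close> these are
  kernels at \<open>T - T'\<close>; for \<open>W = U\<close> there is nothing to subtract.\<close>

lemma unit_in_closure:
  fixes W :: "real \<Rightarrow> real"
  assumes B: "\<And>f. f \<in> B \<Longrightarrow> l2_on T f" and T': "T' \<subseteq> T" "s0 \<in> T'"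
    and cv: "\<And>\<gamma>. \<gamma> \<in> \<Gamma> \<Longrightarrow> (\<lambda>t. if t \<in> T then of_real (W t) / (of_real \<gamma> - of_real t) else 0) \<in> l2_closure T B"
    and units: "\<And>s. s \<in> T - T' \<Longrightarrow> W s \<noteq> 0 \<Longrightarrow> (\<lambda>t. if t = s then 1 else 0) \<in> l2_closure T B"
    and appr: "\<And>e. 0 < e \<Longrightarrow> \<exists>F a x. finite F \<and> F \<subseteq> \<Gamma> \<and> x < e \<and>
      ((\<lambda>s. ((\<Sum>\<gamma>\<in>F. a \<gamma> * (W s / (s - \<gamma>))) - (if s = s0 then 1 else 0))\<^sup>2) has_sum x) T'"
  shows "(\<lambda>t. if t = s0 then 1 else 0) \<in> l2_closure T B"
proof (rule closure_limit[OF B])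
  show "l2_on T (\<lambda>t. if t = s0 then 1 else 0)"
    using T' by (intro l2_finite_support[of "{s0}"]) auto
  fix e :: real assume "0 < e"
  from appr[OF this] obtain F a x where Fx: "finite F \<and> F \<subseteq> \<Gamma> \<and> x < e \<and>
    ((\<lambda>s. ((\<Sum>\<gamma>\<in>F. a \<gamma> * (W s / (s - \<gamma>))) - (if s = s0 then 1 else 0))\<^sup>2) has_sum x) T'"
    by (elim exE)
  then have F: "finite F" "F \<subseteq> \<Gamma>" "x < e"
    and hs: "((\<lambda>s. ((\<Sum>\<gamma>\<in>F. a \<gamma> * (W s / (s - \<gamma>))) - (if s = s0 then 1 else 0))\<^sup>2) has_sum x) T'"
    by blast+
  define c where "c \<gamma> t = (if t \<in> T then complex_of_real (W t) / (of_real \<gamma> - of_real t) else 0)" for \<gamma> t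
  \<comment> \<open>The minus sign converts the denominators \<open>s - \<gamma>\<close> of
    \<open>appr\<close> into those of the Cauchy vectors.\<close>
  define p where "p t = (\<Sum>\<gamma>\<in>F. complex_of_real (- a \<gamma>) * c \<gamma> t)" for t
  define p' where "p' t = (if t \<in> T' then p t else 0)" for t
  define r where "r t = (if t \<in> T' then 0 else p t)" for t
  have p: "p \<in> l2_closure T B" unfolding p_def
    by (rule closure_sum[OF B F(1)]) (use cv F(2) in \<open>auto simp: c_def[abs_def]\<close>)
  have "l2_on T p" using p by (simp add: l2_closure_def)
  then have "l2_on T r" unfolding l2_on_def r_def
    by (auto elim!: summable_on_comparison_test)
  have "r \<in> l2_closure T B"
  proof (rule closure_supported[OF B, where S = "{s \<in> T - T'. W s \<noteq> 0}"])
    show "l2_on T r" by fact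
    show "r t = 0" if "t \<notin> {s \<in> T - T'. W s \<noteq> 0}" for t
      using that by (auto simp: r_def p_def c_def intro!: sum.neutral)
  qed (use units in auto)
  then have "(\<lambda>t. p t + (-1) * r t) \<in> l2_closure T B" by (intro closure_add[OF B] closure_scale[OF B] p)
  moreover have "(\<lambda>t. p t + (-1) * r t) = p'" by (auto simp: p'_def r_def)
  ultimately have p': "p' \<in> l2_closure T B" by simp
  have "sqnorm T (\<lambda>t. (if t = s0 then 1 else 0) - p' t) =
      (\<Sum>\<^sub>\<infinity>s\<in>T'. ((\<Sum>\<gamma>\<in>F. a \<gamma> * (W s / (s - \<gamma>))) - (if s = s0 then 1 else 0))\<^sup>2)"
    unfolding sqnorm_def
  proof (rule infsum_cong_neutral)
    fix s assume "s \<in> T \<inter> T'"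
    then have s: "s \<in> T" "s \<in> T'" by auto
    have "complex_of_real (- a \<gamma>) * c \<gamma> s = of_real (a \<gamma> * (W s / (s - \<gamma>)))" for \<gamma>
    proof -
      have "- a \<gamma> * (W s / (\<gamma> - s)) = a \<gamma> * (W s / (s - \<gamma>))"
        by (metis minus_diff_eq minus_divide_right minus_mult_minus)
      then show ?thesis using s by (simp add: c_def flip: of_real_diff of_real_divide of_real_mult of_real_minus)
    qed
    then have "p' s = of_real (\<Sum>\<gamma>\<in>F. a \<gamma> * (W s / (s - \<gamma>)))"
      using s(2) by (simp add: p'_def p_def)
    then have "(if s = s0 then 1 else 0) - p' s =
        of_real (- ((\<Sum>\<gamma>\<in>F. a \<gamma> * (W s / (s - \<gamma>))) - (if s = s0 then 1 else 0)))"
      by simp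
    then show "(norm ((if s = s0 then 1 else 0) - p' s))\<^sup>2 =
        ((\<Sum>\<gamma>\<in>F. a \<gamma> * (W s / (s - \<gamma>))) - (if s = s0 then 1 else 0))\<^sup>2"
      by (simp only: norm_of_real power2_abs power2_minus)
  qed (use T' in \<open>auto simp: p'_def\<close>)
  also have "\<dots> = x" using hs by (rule infsumI)
  finally show "\<exists>b\<in>l2_closure T B. sqnorm T (\<lambda>t. (if t = s0 then 1 else 0) - b t) < e"
    using p' F(3) by auto
qed

lemma ip_unit_right:
  assumes "t \<in> T" shows "ip T a (\<lambda>s. if s = t then c else 0) = a t * cnj c"
proof -
  have "ip T a (\<lambda>s. if s = t then c else 0) = (\<Sum>\<^sub>\<infinity>s\<in>{t}. a s * cnj (if s = t then c else 0))"
    unfolding ip_def by (rule infsum_cong_neutral) (use assms in auto)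
  then show ?thesis by simp
qed

lemma infsum_of_real_zero:
  assumes "(f has_sum 0) S" shows "(\<Sum>\<^sub>\<infinity>s\<in>S. complex_of_real (f s)) = 0"
  using infsumI[OF has_sum_of_real[OF assms, where 'a = complex]] by simp

lemma polynomial_vanishing_on_infinite_reals:
  fixes c :: "nat \<Rightarrow> complex"
  assumes "infinite S" "\<And>s. s \<in> S \<Longrightarrow> (\<Sum>i<n. c i * of_real s ^ i) = 0" "i < n"
  shows "c i = 0"
proof -
  define p where "p = (\<Sum>i<n. monom (c i) i)"
  have "complex_of_real ` S \<subseteq> {x. poly p x = 0}"
    using assms(2) by (auto simp: p_def poly_sum poly_monom)
  moreover have "infinite (complex_of_real ` S)" using assms(1) by (simp add: finite_image_iff inj_on_def)
  ultimately have "p = 0" using poly_roots_finite finite_subset by blast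
  then have "coeff p i = 0" by simp
  then show ?thesis using assms(3) by (simp add: p_def coeff_sum)
qed

theorem theorem1p4:
  fixes T :: "real set"
  assumes "spectral_seq T"
  shows "\<exists>\<mu>::real \<Rightarrow> real. (\<forall>t\<in>T. \<mu> t > 0) \<and> (\<lambda>t. \<mu> t / (t\<^sup>2 + 1)) summable_on T \<and>
    (\<forall>A. dB_admissible T A \<longrightarrow>
      (\<exists>\<Lambda> \<Lambda>1 \<Lambda>2 g.
         M_basis_fam (dB_space T \<mu> A) (dB_inner T \<mu> A) \<Lambda> (dB_kernel T \<mu> A) \<and>
         biorth_fam (dB_space T \<mu> A) (dB_inner T \<mu> A) \<Lambda> (dB_kernel T \<mu> A) g \<and>
         \<Lambda>1 \<inter> \<Lambda>2 = {} \<and> \<Lambda>1 \<union> \<Lambda>2 = \<Lambda> \<and>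
         defect_infinite (dB_space T \<mu> A) (dB_inner T \<mu> A) \<Lambda>1 \<Lambda>2 (dB_kernel T \<mu> A) g))"
proof -
  obtain T' :: "real set" and V U B :: "real \<Rightarrow> real" and \<Gamma>1 \<Gamma>2 :: "real set" where
    T': "T' \<subseteq> T" "infinite T'" and V: "\<And>s. s \<in> T \<Longrightarrow> 0 < V s"
    and U: "\<And>s. s \<in> T' \<longleftrightarrow> U s \<noteq> 0" and B: "\<And>s. s \<in> T' \<longleftrightarrow> B s \<noteq> 0"
    and Vs: "(\<lambda>s. (V s)\<^sup>2 / (s\<^sup>2 + 1)) summable_on T" and Us: "(\<lambda>s. (U s)\<^sup>2 / (s\<^sup>2 + 1)) summable_on T"
    and Bs: "\<And>k. (\<lambda>s. (B s * s ^ k)\<^sup>2) summable_on T"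
    and \<Gamma>: "\<Gamma>1 \<inter> \<Gamma>2 = {}" "(\<Gamma>1 \<union> \<Gamma>2) \<inter> T = {}"
    and UV: "\<And>\<gamma>. \<gamma> \<in> \<Gamma>1 \<union> \<Gamma>2 \<Longrightarrow> ((\<lambda>s. U s * V s / (s - \<gamma>)) has_sum 0) T"
    and BV: "\<And>\<gamma> k. \<gamma> \<in> \<Gamma>2 \<Longrightarrow> ((\<lambda>s. B s * s ^ k * V s / (s - \<gamma>)) has_sum 0) T"
    and BU: "\<And>\<gamma> k. \<gamma> \<in> \<Gamma>1 \<Longrightarrow> ((\<lambda>s. B s * s ^ k * U s / (s - \<gamma>)) has_sum 0) T"
    and aV: "\<And>s0 e. s0 \<in> T' \<Longrightarrow> 0 < e \<Longrightarrow> \<exists>F a x. finite F \<and> F \<subseteq> \<Gamma>1 \<union> \<Gamma>2 \<and> x < e \<and>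
      ((\<lambda>s. ((\<Sum>\<gamma>\<in>F. a \<gamma> * (V s / (s - \<gamma>))) - (if s = s0 then 1 else 0))\<^sup>2) has_sum x) T'"
    and aU: "\<And>s0 e. s0 \<in> T' \<Longrightarrow> 0 < e \<Longrightarrow> \<exists>F a x. finite F \<and> F \<subseteq> \<Gamma>1 \<union> \<Gamma>2 \<and> x < e \<and>
      ((\<lambda>s. ((\<Sum>\<gamma>\<in>F. a \<gamma> * (U s / (s - \<gamma>))) - (if s = s0 then 1 else 0))\<^sup>2) has_sum x) T'"
    by (rule cauchy_weights_exist[OF assms], rule that)
  define \<mu> where "\<mu> s = (V s)\<^sup>2" for s
  have \<mu>_pos: "0 < \<mu> t" if "t \<in> T" for t using V[OF that] by (simp add: \<mu>_def)
  have \<mu>_sum: "(\<lambda>t. \<mu> t / (t\<^sup>2 + 1)) summable_on T" using Vs by (simp add: \<mu>_def)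
  have sqrt\<mu>: "sqrt (\<mu> t) = V t" if "t \<in> T" for t using V[OF that] by (simp add: \<mu>_def)
  show ?thesis
  proof (intro exI[of _ \<mu>] conjI ballI allI impI \<mu>_pos \<mu>_sum)
    fix A assume adm: "dB_admissible T A"
    interpret de_Branges T \<mu> A by unfold_locales (fact assms \<mu>_pos \<mu>_sum adm)+
    define \<Lambda>1 where "\<Lambda>1 = complex_of_real ` \<Gamma>1"
    define \<Lambda>2 where "\<Lambda>2 = complex_of_real ` (\<Gamma>2 \<union> (T - T'))"
    define \<Lambda> where "\<Lambda> = \<Lambda>1 \<union> \<Lambda>2"
    have \<Lambda>_eq: "\<Lambda> = complex_of_real ` (\<Gamma>1 \<union> \<Gamma>2 \<union> (T - T'))" by (auto simp: \<Lambda>_def \<Lambda>1_def \<Lambda>2_def)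
    have U0: "U s = 0" and B0: "B s = 0" if "s \<notin> T'" for s using U B that by auto
    define e where "e s = (\<lambda>t. if t = s then 1 else 0 :: complex)" for s :: real
    define y where "y z t = (if t \<in> T then complex_of_real (U t) / (of_real z - of_real t) else 0)" for z t :: real
    have l2y: "l2_on T (y z)" for z using l2_cauchy[OF assms Us, of "of_real z"] by (simp add: y_def[abs_def])
    have l2e: "l2_on T (e s)" if "s \<in> T" for s
      using that by (intro l2_finite_support[of "{s}"]) (auto simp: e_def)
    have y0: "y z t = 0" if "t \<notin> T'" for z t using U0[OF that] by (simp add: y_def)
    have cv: "cvec (of_real x) t = (if t \<in> T then of_real (V t) / (of_real x - of_real t) else 0)" for x t
      by (simp add: cvec_def sqrt\<mu>)
    have k\<Gamma>: "\<exists>c. c \<noteq> 0 \<and> kvec (of_real x) = (\<lambda>t. c * cvec (of_real x) t)" if "x \<in> \<Gamma>1 \<union> \<Gamma>2" for x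
    proof -
      have x: "complex_of_real x \<notin> CT" using that \<Gamma>(2) by auto
      have "cnj (cvec (of_real x) t) = cvec (of_real x) t" for t by (simp add: cv)
      then have "kvec (of_real x) = (\<lambda>t. cnj (A (of_real x)) / of_real (pi\<^sup>2) * cvec (of_real x) t)"
        using x by (simp add: kvec_def fun_eq_iff)
      moreover have "cnj (A (of_real x)) / of_real (pi\<^sup>2) \<noteq> 0" using x A_zero_iff by simp
      ultimately show ?thesis by blast
    qed
    have kT: "\<exists>c. c \<noteq> 0 \<and> kvec (of_real s) = (\<lambda>t. c * e s t)" if "s \<in> T" for s
    proof -
      let ?c = "cnj (deriv A (of_real s) * of_real (sqrt (\<mu> s))) / complex_of_real (pi\<^sup>2)"
      have "kvec (of_real s) = (\<lambda>t. ?c * e s t)" using that by (auto simp: kvec_def e_def fun_eq_iff)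
      moreover have "?c \<noteq> 0" using deriv_A_nonzero[OF that] sqrt_\<mu>_nonzero[OF that] by simp
      ultimately show ?thesis by blast
    qed
    have l2k: "\<And>f. f \<in> kvec ` \<Lambda> \<Longrightarrow> l2_on T f" using l2_kvec by auto
    have scaled: "a \<in> l2_closure T X" if X: "\<And>f. f \<in> X \<Longrightarrow> l2_on T f" and f: "f \<in> X" "c \<noteq> 0" "f = (\<lambda>t. c * a t)"
      for X f a and c :: complex
    proof -
      have "(\<lambda>t. (1/c) * f t) \<in> l2_closure T X"
        by (rule closure_scale[OF X lspan_in_closure[OF X lspan_base[OF f(1)]]])
      then show ?thesis using f by simp
    qed
    have cvec_cl: "cvec (of_real x) \<in> l2_closure T (kvec ` \<Lambda>)" if x: "x \<in> \<Gamma>1 \<union> \<Gamma>2" for x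
    proof -
      obtain c where c: "c \<noteq> 0" "kvec (of_real x) = (\<lambda>t. c * cvec (of_real x) t)" using k\<Gamma>[OF x] by blast
      have "kvec (of_real x) \<in> kvec ` \<Lambda>" using x by (auto simp: \<Lambda>_eq)
      from scaled[OF l2k this c] show ?thesis .
    qed
    have unit_cl: "e s \<in> l2_closure T (kvec ` \<Lambda>)" if s: "s \<in> T - T'" for s
    proof -
      obtain c where c: "c \<noteq> 0" "kvec (of_real s) = (\<lambda>t. c * e s t)" using kT s by blast
      have "kvec (of_real s) \<in> kvec ` \<Lambda>" using s by (auto simp: \<Lambda>_eq)
      from scaled[OF l2k this c] show ?thesis .
    qed
    have unit_cl': "e s \<in> l2_closure T (kvec ` \<Lambda>)" if "s \<in> T'" for s
      unfolding e_def
    proof (rule unit_in_closure[OF l2k T'(1) that, where \<Gamma> = "\<Gamma>1 \<union> \<Gamma>2" and W = V])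
      fix x assume "x \<in> \<Gamma>1 \<union> \<Gamma>2"
      then show "(\<lambda>t. if t \<in> T then complex_of_real (V t) / (of_real x - of_real t) else 0) \<in> l2_closure T (kvec ` \<Lambda>)"
        using cvec_cl by (simp add: cv[abs_def])
    qed (use unit_cl aV[OF that] in \<open>auto simp: e_def\<close>)
    have k_complete: "a \<in> l2_closure T (kvec ` \<Lambda>)" if "l2_on T a" for a
    proof (rule closure_supported[OF l2k _ order_refl that])
      fix s assume "s \<in> T"
      then show "(\<lambda>t. if t = s then 1 else 0) \<in> l2_closure T (kvec ` \<Lambda>)"
        using unit_cl[of s] unit_cl'[of s] unfolding e_def by blast
    qed (auto intro: l2_zero[OF that])
    define \<psi> where "\<psi> z = (\<Sum>\<^sub>\<infinity>s\<in>T. complex_of_real (U s * V s / (s - z)))" for z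
    \<comment> \<open>By partial fractions
      \<open>(z - x) / ((z - s) * (x - s)) = 1 / (x - s) - 1 / (z - s)\<close>. Summed against
      \<open>U s * V s\<close> the first part vanishes by \<open>UV\<close> and the second gives
      \<open>\<psi> z\<close>. Admitting \<open>z\<close> in \<open>T - T'\<close> is what makes the
      correction below computable.\<close>
    have yc: "(of_real z - of_real x) * ip T (y z) (cvec (of_real x)) = \<psi> z"
      if x: "x \<in> \<Gamma>1 \<union> \<Gamma>2" and z: "z \<noteq> x" "z \<notin> T'" for x z
    proof -
      let ?P = "\<lambda>s. y z s * cnj (cvec (of_real x) s)"
      have P: "(?P has_sum ip T (y z) (cvec (of_real x))) T"
        unfolding ip_def by (intro has_sum_infsum ip_summable l2y l2_cvec)
      have "((\<lambda>s. (of_real z - of_real x) * ?P s + complex_of_real (U s * V s / (s - x))) has_sum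
          (of_real z - of_real x) * ip T (y z) (cvec (of_real x)) + complex_of_real 0) T"
        by (intro has_sum_add has_sum_cmult_right P has_sum_of_real UV x)
      moreover have "(of_real z - of_real x) * ?P s + complex_of_real (U s * V s / (s - x)) =
          complex_of_real (U s * V s / (s - z))" if s: "s \<in> T" for s
      proof (cases "s \<in> T'")
        case True
        have ne: "s - z \<noteq> 0" "s - x \<noteq> 0" "z - s \<noteq> 0" "x - s \<noteq> 0" using True z s x \<Gamma>(2) by auto
        have "(z - x) * (U s / (z - s) * (V s / (x - s))) + U s * V s / (s - x) = U s * V s / (s - z)"
          using ne by (simp add: divide_simps) (simp add: algebra_simps)
        moreover have "?P s = of_real (U s / (z - s) * (V s / (x - s)))" using s by (simp add: y_def cv)
        ultimately show ?thesis by (metis of_real_add of_real_diff of_real_mult)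
      next
        case False
        then show ?thesis by (simp add: U0 y0)
      qed
      ultimately have "((\<lambda>s. complex_of_real (U s * V s / (s - z))) has_sum
          (of_real z - of_real x) * ip T (y z) (cvec (of_real x)) + complex_of_real 0) T"
        by (simp only: cong: has_sum_cong)
      from infsumI[OF this] show ?thesis unfolding \<psi>_def by simp
    qed
    have \<psi>0: "\<psi> z = 0" if "z \<in> \<Gamma>1 \<union> \<Gamma>2" for z
      unfolding \<psi>_def by (rule infsum_of_real_zero[OF UV[OF that]])
    \<comment> \<open>At a point \<open>z\<close> of \<open>T - T'\<close>, the unit vector is added to keep orthogonality to the Cauchy vectors, for which
      the product of \<open>y z\<close> with the one at \<open>x\<close> is \<open>\<psi> z / (z - x)\<close> instead of 0.\<close>
    define w where "w l = (\<lambda>t. y (Re l) t + (if l \<in> CT then \<psi> (Re l) / of_real (V (Re l)) else 0) * e (Re l) t)" for l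
    have l2w: "l2_on T (w l)" for l
    proof (cases "l \<in> CT")
      case True
      then have "Re l \<in> T" by auto
      then show ?thesis unfolding w_def by (intro l2_add l2y l2_scale l2e)
    qed (use l2y in \<open>simp add: w_def\<close>)
    have w_off: "ip T (w l) (kvec \<nu>) = 0" if l: "l \<in> \<Lambda>" and \<nu>: "\<nu> \<in> \<Lambda>" and ne: "l \<noteq> \<nu>" for l \<nu>
    proof -
      obtain z where z: "z \<in> \<Gamma>1 \<union> \<Gamma>2 \<union> (T - T')" "l = of_real z" using l by (auto simp: \<Lambda>_eq)
      obtain x where x: "x \<in> \<Gamma>1 \<union> \<Gamma>2 \<union> (T - T')" "\<nu> = of_real x" using \<nu> by (auto simp: \<Lambda>_eq)
      have zx: "z \<noteq> x" using ne z x by auto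
      show ?thesis
      proof (cases "x \<in> T")
        case True
        then obtain c where c: "kvec \<nu> = (\<lambda>t. c * e x t)" using kT x(2) by blast
        have "x \<notin> T'" using True x(1) \<Gamma>(2) by blast
        then have "w l x = 0" using zx z(2) by (simp add: w_def y0 e_def)
        then show ?thesis unfolding c ip_scale_right using ip_unit_right[OF True, of "w l" 1] by (simp add: e_def)
      next
        case False
        then have x\<Gamma>: "x \<in> \<Gamma>1 \<union> \<Gamma>2" using x(1) by blast
        then obtain c where c: "kvec \<nu> = (\<lambda>t. c * cvec (of_real x) t)" using k\<Gamma> x(2) by blast
        have zT': "z \<notin> T'" using z(1) \<Gamma>(2) T'(1) by blast
        have y: "ip T (y z) (cvec (of_real x)) = \<psi> z / (of_real z - of_real x)"
          using yc[OF x\<Gamma> zx zT'] zx by (simp add: field_simps)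
        have "ip T (w l) (cvec (of_real x)) = 0"
        proof (cases "z \<in> T")
          case True
          have "ip T (e z) (cvec (of_real x)) = cvec (of_real x) z"
          proof -
            have "ip T (cvec (of_real x)) (e z) = cvec (of_real x) z"
              using ip_unit_right[OF True, of "cvec (of_real x)" 1] by (simp add: e_def)
            then have "ip T (e z) (cvec (of_real x)) = cnj (cvec (of_real x) z)" using ip_cnj by metis
            then show ?thesis by (simp add: cv)
          qed
          also have "\<dots> = of_real (V z) / (of_real x - of_real z)" using True by (simp add: cv)
          finally have E: "ip T (\<lambda>t. \<psi> z / of_real (V z) * e z t) (cvec (of_real x)) = \<psi> z / (of_real x - of_real z)"
            unfolding ip_scale_left using V[OF True] by simp
          have wl: "w l = (\<lambda>t. y z t + \<psi> z / of_real (V z) * e z t)"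
            using z(2) True by (auto simp: w_def)
          have "ip T (w l) (cvec (of_real x)) = \<psi> z / (of_real z - of_real x) + \<psi> z / (of_real x - of_real z)"
            unfolding wl ip_add_left[OF l2y l2_scale[OF l2e[OF True]] l2_cvec] y E ..
          also have "\<dots> = 0" by (metis add.right_inverse minus_diff_eq minus_divide_right)
          finally show ?thesis .
        next
          case False
          then have z\<Gamma>: "z \<in> \<Gamma>1 \<union> \<Gamma>2" "l \<notin> CT" using z by auto
          then have "w l = y z" using z(2) by (simp add: w_def)
          then show ?thesis using y \<psi>0[OF z\<Gamma>(1)] by simp
        qed
        then show ?thesis unfolding c ip_scale_right by simp
      qed
    qed
    have w_nz: "ip T (w l) (kvec l) \<noteq> 0" if l: "l \<in> \<Lambda>" for l
    proof
      assume 0: "ip T (w l) (kvec l) = 0"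
      \<comment> \<open>Otherwise \<open>w l\<close> is orthogonal to the complete system of all kernels.\<close>
      have "w l t = 0" for t
      proof (rule ip_zero_imp_zero[OF l2w])
        fix b assume b: "l2_on T b"
        show "ip T b (w l) = 0"
        proof (rule ip_closure_zero[OF l2k k_complete[OF b] l2w])
          fix f assume "f \<in> kvec ` \<Lambda>"
          then have "ip T (w l) f = 0" using 0 w_off[OF l] by auto
          then show "ip T f (w l) = 0" by (metis ip_cnj complex_cnj_zero)
        qed
      qed
      moreover obtain s where s: "s \<in> T'" using T'(2) by (metis ex_in_conv finite.emptyI)
      obtain z where z: "z \<in> \<Gamma>1 \<union> \<Gamma>2 \<union> (T - T')" "l = of_real z" using l by (auto simp: \<Lambda>_eq)
      have "z \<noteq> s" using z(1) s \<Gamma>(2) T'(1) by blast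
      then have "w l s \<noteq> 0" using s z(2) T'(1) U by (auto simp: w_def e_def y_def)
      ultimately show False by blast
    qed
    define g where "g l = (\<lambda>t. (1 / (of_real (pi\<^sup>2) * ip T (w l) (kvec l))) * w l t)" for l
    have l2g: "l2_on T (g l)" for l unfolding g_def by (rule l2_scale[OF l2w])
    have l2g': "\<And>f. f \<in> g ` \<Lambda> \<Longrightarrow> l2_on T f" using l2g by auto
    have bi: "of_real (pi\<^sup>2) * ip T (g l) (kvec \<nu>) = (if l = \<nu> then 1 else 0)" if "l \<in> \<Lambda>" "\<nu> \<in> \<Lambda>" for l \<nu>
      unfolding g_def ip_scale_left using w_off[OF that] w_nz[OF that(1)] by auto
    have w_cl: "w l \<in> l2_closure T (g ` \<Lambda>)" if "l \<in> \<Lambda>" for l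
    proof (rule scaled[OF l2g'])
      show "g l \<in> g ` \<Lambda>" using that by blast
      show "1 / (of_real (pi\<^sup>2) * ip T (w l) (kvec l)) \<noteq> 0" using w_nz[OF that] by simp
    qed (simp_all add: g_def)
    have unit_g': "e s \<in> l2_closure T (g ` \<Lambda>)" if "s \<in> T'" for s
      unfolding e_def
    proof (rule unit_in_closure[OF l2g' T'(1) that, where \<Gamma> = "\<Gamma>1 \<union> \<Gamma>2" and W = U])
      fix x assume x: "x \<in> \<Gamma>1 \<union> \<Gamma>2"
      then have "complex_of_real x \<notin> CT" using \<Gamma>(2) by auto
      then have "w (of_real x) = y x" by (simp add: w_def)
      then show "(\<lambda>t. if t \<in> T then complex_of_real (U t) / (of_real x - of_real t) else 0) \<in> l2_closure T (g ` \<Lambda>)"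
        using w_cl[of "of_real x"] x by (auto simp: \<Lambda>_eq y_def[abs_def])
    qed (use U aU[OF that] in auto)
    have supp_g: "a \<in> l2_closure T (g ` \<Lambda>)" if "l2_on T a" "\<And>t. t \<notin> T' \<Longrightarrow> a t = 0" for a
      by (rule closure_supported[OF l2g' _ T'(1) that]) (use unit_g' in \<open>auto simp: e_def\<close>)
    \<comment> \<open>At \<open>s\<close> off \<open>T'\<close> the only contribution to
      \<open>w\<close> is the corrected one, nonzero by \<open>w_nz\<close>. Since
      \<open>y s\<close> is supported on \<open>T'\<close> it already lies in the closure, and
      subtracting it isolates the unit vector.\<close>
    have unit_g: "e s \<in> l2_closure T (g ` \<Lambda>)" if s: "s \<in> T - T'" for s
    proof -
      have s\<Lambda>: "complex_of_real s \<in> \<Lambda>" using s by (auto simp: \<Lambda>_eq)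
      have w: "w (of_real s) = (\<lambda>t. y s t + \<psi> s / of_real (V s) * e s t)" using s by (auto simp: w_def)
      obtain c where c: "kvec (of_real s) = (\<lambda>t. c * e s t)" using kT s by blast
      have "ip T (w (of_real s)) (kvec (of_real s)) = cnj c * w (of_real s) s"
        unfolding c ip_scale_right using ip_unit_right[of s T "w (of_real s)" 1] s by (simp add: e_def)
      also have "w (of_real s) s = \<psi> s / of_real (V s)" using s by (simp add: w y0 e_def)
      finally have nz: "\<psi> s / of_real (V s) \<noteq> 0" using w_nz[OF s\<Lambda>] by auto
      have "y s \<in> l2_closure T (g ` \<Lambda>)" by (rule supp_g[OF l2y y0])
      then have "(\<lambda>t. (1 / (\<psi> s / of_real (V s))) * (w (of_real s) t + (-1) * y s t)) \<in> l2_closure T (g ` \<Lambda>)"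
        by (intro closure_scale[OF l2g'] closure_add[OF l2g'] w_cl[OF s\<Lambda>])
      moreover have "(\<lambda>t. (1 / (\<psi> s / of_real (V s))) * (w (of_real s) t + (-1) * y s t)) = e s"
        unfolding w using nz by (auto simp: fun_eq_iff)
      ultimately show ?thesis by simp
    qed
    have g_complete: "a \<in> l2_closure T (g ` \<Lambda>)" if "l2_on T a" for a
    proof (rule closure_supported[OF l2g' _ order_refl that])
      fix s assume "s \<in> T"
      then show "(\<lambda>t. if t = s then 1 else 0) \<in> l2_closure T (g ` \<Lambda>)"
        using unit_g[of s] unit_g'[of s] unfolding e_def by blast
    qed (auto intro: l2_zero[OF that])
    define \<beta> where "\<beta> k s = complex_of_real (B s * s ^ k)" for k s
    have l2\<beta>: "l2_on T (\<beta> k)" for k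
      unfolding l2_on_def \<beta>_def norm_of_real power2_abs using Bs[of k] B0 T'(1) by auto
    have neg: "((\<lambda>s. B s * s ^ k * W s / (x - s)) has_sum 0) T"
      if "((\<lambda>s. B s * s ^ k * W s / (s - x)) has_sum 0) T" for W x k
    proof -
      have "B s * s ^ k * W s / (x - s) = - (B s * s ^ k * W s / (s - x))" for s
        by (metis minus_diff_eq minus_divide_right)
      then show ?thesis using has_sum_cmult_right[OF that, of "-1"] by simp
    qed
    have "M_basis_fam H inn \<Lambda> (dB_kernel T \<mu> A)" "biorth_fam H inn \<Lambda> (dB_kernel T \<mu> A) (\<lambda>l. lift (g l))"
      by (rule M_basis_lift[OF l2g bi k_complete g_complete]; assumption)+
    moreover have "\<Lambda>1 \<inter> \<Lambda>2 = {}" using \<Gamma> by (auto simp: \<Lambda>1_def \<Lambda>2_def)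
    moreover have "defect_infinite H inn \<Lambda>1 \<Lambda>2 (dB_kernel T \<mu> A) (\<lambda>l. lift (g l))"
    proof (rule defect_infinite_lift[OF l2\<beta> l2g])
      fix k l assume "l \<in> \<Lambda>1"
      then obtain x where x: "x \<in> \<Gamma>1" "l = of_real x" by (auto simp: \<Lambda>1_def)
      then have "l \<notin> CT" using \<Gamma>(2) by auto
      then have w: "w l = y x" using x(2) by (simp add: w_def)
      have "ip T (\<beta> k) (y x) = (\<Sum>\<^sub>\<infinity>s\<in>T. complex_of_real (B s * s ^ k * U s / (x - s)))"
        unfolding ip_def by (rule infsum_cong) (simp add: \<beta>_def y_def)
      also have "\<dots> = 0" by (rule infsum_of_real_zero[OF neg[OF BU[OF x(1)]]])
      finally show "ip T (\<beta> k) (g l) = 0" unfolding g_def ip_scale_right w by simp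
    next
      fix k l assume "l \<in> \<Lambda>2"
      then obtain x where x: "x \<in> \<Gamma>2 \<union> (T - T')" "l = of_real x" by (auto simp: \<Lambda>2_def)
      show "ip T (\<beta> k) (kvec l) = 0"
      proof (cases "x \<in> \<Gamma>2")
        case True
        then obtain c where c: "kvec l = (\<lambda>t. c * cvec (of_real x) t)" using k\<Gamma>[of x] x(2) by blast
        have "ip T (\<beta> k) (cvec (of_real x)) = (\<Sum>\<^sub>\<infinity>s\<in>T. complex_of_real (B s * s ^ k * V s / (x - s)))"
          unfolding ip_def by (rule infsum_cong) (simp add: \<beta>_def cv)
        also have "\<dots> = 0" by (rule infsum_of_real_zero[OF neg[OF BV[OF True]]])
        finally show ?thesis unfolding c ip_scale_right by simp
      next
        case False
        then have s: "x \<in> T" "x \<notin> T'" using x(1) by auto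
        then obtain c where c: "kvec l = (\<lambda>t. c * e x t)" using kT x(2) by blast
        show ?thesis unfolding c ip_scale_right
          using ip_unit_right[OF s(1), of "\<beta> k" 1] B0[OF s(2)] by (simp add: e_def \<beta>_def)
      qed
    next
      fix n c assume 0: "\<And>t. (\<Sum>i<n. c i * \<beta> i t) = 0"
      \<comment> \<open>Dividing by \<open>B s\<close>, nonzero on \<open>T'\<close>, turns a linear
        dependence into a polynomial with infinitely many zeros.\<close>
      have "(\<Sum>i<n. c i * of_real s ^ i) = 0" if "s \<in> T'" for s
      proof -
        have "(\<Sum>i<n. c i * \<beta> i s) = of_real (B s) * (\<Sum>i<n. c i * of_real s ^ i)"
          by (simp add: \<beta>_def sum_distrib_left mult_ac)
        then show ?thesis using 0[of s] B that by auto
      qed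
      then show "\<forall>i<n. c i = 0" using polynomial_vanishing_on_infinite_reals[OF T'(2)] by blast
    qed
    ultimately show "\<exists>\<Lambda> \<Lambda>1 \<Lambda>2 g. M_basis_fam H inn \<Lambda> (dB_kernel T \<mu> A) \<and>
        biorth_fam H inn \<Lambda> (dB_kernel T \<mu> A) g \<and> \<Lambda>1 \<inter> \<Lambda>2 = {} \<and> \<Lambda>1 \<union> \<Lambda>2 = \<Lambda> \<and>
        defect_infinite H inn \<Lambda>1 \<Lambda>2 (dB_kernel T \<mu> A) g"
      using \<Lambda>_def by blast
  qed
qed

end
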